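(* Assume $\chi_{\rm res}\le\chi_0<1$ (so that kernel coercivity $\operatorname{Re}a(w,w)\ge c_W\|w\|_k^2$ holds for $w\in\ker I_H$) and $\gamma_h(k)>0$. Let $F\in V^\star$ with fine-grid Galerkin solution $u_h$, let $\ell$ be an oversampling level, and let $U\in V_h$ satisfy $R_U(y)=0$ for every $y\in Y_{H,\ell}$. Then $$\|u_h-U\|_k\le C_{\rm sd}\Big(c_W^{-1}+\frac{C_IC_F}{\gamma_h(k)}\,\delta_\ell\Big)\eta_H(U).$$ In particular, $$\frac{\eta_H(U)}{C_aC_{\rm syn}}\le\|u_h-U\|_k\le C_{\rm sd}\Big(c_W^{-1}+\frac{C_IC_FC_{\rm sd}}{\gamma_h(k)\,c_W}\,\Theta_\ell\Big)\eta_H(U).$$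
   Context: **Problem.** $\Omega\subset\mathbb R^2$ is a bounded polygonal Lipschitz domain whose (fixed) boundary partition consists of relatively open parts $\Gamma_D,\Gamma_N,\Gamma_R$, disjoint up to endpoints, with $|\Gamma_R|>0$; $k\ge k_{\min}>0$. $V=\{v\in H^1(\Omega;\mathbb C): v|_{\Gamma_D}=0\}$. $L^2$ inner products are linear in the first and conjugate linear in the second argument. For $v,w\in V$, $$b_k(v,w)=(\nabla v,\nabla w)_\Omega+k^2(v,w)_\Omega,\quad \|v\|_k^2=b_k(v,v),\quad a(v,w)=(\nabla v,\nabla w)_\Omega-k^2(v,w)_\Omega-\mathrm i k(v,w)_{\Gamma_R}.$$ $C_a$ is a continuity constant: $|a(v,w)|\le C_a\|v\|_k\|w\|_k$ on $V$. $X^\star$ is the continuous anti-dual of a subspace $X\subseteq V$. **Meshes and patches.** $\mathcal T_H$ and its refinement $\mathcal T_h$ are shape-regular conforming triangular meshes resolving the boundary partition; $V_H\subseteq V_h\subset V$ are the associated continuous piecewise affine spaces; $H|_T=H_T=\operatorname{diam}T$ for $T\in\mathcal T_H$; $\mathcal N_H$ is the set of all coarse vertices (including Dirichlet vertices). For a coarse entity or a union of entities $S$: $N^0(S)=S$, $N(S)=\bigcup\{T\in\mathcal T_H:\overline T\cap\overline S\ne\varnothing\}$, $N^m(S)=N(N^{m-1}(S))$; $N^\infty(T)=\Omega$; $C_{\rm patch}(m)=\max_{T}\#\{K\in\mathcal T_H:K\subseteq N^m(T)\}$. **Quasi-interpolation and kernel.** $I_H=E_H\Pi_H^{\rm dg}:V\to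 V_H$, where $\Pi_H^{\rm dg}$ is the elementwise $L^2$ projection onto discontinuous piecewise affine functions and, for coarse vertices $z$, $(E_Hq)(z)=0$ if $z\in\overline{\Gamma_D}$ and $(E_Hq)(z)=\big(\sum_{T\ni z}q|_T(z)|T|\big)/\big(\sum_{T\ni z}|T|\big)$ otherwise; $I_H$ is a projection onto $V_H$. $C_{\rm app}$ is such that $H_T^{-1}\|v-I_Hv\|_{L^2(T)}\le C_{\rm app}\|\nabla v\|_{L^2(N(T))}$, and $C_I$ (depending only on $\chi_0$ and fixed-order patch geometry) is such that $\|I_Hv\|_k\le C_I\|v\|_k$ and $\|v-I_Hv\|_k\le(1+C_I)\|v\|_k$ for $v\in V$. $W_h=\ker I_H\cap V_h$, $\chi_{\rm res}=C_{\rm app}C_{\rm patch}(1)^{1/2}\|kH\|_{L^\infty(\Omega)}$, $c_W=(1-\chi_{\rm res}^2)/(1+\chi_{\rm res}^2)$, $C_F=1+C_a/c_W$. **Fine-grid problem.** $\gamma_h(k)=\inf_{0\ne v_h\in V_h}\sup_{0\ne w_h\in V_h}|a(v_h,w_h)|/(\|v_h\|_k\|w_h\|_k)$. $u_h\in V_h$ solves $a(u_h,v_h)=F(v_h)$ for all $v_h\in V_h$. **Correctors.** Ideal correctors $\mathcal Q_\infty,\mathcal Q_\infty^*:V_h\to W_h$: $a(\mathcal Q_\infty v_h,w)=a(v_h,w)$, $a(w,\mathcal Q_\infty^*v_h)=a(w,v_h)$ for all $w\in W_h$. Localized correctors, $\ell\in\mathbb N_0\cup\{\infty\}$: let $a_T$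 be $a$ with integrals restricted to $T\in\mathcal T_H$ (Robin integral over $\Gamma_R\cap\overline T$), $W_h(N^\ell(T))=\{w\in W_h:\operatorname{supp}w\subseteq\overline{N^\ell(T)}\}$; for $v_H\in V_H$, $q_{T,\ell}v_H,q_{T,\ell}^*v_H\in W_h(N^\ell(T))$ solve $a(q_{T,\ell}v_H,w)=a_T(v_H,w)$ and $a(w,q_{T,\ell}^*v_H)=a_T(w,v_H)$ for all $w\in W_h(N^\ell(T))$; $\mathcal Q_\ell=\sum_Tq_{T,\ell}$, $\mathcal Q_\ell^*=\sum_Tq_{T,\ell}^*$ on $V_H$ (consistent with the ideal correctors for $\ell=\infty$). $T_\ell^*=I-\mathcal Q_\ell^*$ and $Y_{H,\ell}=T_\ell^*V_H$. **Localization defect.** $\mathcal D_\ell=\mathcal Q_\infty-\mathcal Q_\ell$ and $\mathcal D_\ell^*=\mathcal Q_\infty^*-\mathcal Q_\ell^*$ on $V_H$; $\delta_\ell:=\|\mathcal D_\ell\|_{\mathcal L(V_H,V_h)}=\|\mathcal D_\ell^*\|_{\mathcal L(V_H,V_h)}$, operator norms with respect to $\|\cdot\|_k$ (the two coincide, since the primal and adjoint correctors are related by complex conjugation). **Local spaces, constants, indicators.** For $z\in\mathcal N_H$, $W_{h,z}=\{w\in W_h:\operatorname{supp}w\subseteq\overline{N^2(z)}\}$. $C_{\rm sd},C_{\rm syn}$ are constants (depending only on $\chi_0$, coarse- and fine-mesh shape regularity and fixed-order patch overlap) such that every $w\in W_h$ can be written $w=\sum_{z\in\mathcal N_H}w_z$,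 $w_z\in W_{h,z}$, with $\sum_z\|w_z\|_k^2\le C_{\rm sd}^2\|w\|_k^2$, and such that arbitrary $w_z\in W_{h,z}$ satisfy $\|\sum_zw_z\|_k^2\le C_{\rm syn}^2\sum_z\|w_z\|_k^2$. For $G\in V_h^\star$, $\xi_z(G)\in W_{h,z}$ is defined by $b_k(\xi_z(G),w)=G(w)$ for $w\in W_{h,z}$, and $\eta(G)^2=\sum_{z\in\mathcal N_H}\|\xi_z(G)\|_k^2$. For $U\in V_h$: $R_U=F-a(U,\cdot)$ and $\eta_H(U)=\eta(R_U)$. Finally $G_\ell(v_H)(w)=\overline{a(w,T_\ell^*v_H)}$ for $v_H\in V_H$, and $\Theta_\ell=\sup_{0\ne v_H\in V_H}\eta(G_\ell(v_H))/\|v_H\|_k$. *)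

theory Defs
  imports "HOL-Analysis.Analysis" "HOL-Library.Extended_Nat"
begin

type_synonym plane = "real^2"
type_synonym field = "plane \<Rightarrow> complex"


subsection \<open>Polygonal Lipschitz domains and arc length\<close>

definition lipschitz_domain :: "plane set \<Rightarrow> bool" where
  "lipschitz_domain \<Omega> \<longleftrightarrow> open \<Omega> \<and> connected \<Omega> \<and> \<Omega> \<noteq> {} \<and>
    (\<forall>x\<in>frontier \<Omega>. \<exists>r>0. \<exists>e1 e2 :: plane. \<exists>(g :: real \<Rightarrow> real) L.
        norm e1 = 1 \<and> norm e2 = 1 \<and> e1 \<bullet> e2 = 0 \<and> L-lipschitz_on UNIV g \<and>
        \<Omega> \<inter> ball x r = {y \<in> ball x r. (y - x) \<bullet> e2 > g ((y - x) \<bullet> e1)})"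

definition polygonal :: "plane set \<Rightarrow> bool" where
  "polygonal \<Omega> \<longleftrightarrow> (\<exists>S :: (plane \<times> plane) set. finite S \<and>
      frontier \<Omega> = (\<Union>(a, b)\<in>S. closed_segment a b))"

definition hausdorff1_outer :: "plane set \<Rightarrow> ennreal" where
  "hausdorff1_outer A = (SUP \<delta>\<in>{0<..}.
      INF C\<in>{C :: nat \<Rightarrow> plane set. A \<subseteq> (\<Union>n. C n) \<and> (\<forall>n. bounded (C n) \<and> diameter (C n) \<le> \<delta>)}.
        \<Sum>n. ennreal (diameter (C n)))"

text \<open>
  One-dimensional Hausdorff measure; on a polygonal boundary it is arc length. The outer measure
  above is a metric outer measure, hence countably additive on Borel sets (Caratheodory), so that
  \<^const>\<open>measure_of\<close> does not collapse to the null measure here.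
\<close>

definition arclength :: "plane measure" where
  "arclength = measure_of UNIV (sets borel) hausdorff1_outer"

definition boundary_partition :: "plane set \<Rightarrow> plane set \<Rightarrow> plane set \<Rightarrow> plane set \<Rightarrow> bool" where
  "boundary_partition \<Omega> D N R \<longleftrightarrow>
    (\<forall>G\<in>{D, N, R}. openin (top_of_set (frontier \<Omega>)) G) \<and>
    D \<inter> N = {} \<and> D \<inter> R = {} \<and> N \<inter> R = {} \<and>
    finite (closure D \<inter> closure N) \<and> finite (closure D \<inter> closure R) \<and> finite (closure N \<inter> closure R) \<and>
    closure D \<union> closure N \<union> closure R = frontier \<Omega>"


subsection \<open>Sobolev functions\<close>

text \<open>
  Elements of \<open>L\<^sup>2(\<Omega>)\<close> and \<open>H\<^sup>1(\<Omega>)\<close> are represented by functions on the whole plane, of which only the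
  values almost everywhere on \<open>\<Omega>\<close> matter.
\<close>

definition L2_on :: "plane set \<Rightarrow> field \<Rightarrow> bool" where
  "L2_on \<Omega> v \<longleftrightarrow> set_borel_measurable lebesgue \<Omega> v \<and> set_integrable lebesgue \<Omega> (\<lambda>x. (cmod (v x))\<^sup>2)"

definition pderiv_at :: "2 \<Rightarrow> (plane \<Rightarrow> real) \<Rightarrow> plane \<Rightarrow> real" where
  "pderiv_at i \<phi> x = frechet_derivative \<phi> (at x) (axis i 1)"

text \<open>
  Test functions are compactly supported and continuously differentiable; by mollification they
  define the same weak derivatives as the smooth ones.
\<close>

definition test_function :: "plane set \<Rightarrow> (plane \<Rightarrow> real) \<Rightarrow> bool" where
  "test_function \<Omega> \<phi> \<longleftrightarrow>
    (\<forall>x. \<phi> differentiable (at x)) \<and> (\<forall>i. continuous_on UNIV (pderiv_at i \<phi>)) \<and>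
    compact (closure {x. \<phi> x \<noteq> 0}) \<and> closure {x. \<phi> x \<noteq> 0} \<subseteq> \<Omega>"

definition weak_gradient :: "plane set \<Rightarrow> field \<Rightarrow> (plane \<Rightarrow> complex^2) \<Rightarrow> bool" where
  "weak_gradient \<Omega> v g \<longleftrightarrow> (\<forall>\<phi> i. test_function \<Omega> \<phi> \<longrightarrow>
      (LINT x:\<Omega>|lebesgue. v x * complex_of_real (pderiv_at i \<phi> x)) =
      - (LINT x:\<Omega>|lebesgue. g x $ i * complex_of_real (\<phi> x)))"

definition L2_gradient :: "plane set \<Rightarrow> field \<Rightarrow> (plane \<Rightarrow> complex^2) \<Rightarrow> bool" where
  "L2_gradient \<Omega> v g \<longleftrightarrow> (\<forall>i. L2_on \<Omega> (\<lambda>x. g x $ i)) \<and> weak_gradient \<Omega> v g"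

definition H1 :: "plane set \<Rightarrow> field set" where
  "H1 \<Omega> = {v. L2_on \<Omega> v \<and> (\<exists>g. L2_gradient \<Omega> v g)}"

text \<open>The weak gradient is unique almost everywhere on \<open>\<Omega>\<close>; its choice does not affect integrals.\<close>

definition grad :: "plane set \<Rightarrow> field \<Rightarrow> plane \<Rightarrow> complex^2" where
  "grad \<Omega> v = (SOME g. L2_gradient \<Omega> v g)"

text \<open>
  For a Lipschitz domain the trace of an \<open>H\<^sup>1\<close> function is, at almost every boundary point with respect
  to arc length, the limit of the averages of the function over \<open>\<Omega> \<inter> ball x r\<close> as \<open>r\<close> tends to \<open>0\<close>.
\<close>

definition local_average :: "plane set \<Rightarrow> field \<Rightarrow> plane \<Rightarrow> real \<Rightarrow> complex" where
  "local_average \<Omega> v x r =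
     (LINT y:(\<Omega> \<inter> ball x r)|lebesgue. v y) / complex_of_real (measure lebesgue (\<Omega> \<inter> ball x r))"

definition has_trace_at :: "plane set \<Rightarrow> field \<Rightarrow> plane \<Rightarrow> complex \<Rightarrow> bool" where
  "has_trace_at \<Omega> v x c \<longleftrightarrow> (local_average \<Omega> v x \<longlongrightarrow> c) (at_right 0)"

definition boundary_trace :: "plane set \<Rightarrow> field \<Rightarrow> field" where
  "boundary_trace \<Omega> v x = Lim (at_right 0) (local_average \<Omega> v x)"


subsection \<open>Triangular meshes and piecewise affine functions\<close>

text \<open>Triangles are closed; two of them meet in a common, possibly empty, face.\<close>

definition triangular_mesh :: "plane set \<Rightarrow> plane set set \<Rightarrow> bool" where
  "triangular_mesh \<Omega> \<T> \<longleftrightarrow> triangulation \<T> \<and> (\<forall>T\<in>\<T>. 2 simplex T) \<and> \<Union>\<T> = closure \<Omega>"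

definition shape_regular :: "real \<Rightarrow> plane set set \<Rightarrow> bool" where
  "shape_regular \<sigma> \<T> \<longleftrightarrow> (\<forall>T\<in>\<T>. \<exists>x r. 0 < r \<and> cball x r \<subseteq> T \<and> diameter T \<le> \<sigma> * r)"

definition refines :: "plane set set \<Rightarrow> plane set set \<Rightarrow> bool" where
  "refines \<T>' \<T> \<longleftrightarrow> (\<forall>K\<in>\<T>'. \<exists>T\<in>\<T>. K \<subseteq> T)"

definition mesh_edges :: "plane set set \<Rightarrow> plane set set" where
  "mesh_edges \<T> = {e. \<exists>T\<in>\<T>. e facet_of T}"

definition resolves :: "plane set set \<Rightarrow> plane set \<Rightarrow> bool" where
  "resolves \<T> G \<longleftrightarrow> (\<exists>E \<subseteq> mesh_edges \<T>. closure G = \<Union>E)"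

definition vertices :: "plane set set \<Rightarrow> plane set" where
  "vertices \<T> = {z. \<exists>T\<in>\<T>. z extreme_point_of T}"

definition affine_field :: "field \<Rightarrow> bool" where
  "affine_field p \<longleftrightarrow> (\<exists>c (b :: complex^2). \<forall>x. p x = c + (\<Sum>i\<in>UNIV. complex_of_real (x $ i) * b $ i))"

text \<open>
  Continuous piecewise affine functions are pinned down on \<open>\<Union>\<T>\<close> and extended by zero, so that
  equality of functions is equality in the finite element space.
\<close>

definition P1 :: "plane set set \<Rightarrow> field set" where
  "P1 \<T> = {v. (\<forall>x. x \<notin> \<Union>\<T> \<longrightarrow> v x = 0) \<and> continuous_on (\<Union>\<T>) v \<and>
              (\<forall>T\<in>\<T>. \<exists>p. affine_field p \<and> (\<forall>x\<in>T. v x = p x))}"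


subsection \<open>The Helmholtz problem\<close>

record helmholtz =
  Omega :: "plane set"
  Gamma_D :: "plane set"
  Gamma_N :: "plane set"
  Gamma_R :: "plane set"
  wavenumber :: real
  TH :: "plane set set"
  Th :: "plane set set"

definition helmholtz_setting :: "helmholtz \<Rightarrow> bool" where
  "helmholtz_setting P \<longleftrightarrow>
     lipschitz_domain (Omega P) \<and> polygonal (Omega P) \<and> bounded (Omega P) \<and>
     boundary_partition (Omega P) (Gamma_D P) (Gamma_N P) (Gamma_R P) \<and>
     0 < emeasure arclength (Gamma_R P) \<and>
     triangular_mesh (Omega P) (TH P) \<and> triangular_mesh (Omega P) (Th P) \<and> refines (Th P) (TH P) \<and>
     (\<forall>\<T>\<in>{TH P, Th P}. \<forall>G\<in>{Gamma_D P, Gamma_N P, Gamma_R P}. resolves \<T> G)"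

definition V :: "helmholtz \<Rightarrow> field set" where
  "V P = {v \<in> H1 (Omega P). AE x in arclength. x \<in> Gamma_D P \<longrightarrow> has_trace_at (Omega P) v x 0}"

definition fe_space :: "helmholtz \<Rightarrow> plane set set \<Rightarrow> field set" where
  "fe_space P \<T> = {v \<in> P1 \<T>. \<forall>x\<in>Gamma_D P. v x = 0}"

abbreviation V_H :: "helmholtz \<Rightarrow> field set" where "V_H P \<equiv> fe_space P (TH P)"
abbreviation V_h :: "helmholtz \<Rightarrow> field set" where "V_h P \<equiv> fe_space P (Th P)"

definition grad_ip :: "helmholtz \<Rightarrow> plane set \<Rightarrow> field \<Rightarrow> field \<Rightarrow> complex" where
  "grad_ip P S v w = (LINT x:S|lebesgue. \<Sum>i\<in>UNIV. grad (Omega P) v x $ i * cnj (grad (Omega P) w x $ i))"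

definition L2_ip :: "plane set \<Rightarrow> field \<Rightarrow> field \<Rightarrow> complex" where
  "L2_ip S v w = (LINT x:S|lebesgue. v x * cnj (w x))"

definition boundary_ip :: "helmholtz \<Rightarrow> plane set \<Rightarrow> field \<Rightarrow> field \<Rightarrow> complex" where
  "boundary_ip P G v w = (LINT x:G|arclength. boundary_trace (Omega P) v x * cnj (boundary_trace (Omega P) w x))"

definition L2_norm :: "plane set \<Rightarrow> field \<Rightarrow> real" where
  "L2_norm S v = sqrt (Re (L2_ip S v v))"

definition grad_norm :: "helmholtz \<Rightarrow> plane set \<Rightarrow> field \<Rightarrow> real" where
  "grad_norm P S v = sqrt (Re (grad_ip P S v v))"

definition b_form :: "helmholtz \<Rightarrow> field \<Rightarrow> field \<Rightarrow> complex" where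
  "b_form P v w = grad_ip P (Omega P) v w + complex_of_real ((wavenumber P)\<^sup>2) * L2_ip (Omega P) v w"

definition knorm :: "helmholtz \<Rightarrow> field \<Rightarrow> real" where
  "knorm P v = sqrt (Re (b_form P v v))"

definition a_on :: "helmholtz \<Rightarrow> plane set \<Rightarrow> plane set \<Rightarrow> field \<Rightarrow> field \<Rightarrow> complex" where
  "a_on P S G v w = grad_ip P S v w - complex_of_real ((wavenumber P)\<^sup>2) * L2_ip S v w
                    - \<i> * complex_of_real (wavenumber P) * boundary_ip P G v w"

definition a_form :: "helmholtz \<Rightarrow> field \<Rightarrow> field \<Rightarrow> complex" where
  "a_form P = a_on P (Omega P) (Gamma_R P)"

definition a_loc :: "helmholtz \<Rightarrow> plane set \<Rightarrow> field \<Rightarrow> field \<Rightarrow> complex" where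
  "a_loc P T = a_on P T (Gamma_R P \<inter> T)"

definition antidual :: "helmholtz \<Rightarrow> field set \<Rightarrow> (field \<Rightarrow> complex) set" where
  "antidual P X = {F. (\<forall>v\<in>X. \<forall>w\<in>X. F (\<lambda>x. v x + w x) = F v + F w) \<and>
                      (\<forall>c. \<forall>v\<in>X. F (\<lambda>x. c * v x) = cnj c * F v) \<and>
                      (\<exists>C. \<forall>v\<in>X. cmod (F v) \<le> C * knorm P v)}"

definition continuity_constant :: "helmholtz \<Rightarrow> real \<Rightarrow> bool" where
  "continuity_constant P C \<longleftrightarrow> 0 \<le> C \<and>
     (\<forall>v\<in>V P. \<forall>w\<in>V P. cmod (a_form P v w) \<le> C * knorm P v * knorm P w)"

definition inf_sup :: "helmholtz \<Rightarrow> real" where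
  "inf_sup P = (INF v\<in>V_h P - {\<lambda>_. 0}. SUP w\<in>V_h P - {\<lambda>_. 0}.
                  cmod (a_form P v w) / (knorm P v * knorm P w))"

definition galerkin_solution :: "helmholtz \<Rightarrow> (field \<Rightarrow> complex) \<Rightarrow> field \<Rightarrow> bool" where
  "galerkin_solution P F u \<longleftrightarrow> u \<in> V_h P \<and> (\<forall>v\<in>V_h P. a_form P u v = F v)"


subsection \<open>Patches\<close>

definition nbhd :: "helmholtz \<Rightarrow> plane set \<Rightarrow> plane set" where
  "nbhd P S = \<Union>{T \<in> TH P. closure T \<inter> closure S \<noteq> {}}"

definition patch :: "helmholtz \<Rightarrow> enat \<Rightarrow> plane set \<Rightarrow> plane set" where
  "patch P l S = (case l of enat m \<Rightarrow> (nbhd P ^^ m) S | \<infinity> \<Rightarrow> Omega P)"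

definition C_patch :: "helmholtz \<Rightarrow> nat \<Rightarrow> nat" where
  "C_patch P m = (MAX T\<in>TH P. card {K \<in> TH P. K \<subseteq> patch P (enat m) T})"

definition supp :: "helmholtz \<Rightarrow> field \<Rightarrow> plane set" where
  "supp P w = closure {x \<in> Omega P. w x \<noteq> 0}"


subsection \<open>Quasi-interpolation and its kernel\<close>

definition dg_projection :: "plane set \<Rightarrow> field \<Rightarrow> field" where
  "dg_projection T v = (THE p. affine_field p \<and>
     (\<forall>q. affine_field q \<longrightarrow> L2_ip T (\<lambda>x. v x - p x) q = 0))"

text \<open>The argument \<open>q\<close> is a discontinuous piecewise affine function, \<open>q T\<close> being its restriction to \<open>T\<close>.\<close>

definition nodal_average :: "helmholtz \<Rightarrow> (plane set \<Rightarrow> field) \<Rightarrow> field" where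
  "nodal_average P q z = (if z \<in> closure (Gamma_D P) then 0 else
      (\<Sum>T\<in>{T \<in> TH P. z \<in> T}. q T z * complex_of_real (measure lebesgue T)) /
      (\<Sum>T\<in>{T \<in> TH P. z \<in> T}. complex_of_real (measure lebesgue T)))"

definition E_H :: "helmholtz \<Rightarrow> (plane set \<Rightarrow> field) \<Rightarrow> field" where
  "E_H P q = (THE v. v \<in> P1 (TH P) \<and> (\<forall>z\<in>vertices (TH P). v z = nodal_average P q z))"

definition I_H :: "helmholtz \<Rightarrow> field \<Rightarrow> field" where
  "I_H P v = E_H P (\<lambda>T. dg_projection T v)"

definition W_h :: "helmholtz \<Rightarrow> field set" where
  "W_h P = {w \<in> V_h P. I_H P w = (\<lambda>_. 0)}"

definition approximation_constant :: "helmholtz \<Rightarrow> real \<Rightarrow> bool" where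
  "approximation_constant P C \<longleftrightarrow> 0 \<le> C \<and>
     (\<forall>v\<in>V P. \<forall>T\<in>TH P.
        inverse (diameter T) * L2_norm T (\<lambda>x. v x - I_H P v x) \<le> C * grad_norm P (nbhd P T) v)"

definition stability_constant :: "helmholtz \<Rightarrow> real \<Rightarrow> bool" where
  "stability_constant P C \<longleftrightarrow> 0 \<le> C \<and>
     (\<forall>v\<in>V P. knorm P (I_H P v) \<le> C * knorm P v \<and>
               knorm P (\<lambda>x. v x - I_H P v x) \<le> (1 + C) * knorm P v)"

text \<open>
  The maximum is the \<open>L\<^sup>\<infinity>\<close> norm of \<open>kH\<close>, as the mesh size \<open>H\<close> is piecewise constant with value
  \<^term>\<open>diameter T\<close> on \<open>T\<close>.
\<close>

definition chi_res :: "helmholtz \<Rightarrow> real \<Rightarrow> real" where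
  "chi_res P Capp = Capp * sqrt (real (C_patch P 1)) * (MAX T\<in>TH P. wavenumber P * diameter T)"

definition c_W :: "helmholtz \<Rightarrow> real \<Rightarrow> real" where
  "c_W P Capp = (1 - (chi_res P Capp)\<^sup>2) / (1 + (chi_res P Capp)\<^sup>2)"

definition C_F :: "helmholtz \<Rightarrow> real \<Rightarrow> real \<Rightarrow> real" where
  "C_F P Ca Capp = 1 + Ca / c_W P Capp"


subsection \<open>Correctors and localization defect\<close>

definition Q_inf :: "helmholtz \<Rightarrow> field \<Rightarrow> field" where
  "Q_inf P v = (THE q. q \<in> W_h P \<and> (\<forall>w\<in>W_h P. a_form P q w = a_form P v w))"

definition Q_inf_adj :: "helmholtz \<Rightarrow> field \<Rightarrow> field" where
  "Q_inf_adj P v = (THE q. q \<in> W_h P \<and> (\<forall>w\<in>W_h P. a_form P w q = a_form P w v))"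

definition W_patch :: "helmholtz \<Rightarrow> enat \<Rightarrow> plane set \<Rightarrow> field set" where
  "W_patch P l T = {w \<in> W_h P. supp P w \<subseteq> closure (patch P l T)}"

definition q_loc :: "helmholtz \<Rightarrow> enat \<Rightarrow> plane set \<Rightarrow> field \<Rightarrow> field" where
  "q_loc P l T v = (THE q. q \<in> W_patch P l T \<and> (\<forall>w\<in>W_patch P l T. a_form P q w = a_loc P T v w))"

definition q_loc_adj :: "helmholtz \<Rightarrow> enat \<Rightarrow> plane set \<Rightarrow> field \<Rightarrow> field" where
  "q_loc_adj P l T v = (THE q. q \<in> W_patch P l T \<and> (\<forall>w\<in>W_patch P l T. a_form P w q = a_loc P T w v))"

definition Q_loc :: "helmholtz \<Rightarrow> enat \<Rightarrow> field \<Rightarrow> field" where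
  "Q_loc P l v = (\<lambda>x. \<Sum>T\<in>TH P. q_loc P l T v x)"

definition Q_loc_adj :: "helmholtz \<Rightarrow> enat \<Rightarrow> field \<Rightarrow> field" where
  "Q_loc_adj P l v = (\<lambda>x. \<Sum>T\<in>TH P. q_loc_adj P l T v x)"

definition T_adj :: "helmholtz \<Rightarrow> enat \<Rightarrow> field \<Rightarrow> field" where
  "T_adj P l v = (\<lambda>x. v x - Q_loc_adj P l v x)"

definition Y_H :: "helmholtz \<Rightarrow> enat \<Rightarrow> field set" where
  "Y_H P l = T_adj P l ` V_H P"

definition defect :: "helmholtz \<Rightarrow> enat \<Rightarrow> field \<Rightarrow> field" where
  "defect P l v = (\<lambda>x. Q_inf P v x - Q_loc P l v x)"

definition defect_adj :: "helmholtz \<Rightarrow> enat \<Rightarrow> field \<Rightarrow> field" where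
  "defect_adj P l v = (\<lambda>x. Q_inf_adj P v x - Q_loc_adj P l v x)"

text \<open>
  In this supremum and in the one for \<open>\<Theta>\<close> below, \<open>v = 0\<close> contributes \<open>x / 0 = 0\<close>, which only matters
  if \<open>V_H\<close> is trivial.
\<close>

definition op_norm_VH :: "helmholtz \<Rightarrow> (field \<Rightarrow> field) \<Rightarrow> real" where
  "op_norm_VH P A = (SUP v\<in>V_H P. knorm P (A v) / knorm P v)"

text \<open>
  The operator norms of \<^term>\<open>defect P l\<close> and \<^term>\<open>defect_adj P l\<close> coincide, by complex
  conjugation of the corrector problems; the first one serves as definition.
\<close>

definition delta :: "helmholtz \<Rightarrow> enat \<Rightarrow> real" where
  "delta P l = op_norm_VH P (defect P l)"


subsection \<open>Local spaces and indicators\<close>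

definition W_node :: "helmholtz \<Rightarrow> plane \<Rightarrow> field set" where
  "W_node P z = {w \<in> W_h P. supp P w \<subseteq> closure (patch P (enat 2) {z})}"

definition stable_decomposition_constant :: "helmholtz \<Rightarrow> real \<Rightarrow> bool" where
  "stable_decomposition_constant P C \<longleftrightarrow> 0 \<le> C \<and>
     (\<forall>w\<in>W_h P. \<exists>f :: plane \<Rightarrow> field.
        (\<forall>z\<in>vertices (TH P). f z \<in> W_node P z) \<and>
        w = (\<lambda>x. \<Sum>z\<in>vertices (TH P). f z x) \<and>
        (\<Sum>z\<in>vertices (TH P). (knorm P (f z))\<^sup>2) \<le> C\<^sup>2 * (knorm P w)\<^sup>2)"

definition synthesis_constant :: "helmholtz \<Rightarrow> real \<Rightarrow> bool" where
  "synthesis_constant P C \<longleftrightarrow> 0 \<le> C \<and>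
     (\<forall>f :: plane \<Rightarrow> field. (\<forall>z\<in>vertices (TH P). f z \<in> W_node P z) \<longrightarrow>
        (knorm P (\<lambda>x. \<Sum>z\<in>vertices (TH P). f z x))\<^sup>2
          \<le> C\<^sup>2 * (\<Sum>z\<in>vertices (TH P). (knorm P (f z))\<^sup>2))"

definition xi :: "helmholtz \<Rightarrow> plane \<Rightarrow> (field \<Rightarrow> complex) \<Rightarrow> field" where
  "xi P z G = (THE q. q \<in> W_node P z \<and> (\<forall>w\<in>W_node P z. b_form P q w = G w))"

definition eta :: "helmholtz \<Rightarrow> (field \<Rightarrow> complex) \<Rightarrow> real" where
  "eta P G = sqrt (\<Sum>z\<in>vertices (TH P). (knorm P (xi P z G))\<^sup>2)"

definition residual :: "helmholtz \<Rightarrow> (field \<Rightarrow> complex) \<Rightarrow> field \<Rightarrow> field \<Rightarrow> complex" where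
  "residual P F U = (\<lambda>w. F w - a_form P U w)"

definition eta_H :: "helmholtz \<Rightarrow> (field \<Rightarrow> complex) \<Rightarrow> field \<Rightarrow> real" where
  "eta_H P F U = eta P (residual P F U)"

definition G_loc :: "helmholtz \<Rightarrow> enat \<Rightarrow> field \<Rightarrow> field \<Rightarrow> complex" where
  "G_loc P l v = (\<lambda>w. cnj (a_form P w (T_adj P l v)))"

definition Theta :: "helmholtz \<Rightarrow> enat \<Rightarrow> real" where
  "Theta P l = (SUP v\<in>V_H P. eta P (G_loc P l v) / knorm P v)"

end

theory Submission
  imports Defs
begin

text \<open>
  Let \<open>e = u\<^sub>h - U\<close> be the error and \<open>R\<close> the residual of \<open>U\<close>, so that \<open>a(e, v) = R(v)\<close> for all fine
  functions \<open>v\<close>. The error is split into its kernel part \<open>q = Q\<^sub>\<infinity> e\<close>, which lies in \<open>W\<^sub>h\<close>, and the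
  remainder \<open>r = e - q\<close>, which satisfies \<open>a(r, w) = 0\<close> for all \<open>w\<close> in \<open>W\<^sub>h\<close>.

  The form \<open>a\<close> is coercive on \<open>W\<^sub>h\<close> (\<open>kernel_coercive\<close>), so \<open>c\<^sub>W \<parallel>q\<parallel>\<^sup>2 \<le> |a(q, q)| = |R(q)|\<close>. Decomposing a
  kernel function stably into nodal contributions and testing each of them against the local Riesz
  representative bounds \<open>R\<close> on \<open>W\<^sub>h\<close> by \<open>C\<^sub>s\<^sub>d \<eta> \<parallel>\<sqdot>\<parallel>\<close> (\<open>eta_reliable\<close>). Hence \<open>\<parallel>q\<parallel> \<le> C\<^sub>s\<^sub>d \<eta> / c\<^sub>W\<close>.

  For \<open>r\<close> the inf-sup constant is used. Given a fine test function \<open>v\<close>, put \<open>g = I\<^sub>H v\<close>. As \<open>v - g\<close> and the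
  ideal adjoint correction \<open>Q\<^sub>\<infinity>\<^sup>* g\<close> lie in \<open>W\<^sub>h\<close>, one has \<open>a(r, v) = a(r, g - Q\<^sub>\<infinity>\<^sup>* g)\<close>. By definition of the
  adjoint corrector, \<open>a(q, g - Q\<^sub>\<infinity>\<^sup>* g) = 0\<close>, so this is \<open>R(g - Q\<^sub>\<infinity>\<^sup>* g)\<close>. The function \<open>g - Q\<^sub>\<infinity>\<^sup>* g\<close> differs
  from the test function \<open>T\<^sub>\<ell>\<^sup>* g\<close>, at which \<open>R\<close> vanishes, by the defect \<open>D\<^sub>\<ell>\<^sup>* g\<close>, a kernel function.
  Therefore \<open>|a(r, v)| = |R(D\<^sub>\<ell>\<^sup>* g)|\<close> is bounded by \<open>C\<^sub>s\<^sub>d \<eta> \<parallel>D\<^sub>\<ell>\<^sup>* g\<parallel>\<close>, and \<open>\<parallel>g\<parallel> \<le> C\<^sub>I \<parallel>v\<parallel>\<close> (\<open>reliability\<close>).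
  The factor \<open>C\<^sub>F \<ge> 1\<close> enters by monotonicity.

  It remains to estimate \<open>D\<^sub>\<ell>\<^sup>*\<close>. On the one hand, \<open>a(v, w)\<close> equals \<open>a\<close> at the conjugates of \<open>w\<close> and \<open>v\<close>, so
  complex conjugation turns adjoint corrector problems into primal ones and \<open>\<delta>\<^sub>\<ell>\<close> bounds \<open>D\<^sub>\<ell>\<^sup>*\<close> as well
  (\<open>defect_adj_le_delta\<close>). On the other hand, \<open>D\<^sub>\<ell>\<^sup>* g\<close> solves the kernel problem whose right-hand side is
  the conjugate of \<open>G\<^sub>\<ell>(g)\<close>, so coercivity and \<open>eta_reliable\<close> bound it by \<open>C\<^sub>s\<^sub>d \<Theta>\<^sub>\<ell> / c\<^sub>W\<close>
  (\<open>defect_adj_le_Theta\<close>). The lower bound of the error follows from \<open>\<eta>\<^sup>2 = R(s)\<close>, where \<open>s\<close> is the sum of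
  the local Riesz representatives (\<open>eta_efficient\<close>).

  Most of the work goes into the facts that this argument takes for granted. Sesquilinearity of \<open>a\<close> on
  the fine space rests on the uniqueness of weak gradients (\<open>fundamental_lemma\<close>), on the fact that
  continuous piecewise affine functions have weak gradients (\<open>P1_L2_gradient\<close>) and pointwise traces
  (\<open>P1_trace\<close>), and on the finite length of the boundary (\<open>hausdorff1_outer_segments\<close>). The elementwise
  projections, correctors and local Riesz representatives are all obtained from a single existence
  theorem in finite dimension (\<open>form_representation\<close>), and the quasi-interpolation from nodal
  interpolation on conforming meshes (\<open>nodal_interpolant\<close>).
\<close>

section \<open>Sesquilinear forms on spaces of functions\<close>

text \<open>
  The spaces of interest are sets of functions with pointwise operations, and the forms are
  sesquilinear on these sets only. Linearity is therefore expressed relative to a carrier.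
\<close>

definition fun_subspace :: "('a \<Rightarrow> complex) set \<Rightarrow> bool" where
  "fun_subspace X \<longleftrightarrow> (\<lambda>_. 0) \<in> X \<and> (\<forall>u\<in>X. \<forall>v\<in>X. (\<lambda>x. u x + v x) \<in> X) \<and>
     (\<forall>c. \<forall>u\<in>X. (\<lambda>x. c * u x) \<in> X)"

definition sesq_on :: "('a \<Rightarrow> complex) set \<Rightarrow> (('a \<Rightarrow> complex) \<Rightarrow> ('a \<Rightarrow> complex) \<Rightarrow> complex) \<Rightarrow> bool" where
  "sesq_on X B \<longleftrightarrow>
     (\<forall>u\<in>X. \<forall>v\<in>X. \<forall>w\<in>X. B (\<lambda>x. u x + v x) w = B u w + B v w \<and> B w (\<lambda>x. u x + v x) = B w u + B w v) \<and>
     (\<forall>c. \<forall>u\<in>X. \<forall>w\<in>X. B (\<lambda>x. c * u x) w = c * B u w \<and> B w (\<lambda>x. c * u x) = cnj c * B w u)"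

definition antilinear_on :: "('a \<Rightarrow> complex) set \<Rightarrow> (('a \<Rightarrow> complex) \<Rightarrow> complex) \<Rightarrow> bool" where
  "antilinear_on X G \<longleftrightarrow> (\<forall>u\<in>X. \<forall>v\<in>X. G (\<lambda>x. u x + v x) = G u + G v) \<and>
     (\<forall>c. \<forall>u\<in>X. G (\<lambda>x. c * u x) = cnj c * G u)"

definition psd_on :: "('a \<Rightarrow> complex) set \<Rightarrow> (('a \<Rightarrow> complex) \<Rightarrow> ('a \<Rightarrow> complex) \<Rightarrow> complex) \<Rightarrow> bool" where
  "psd_on X B \<longleftrightarrow> sesq_on X B \<and> (\<forall>u\<in>X. \<forall>v\<in>X. B v u = cnj (B u v)) \<and> (\<forall>u\<in>X. 0 \<le> Re (B u u))"

lemma antilinear_onD: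
  assumes "antilinear_on X G" "u \<in> X"
  shows "v \<in> X \<Longrightarrow> G (\<lambda>x. u x + v x) = G u + G v" "G (\<lambda>x. c * u x) = cnj c * G u"
  using assms by (auto simp: antilinear_on_def)

lemma psd_onD:
  assumes "psd_on X B"
  shows "sesq_on X B" "u \<in> X \<Longrightarrow> v \<in> X \<Longrightarrow> B v u = cnj (B u v)" "u \<in> X \<Longrightarrow> 0 \<le> Re (B u u)"
  using assms unfolding psd_on_def by blast+

lemma psd_onI:
  assumes "sesq_on X B" "\<And>u v. u \<in> X \<Longrightarrow> v \<in> X \<Longrightarrow> B v u = cnj (B u v)" "\<And>u. u \<in> X \<Longrightarrow> 0 \<le> Re (B u u)"
  shows "psd_on X B"
  using assms unfolding psd_on_def by blast

lemma fun_subspaceD: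
  assumes "fun_subspace X"
  shows "(\<lambda>_. 0) \<in> X" "u \<in> X \<Longrightarrow> v \<in> X \<Longrightarrow> (\<lambda>x. u x + v x) \<in> X"
    "u \<in> X \<Longrightarrow> (\<lambda>x. c * u x) \<in> X" "u \<in> X \<Longrightarrow> v \<in> X \<Longrightarrow> (\<lambda>x. u x - v x) \<in> X"
proof -
  have add: "\<And>u v. u \<in> X \<Longrightarrow> v \<in> X \<Longrightarrow> (\<lambda>x. u x + v x) \<in> X"
    and scale: "\<And>c u. u \<in> X \<Longrightarrow> (\<lambda>x. c * u x) \<in> X"
    using assms by (auto simp: fun_subspace_def)
  show "(\<lambda>_. 0) \<in> X" using assms by (simp add: fun_subspace_def)
  show "u \<in> X \<Longrightarrow> v \<in> X \<Longrightarrow> (\<lambda>x. u x + v x) \<in> X" "u \<in> X \<Longrightarrow> (\<lambda>x. c * u x) \<in> X"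
    by (fact add, fact scale)
  show "(\<lambda>x. u x - v x) \<in> X" if "u \<in> X" "v \<in> X"
    using add[OF that(1) scale[OF that(2), of "-1"]] by simp
qed

lemma fun_subspace_sum:
  assumes "fun_subspace X" "finite I" "\<And>i. i \<in> I \<Longrightarrow> f i \<in> X"
  shows "(\<lambda>x. \<Sum>i\<in>I. f i x) \<in> X"
  using assms(2,3)
proof (induction I rule: finite_induct)
  case (insert i I)
  then show ?case using fun_subspaceD(2)[OF assms(1), of "f i" "\<lambda>x. \<Sum>i\<in>I. f i x"] by auto
qed (use assms(1) in \<open>auto simp: fun_subspace_def\<close>)

lemma sesq_onD:
  assumes "sesq_on X B" "u \<in> X" "w \<in> X"
  shows "v \<in> X \<Longrightarrow> B (\<lambda>x. u x + v x) w = B u w + B v w"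
    "v \<in> X \<Longrightarrow> B w (\<lambda>x. u x + v x) = B w u + B w v"
    "B (\<lambda>x. c * u x) w = c * B u w" "B w (\<lambda>x. c * u x) = cnj c * B w u"
  using assms by (auto simp: sesq_on_def)

lemma sesq_on_diff:
  assumes "fun_subspace X" "sesq_on X B" "u \<in> X" "v \<in> X" "w \<in> X"
  shows "B (\<lambda>x. u x - v x) w = B u w - B v w" "B w (\<lambda>x. u x - v x) = B w u - B w v"
proof -
  note m = fun_subspaceD(3)[OF assms(1,4), of "-1"]
  have "B (\<lambda>x. u x + (- 1) * v x) w = B u w - B v w" 
    using sesq_onD(1)[OF assms(2,3,5) m] sesq_onD(3)[OF assms(2,4,5), of "-1"] by simp
  moreover have "B w (\<lambda>x. u x + (- 1) * v x) = B w u - B w v" 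
    using sesq_onD(2)[OF assms(2,3,5) m] sesq_onD(4)[OF assms(2,4,5), of "-1"] by simp
  ultimately show "B (\<lambda>x. u x - v x) w = B u w - B v w" "B w (\<lambda>x. u x - v x) = B w u - B w v" by simp_all
qed

lemma sesq_on_subset: "sesq_on X B \<Longrightarrow> Y \<subseteq> X \<Longrightarrow> sesq_on Y B"
  unfolding sesq_on_def by blast

lemma psd_on_subset: "psd_on X B \<Longrightarrow> Y \<subseteq> X \<Longrightarrow> psd_on Y B"
  unfolding psd_on_def using sesq_on_subset by blast

lemma sesq_on_add:
  assumes "sesq_on X A" "sesq_on X B"
  shows "sesq_on X (\<lambda>v w. A v w + B v w)"
  using assms unfolding sesq_on_def by (auto simp: algebra_simps)

lemma sesq_on_scale:
  assumes "sesq_on X A"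
  shows "sesq_on X (\<lambda>v w. c * A v w)"
  using assms unfolding sesq_on_def by (auto simp: algebra_simps)

lemma psd_on_add:
  assumes "psd_on X A" "psd_on X B"
  shows "psd_on X (\<lambda>v w. A v w + B v w)"
proof (rule psd_onI)
  show "sesq_on X (\<lambda>v w. A v w + B v w)" using assms sesq_on_add psd_onD(1) by blast
  fix u assume u: "u \<in> X"
  show "0 \<le> Re (A u u + B u u)" using psd_onD(3)[OF assms(1) u] psd_onD(3)[OF assms(2) u] by simp
  fix v assume v: "v \<in> X"
  show "A v u + B v u = cnj (A u v + B u v)"
    using psd_onD(2)[OF assms(1) u v] psd_onD(2)[OF assms(2) u v] by simp
qed

lemma psd_on_scale:
  assumes "psd_on X A" "0 \<le> c"
  shows "psd_on X (\<lambda>v w. complex_of_real c * A v w)"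
proof (rule psd_onI)
  show "sesq_on X (\<lambda>v w. complex_of_real c * A v w)"
    using sesq_on_scale psd_onD(1)[OF assms(1)] by blast
  fix u assume u: "u \<in> X"
  show "0 \<le> Re (complex_of_real c * A u u)" using psd_onD(3)[OF assms(1) u] assms(2) by simp
  fix v assume v: "v \<in> X"
  show "complex_of_real c * A v u = cnj (complex_of_real c * A u v)"
    using psd_onD(2)[OF assms(1) u v] by simp
qed

lemma psd_on_Re: 
  assumes "psd_on X B" "u \<in> X"
  shows "B u u = complex_of_real (Re (B u u))" "0 \<le> Re (B u u)" 
proof -
  have "B u u = cnj (B u u)" using psd_onD(2)[OF assms assms(2)] .
  then have "Im (B u u) = 0" by (metis Reals_cnj_iff complex_is_Real_iff)
  then show "B u u = complex_of_real (Re (B u u))" by (simp add: complex_eq_iff)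
qed (rule psd_onD(3)[OF assms])

lemma antilinear_on_sum:
  assumes X: "fun_subspace X" and G: "antilinear_on X G" and "finite I" "\<And>i. i \<in> I \<Longrightarrow> f i \<in> X"
  shows "G (\<lambda>x. \<Sum>i\<in>I. f i x) = (\<Sum>i\<in>I. G (f i))"
  using assms(3,4)
proof (induction I rule: finite_induct)
  case empty
  show ?case using antilinear_onD(2)[OF G fun_subspaceD(1)[OF X], of 0] by simp
next
  case (insert i I)
  have "G (\<lambda>x. f i x + (\<Sum>i\<in>I. f i x)) = G (f i) + G (\<lambda>x. \<Sum>i\<in>I. f i x)"
    using antilinear_onD(1)[OF G] insert.prems fun_subspace_sum[OF X insert.hyps(1)] by simp
  then show ?case using insert by simp
qed

lemma antilinear_on_diff:
  assumes X: "fun_subspace X" and G: "antilinear_on X G" and "u \<in> X" "v \<in> X"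
  shows "G (\<lambda>x. u x - v x) = G u - G v"
proof -
  note m = fun_subspaceD(3)[OF X \<open>v \<in> X\<close>, of "-1"]
  show ?thesis
    using antilinear_onD(1)[OF G \<open>u \<in> X\<close> m] antilinear_onD(2)[OF G \<open>v \<in> X\<close>, of "-1"] by simp
qed

lemma antilinear_on_subset: "antilinear_on X G \<Longrightarrow> Y \<subseteq> X \<Longrightarrow> antilinear_on Y G"
  unfolding antilinear_on_def by blast

lemma sesq_on_antilinear: "sesq_on X B \<Longrightarrow> u \<in> X \<Longrightarrow> antilinear_on X (B u)"
  unfolding antilinear_on_def sesq_on_def by blast

lemma sesq_on_antilinear_cnj: "sesq_on X B \<Longrightarrow> u \<in> X \<Longrightarrow> antilinear_on X (\<lambda>w. cnj (B w u))"
  unfolding antilinear_on_def sesq_on_def by simp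

text \<open>
  The form is nonnegative at \<open>u - t B(u, v) v\<close> for all real \<open>t\<close>. The resulting quadratic inequality in
  \<open>t\<close> also settles degenerate forms, such as gradient inner products.
\<close>

lemma psd_on_Cauchy_Schwarz:
  assumes X: "fun_subspace X" and B: "psd_on X B" and u: "u \<in> X" and v: "v \<in> X"
  shows "cmod (B u v) \<le> sqrt (Re (B u u)) * sqrt (Re (B v v))"
proof -
  define m where "m = (cmod (B u v))\<^sup>2"
  have s: "sesq_on X B" using B by (rule psd_onD)
  note vu = psd_onD(2)[OF B u v]
  have mm: "B u v * cnj (B u v) = complex_of_real m"
    by (simp only: m_def complex_norm_square)
  have q: "0 \<le> Re (B u u) - 2 * t * m + t\<^sup>2 * m * Re (B v v)" for t
  proof -
    define c where "c = complex_of_real t * B u v"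
    let ?w = "\<lambda>x. u x - c * v x"
    note cv = fun_subspaceD(3)[OF X v, of c]
    note w = fun_subspaceD(4)[OF X u cv]
    have "B ?w ?w = B u u - B u (\<lambda>x. c * v x) - (B (\<lambda>x. c * v x) u - B (\<lambda>x. c * v x) (\<lambda>x. c * v x))"
      using sesq_on_diff[OF X s u cv] w u cv by simp
    also have "\<dots> = B u u - cnj c * B u v - c * B v u + c * (cnj c * B v v)"
      using sesq_onD(3,4)[OF s v] u cv v by simp
    also have "cnj c * B u v = complex_of_real (t * m)"
      unfolding c_def of_real_mult mm[symmetric] by simp
    also have "c * B v u = complex_of_real (t * m)"
      unfolding c_def of_real_mult mm[symmetric] vu by simp
    also have "c * (cnj c * B v v) = complex_of_real (t\<^sup>2 * m) * B v v"
      unfolding c_def of_real_mult mm[symmetric] by (simp add: power2_eq_square)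
    finally have "Re (B ?w ?w) = Re (B u u) - 2 * t * m + t\<^sup>2 * m * Re (B v v)"
      by simp
    then show ?thesis using psd_onD(3)[OF B w] by simp
  qed
  note nn = psd_onD(3)[OF B u] psd_onD(3)[OF B v]
  have m0: "0 \<le> m" by (simp add: m_def)
  have "m \<le> Re (B u u) * Re (B v v)"
  proof (cases "Re (B v v) = 0")
    case True
    have "m = 0"
    proof (rule ccontr)
      assume "m \<noteq> 0"
      then show False using q[of "(Re (B u u) + 1) / (2 * m)"] True nn by (simp add: field_simps)
    qed
    then show ?thesis using True by simp
  next
    case False
    then show ?thesis using q[of "1 / Re (B v v)"] nn by (simp add: field_simps power2_eq_square)
  qed
  then have "sqrt m \<le> sqrt (Re (B u u)) * sqrt (Re (B v v))"
    by (metis real_sqrt_le_iff real_sqrt_mult)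
  then show ?thesis by (simp add: m_def)
qed

lemma psd_on_triangle:
  assumes X: "fun_subspace X" and B: "psd_on X B" and u: "u \<in> X" and v: "v \<in> X"
  shows "sqrt (Re (B (\<lambda>x. u x + v x) (\<lambda>x. u x + v x))) \<le> sqrt (Re (B u u)) + sqrt (Re (B v v))"
proof (rule real_le_lsqrt)
  have s: "sesq_on X B" using B by (rule psd_onD)
  have w: "(\<lambda>x. u x + v x) \<in> X" using X u v by (rule fun_subspaceD)
  note nn = psd_onD(3)[OF B u] psd_onD(3)[OF B v]
  show "0 \<le> sqrt (Re (B u u)) + sqrt (Re (B v v))"
    using nn by simp
  have "Re (B (\<lambda>x. u x + v x) (\<lambda>x. u x + v x)) = Re (B u u) + Re (B u v) + (Re (B v u) + Re (B v v))"
    using sesq_onD(1,2)[OF s u _ v] w u v by simp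
  moreover have "Re (B v u) = Re (B u v)" using psd_onD(2)[OF B u v] by simp
  moreover have "Re (B u v) \<le> sqrt (Re (B u u)) * sqrt (Re (B v v))"
    using psd_on_Cauchy_Schwarz[OF assms] complex_Re_le_cmod order_trans by blast
  ultimately show "Re (B (\<lambda>x. u x + v x) (\<lambda>x. u x + v x)) \<le> (sqrt (Re (B u u)) + sqrt (Re (B v v)))\<^sup>2"
    using nn by (simp add: power2_sum)
qed

text \<open>
  The Lax-Milgram and Riesz theorems in finite dimension. Finite dimension is expressed by a finite
  set \<open>Z\<close> of points that separates the functions of \<open>X\<close>, because this property is inherited by subspaces.
  The induction on \<open>Z\<close> passes to the hyperplane of functions that vanish at one of the points and
  complements it by a vector that is left-orthogonal to it.
\<close>

lemma form_representation:
  assumes "finite Z" "fun_subspace X" "\<And>v. v \<in> X \<Longrightarrow> \<forall>z\<in>Z. v z = 0 \<Longrightarrow> v = (\<lambda>_. 0)"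
    and "sesq_on X A" "\<And>v. v \<in> X \<Longrightarrow> A v v = 0 \<Longrightarrow> v = (\<lambda>_. 0)" "antilinear_on X G"
  shows "\<exists>!q. q \<in> X \<and> (\<forall>w\<in>X. A q w = G w)"
proof (rule ex_ex1I)
  show "\<exists>q. q \<in> X \<and> (\<forall>w\<in>X. A q w = G w)"
    using assms
  proof (induction Z arbitrary: X G rule: finite_induct)
    case empty
    note X = empty.prems
    have "v = (\<lambda>_. 0)" if "v \<in> X" for v using X(2)[OF that] by simp
    then have X0: "X = {\<lambda>_. 0}" using fun_subspaceD(1)[OF X(1)] by blast
    have "A (\<lambda>_. 0) (\<lambda>_. 0) = 0" "G (\<lambda>_. 0) = 0"
      using sesq_onD(4)[OF X(3), of "\<lambda>_. 0" "\<lambda>_. 0" 0] antilinear_onD(2)[OF X(5), of "\<lambda>_. 0" 0] X0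
      by simp_all
    then show ?case using X0 by auto
  next
    case (insert z Z)
    note X = insert.prems
    let ?X' = "{v \<in> X. v z = 0}"
    have X': "fun_subspace ?X'" "?X' \<subseteq> X" using X(1) by (auto simp: fun_subspace_def)
    have sep: "v \<in> ?X' \<Longrightarrow> \<forall>y\<in>Z. v y = 0 \<Longrightarrow> v = (\<lambda>_. 0)" for v using X(2)[of v] by auto
    have ex': "\<exists>q. q \<in> ?X' \<and> (\<forall>w\<in>?X'. A q w = H w)" if "antilinear_on ?X' H" for H
    proof (rule insert.IH[OF X'(1) _ sesq_on_subset[OF X(3) X'(2)] _ that])
      show "v = (\<lambda>_. 0)" if "v \<in> ?X'" "\<forall>y\<in>Z. v y = 0" for v using sep that .
      show "v = (\<lambda>_. 0)" if "v \<in> ?X'" "A v v = 0" for v using X(4)[of v] that by simp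
    qed
    obtain q' where q': "q' \<in> ?X'" "\<And>w. w \<in> ?X' \<Longrightarrow> A q' w = G w"
      using ex'[of G, OF antilinear_on_subset[OF X(5) X'(2)]] by blast
    show ?case
    proof (cases "?X' = X")
      case True
      then show ?thesis using q' by blast
    next
      case False
      then obtain b0 where b0: "b0 \<in> X" "b0 z \<noteq> 0" by auto
      obtain p where p: "p \<in> ?X'" "\<And>w. w \<in> ?X' \<Longrightarrow> A p w = A b0 w"
        using ex'[of "A b0", OF antilinear_on_subset[OF sesq_on_antilinear[OF X(3) b0(1)] X'(2)]] by blast
      \<comment> \<open>the component of a complement of \<open>?X'\<close> that is left-orthogonal to \<open>?X'\<close>\<close>
      define b where "b = (\<lambda>x. b0 x - p x)"
      have bX: "b \<in> X" unfolding b_def using fun_subspaceD(4)[OF X(1) b0(1)] p by simp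
      have bz: "b z \<noteq> 0" using b0 p by (simp add: b_def)
      have orth: "A b w = 0" if "w \<in> ?X'" for w
        unfolding b_def using sesq_on_diff(1)[OF X(1,3) b0(1)] p that by auto
      have bb: "A b b \<noteq> 0" using X(4)[OF bX] bz by auto
      define c where "c = (G b - A q' b) / A b b"
      define q where "q = (\<lambda>x. q' x + c * b x)"
      have cb: "(\<lambda>x. c * b x) \<in> X" using fun_subspaceD(3)[OF X(1) bX] .
      have q'X: "q' \<in> X" using q' by blast
      have qX: "q \<in> X" unfolding q_def using fun_subspaceD(2)[OF X(1) q'X cb] .
      have Aq: "A q w = A q' w + c * A b w" if "w \<in> X" for w
        unfolding q_def using sesq_onD(1)[OF X(3) q'X that cb] sesq_onD(3)[OF X(3) bX that] by simp
      have "A q w = G w" if w: "w \<in> X" for w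
      proof -
        define d where "d = w z / b z"
        define w' where "w' = (\<lambda>x. w x - d * b x)"
        have db: "(\<lambda>x. d * b x) \<in> X" using fun_subspaceD(3)[OF X(1) bX] .
        have w': "w' \<in> ?X'"
          unfolding w'_def using fun_subspaceD(4)[OF X(1) w db] bz by (auto simp: d_def)
        then have w'X: "w' \<in> X" by blast
        have w_eq: "w = (\<lambda>x. w' x + d * b x)" by (simp add: w'_def)
        have "A q w = A q w' + cnj d * A q b"
          by (subst w_eq) (use sesq_onD(2)[OF X(3) w'X qX db] sesq_onD(4)[OF X(3) bX qX] in simp)
        also have "A q w' = G w'" using Aq[OF w'X] orth[OF w'] q'(2)[OF w'] by simp
        also have "A q b = G b" using Aq[OF bX] bb by (simp add: c_def)
        also have "G w' + cnj d * G b = G (\<lambda>x. w' x + d * b x)"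
          using antilinear_onD(1)[OF X(5) w'X db] antilinear_onD(2)[OF X(5) bX] by simp
        also have "(\<lambda>x. w' x + d * b x) = w" using w_eq by (rule sym)
        finally show ?thesis .
      qed
      then show ?thesis using qX by blast
    qed
  qed
next
  fix p q assume p: "p \<in> X \<and> (\<forall>w\<in>X. A p w = G w)" and q: "q \<in> X \<and> (\<forall>w\<in>X. A q w = G w)"
  let ?d = "\<lambda>x. p x - q x"
  have d: "?d \<in> X" using fun_subspaceD(4)[OF assms(2)] p q by simp
  have "A ?d ?d = A p ?d - A q ?d" using sesq_on_diff(1)[OF assms(2,4) _ _ d] p q by blast
  then have "?d = (\<lambda>_. 0)" using assms(5)[OF d] p q d by simp
  then show "p = q" by (simp add: fun_eq_iff)
qed

section \<open>Inner products of square integrable functions\<close>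

text \<open>
  Membership in \<open>L\<^sup>2\<close> for functions of which only the values on \<open>S\<close> are relevant; used with Lebesgue
  measure and with arc length.
\<close>

definition sq_int :: "'a measure \<Rightarrow> 'a set \<Rightarrow> ('a \<Rightarrow> complex) \<Rightarrow> bool" where
  "sq_int M S f \<longleftrightarrow> set_borel_measurable M S f \<and> set_integrable M S (\<lambda>x. (cmod (f x))\<^sup>2)"

lemma L2_on_sq_int: "L2_on \<Omega> v = sq_int lebesgue \<Omega> v"
  by (simp add: L2_on_def sq_int_def)

lemma set_lint_cong_AE:
  fixes f g :: "'a \<Rightarrow> 'b::{banach, second_countable_topology}"
  assumes "set_integrable M S f" "set_integrable M S g" "AE x in M. x \<in> S \<longrightarrow> f x = g x"
  shows "(LINT x:S|M. f x) = (LINT x:S|M. g x)"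
  unfolding set_lebesgue_integral_def
proof (rule integral_cong_AE)
  show "AE x in M. indicat_real S x *\<^sub>R f x = indicat_real S x *\<^sub>R g x"
    using assms(3) by eventually_elim (auto simp: indicator_def)
qed (use assms(1,2) in \<open>auto simp: set_integrable_def\<close>)

lemma cnj_borel_measurable:
  assumes "f \<in> borel_measurable M"
  shows "(\<lambda>x. cnj (f x)) \<in> borel_measurable M"
proof -
  have "cnj \<in> borel_measurable borel"
    by (intro borel_measurable_continuous_onI continuous_on_cnj continuous_on_id)
  then show ?thesis using measurable_compose[OF assms] by blast
qed

lemma sq_int_mult:
  assumes f: "sq_int M S f" and g: "sq_int M S g"
  shows "set_integrable M S (\<lambda>x. f x * cnj (g x))"
  unfolding set_integrable_def
proof (rule Bochner_Integration.integrable_bound)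
  show "integrable M (\<lambda>x. indicat_real S x *\<^sub>R (cmod (f x))\<^sup>2 + indicat_real S x *\<^sub>R (cmod (g x))\<^sup>2)"
    using f g by (intro Bochner_Integration.integrable_add) (auto simp: sq_int_def set_integrable_def)
  have "(\<lambda>x. (indicat_real S x *\<^sub>R f x) * cnj (indicat_real S x *\<^sub>R g x)) \<in> borel_measurable M"
    using f g by (intro borel_measurable_times cnj_borel_measurable)
      (auto simp: sq_int_def set_borel_measurable_def)
  moreover have "(\<lambda>x. (indicat_real S x *\<^sub>R f x) * cnj (indicat_real S x *\<^sub>R g x))
      = (\<lambda>x. indicat_real S x *\<^sub>R (f x * cnj (g x)))"
    by (auto simp: indicator_def)
  ultimately show "(\<lambda>x. indicat_real S x *\<^sub>R (f x * cnj (g x))) \<in> borel_measurable M" by simp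
  have "a * b \<le> a\<^sup>2 + b\<^sup>2" for a b :: real
  proof -
    have "0 \<le> (a - b)\<^sup>2 + (a\<^sup>2 + b\<^sup>2)" by simp
    then show ?thesis by (simp add: power2_diff)
  qed
  then show "AE x in M. norm (indicat_real S x *\<^sub>R (f x * cnj (g x)))
      \<le> norm (indicat_real S x *\<^sub>R (cmod (f x))\<^sup>2 + indicat_real S x *\<^sub>R (cmod (g x))\<^sup>2)"
    by (intro AE_I2) (auto simp: indicator_def norm_mult)
qed

lemma set_borel_measurable_norm_square:
  assumes "set_borel_measurable M S f"
  shows "(\<lambda>x. indicat_real S x *\<^sub>R (cmod (f x))\<^sup>2) \<in> borel_measurable M"
proof -
  have "(\<lambda>x. (norm (indicat_real S x *\<^sub>R f x))\<^sup>2) \<in> borel_measurable M"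
    using assms unfolding set_borel_measurable_def
    by (intro borel_measurable_power measurable_compose[OF _ borel_measurable_norm])
  moreover have "(\<lambda>x. (norm (indicat_real S x *\<^sub>R f x))\<^sup>2) = (\<lambda>x. indicat_real S x *\<^sub>R (cmod (f x))\<^sup>2)"
    by (auto simp: indicator_def)
  ultimately show ?thesis by simp
qed

lemma sq_int_cnj: 
  assumes "sq_int M S f" shows "sq_int M S (\<lambda>x. cnj (f x))"
proof -
  have "(\<lambda>x. cnj (indicat_real S x *\<^sub>R f x)) = (\<lambda>x. indicat_real S x *\<^sub>R cnj (f x))" by auto
  then show ?thesis
    using assms cnj_borel_measurable[of "\<lambda>x. indicat_real S x *\<^sub>R f x" M]
    by (simp add: sq_int_def set_borel_measurable_def)
qed

lemma sq_int_scale: 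
  assumes "sq_int M S f" shows "sq_int M S (\<lambda>x. c * f x)"
proof -
  have "(\<lambda>x. c * (indicat_real S x *\<^sub>R f x)) \<in> borel_measurable M"
    using assms by (intro borel_measurable_times borel_measurable_const) (auto simp: sq_int_def
        set_borel_measurable_def)
  moreover have "integrable M (\<lambda>x. (cmod c)\<^sup>2 * (indicat_real S x *\<^sub>R (cmod (f x))\<^sup>2))"
    using assms by (intro integrable_mult_right) (auto simp: sq_int_def set_integrable_def)
  ultimately show ?thesis
    by (simp add: sq_int_def set_borel_measurable_def set_integrable_def norm_mult power_mult_distrib algebra_simps)
qed

lemma sq_int_add: 
  assumes f: "sq_int M S f" and g: "sq_int M S g" shows "sq_int M S (\<lambda>x. f x + g x)"
proof -
  have "(\<lambda>x. (indicat_real S x *\<^sub>R f x) + (indicat_real S x *\<^sub>R g x)) \<in> borel_measurable M"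
    using f g by (intro borel_measurable_add) (auto simp: sq_int_def set_borel_measurable_def)
  then have m: "set_borel_measurable M S (\<lambda>x. f x + g x)"
    by (simp add: set_borel_measurable_def scaleR_add_right)
  have m2: "(\<lambda>x. indicat_real S x *\<^sub>R (cmod (f x + g x))\<^sup>2) \<in> borel_measurable M" using m
      by (rule set_borel_measurable_norm_square)
  have *: "(cmod (a + b))\<^sup>2 \<le> 2 * (cmod a)\<^sup>2 + 2 * (cmod b)\<^sup>2" for a b
  proof -
    have "(cmod (a + b))\<^sup>2 \<le> (cmod a + cmod b)\<^sup>2" by (intro power_mono norm_triangle_ineq) auto
    also have "\<dots> \<le> 2 * (cmod a)\<^sup>2 + 2 * (cmod b)\<^sup>2"
      using zero_le_power2[of "cmod a - cmod b"] by (simp add: power2_sum power2_diff)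
    finally show ?thesis .
  qed
  have "integrable M (\<lambda>x. indicat_real S x *\<^sub>R (cmod (f x + g x))\<^sup>2)"
  proof (rule Bochner_Integration.integrable_bound[OF _ m2])
    show "integrable M (\<lambda>x. 2 * (indicat_real S x *\<^sub>R (cmod (f x))\<^sup>2) + 2 * (indicat_real S x *\<^sub>R (cmod (g x))\<^sup>2))"
      using f g by (intro Bochner_Integration.integrable_add integrable_mult_right)
        (auto simp: sq_int_def set_integrable_def)
    show "AE x in M. norm (indicat_real S x *\<^sub>R (cmod (f x + g x))\<^sup>2)
      \<le> norm (2 * (indicat_real S x *\<^sub>R (cmod (f x))\<^sup>2) + 2 * (indicat_real S x *\<^sub>R (cmod (g x))\<^sup>2))"
      using * by (intro AE_I2) (auto simp: indicator_def)
  qed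
  with m show ?thesis by (simp add: sq_int_def set_integrable_def)
qed

lemma sq_int_diff: 
  assumes f: "sq_int M S f" and g: "sq_int M S g" shows "sq_int M S (\<lambda>x. f x - g x)"
  using sq_int_add[OF f sq_int_scale[OF g, of "-1"]] by simp

lemma sq_int_finite_bounded:
  assumes "set_borel_measurable M S f" "S \<in> sets M" "emeasure M S < \<infinity>" "\<And>x. x \<in> S \<Longrightarrow> cmod (f x) \<le> C"
  shows "sq_int M S f"
  unfolding sq_int_def set_integrable_def
proof
  show "set_borel_measurable M S f" by fact
  have m: "(\<lambda>x. indicat_real S x *\<^sub>R (cmod (f x))\<^sup>2) \<in> borel_measurable M" using assms(1)
      by (rule set_borel_measurable_norm_square)
  show "integrable M (\<lambda>x. indicat_real S x *\<^sub>R (cmod (f x))\<^sup>2)"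
  proof (rule integrableI_bounded_set[where A=S and B="C\<^sup>2"])
    show "AE x in M. x \<in> S \<longrightarrow> norm (indicat_real S x *\<^sub>R (cmod (f x))\<^sup>2) \<le> C\<^sup>2"
      using assms(4) by (intro AE_I2) (auto intro!: power_mono)
  qed (use assms m in auto)
qed

text \<open>
  Mesh elements are closed, so that they stick out of the open domain, but only by a null set.
\<close>

lemma sq_int_lebesgue_mono:
  fixes f :: "'a::euclidean_space \<Rightarrow> complex"
  assumes f: "sq_int lebesgue S f" and T: "T \<in> sets lebesgue" and TS: "negligible (T - S)"
  shows "sq_int lebesgue T f"
proof -
  have ae: "AE x in lebesgue. x \<notin> T - S"
    using TS AE_not_in negligible_iff_null_sets by blast
  have "(\<lambda>x. indicat_real T x *\<^sub>R (indicat_real S x *\<^sub>R f x)) \<in> borel_measurable lebesgue"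
    using borel_measurable_scaleR[OF borel_measurable_indicator[OF T], of "\<lambda>x. indicat_real S x *\<^sub>R f x"] f
    by (simp only: sq_int_def set_borel_measurable_def)
  moreover have "AE x in lebesgue. indicat_real T x *\<^sub>R (indicat_real S x *\<^sub>R f x) = indicat_real T x *\<^sub>R f x"
    using ae by eventually_elim (auto simp: indicator_def)
  ultimately have m: "(\<lambda>x. indicat_real T x *\<^sub>R f x) \<in> borel_measurable lebesgue"
    by (rule borel_measurable_AE)
  have i: "integrable lebesgue (\<lambda>x. indicat_real T x *\<^sub>R (indicat_real S x *\<^sub>R (cmod (f x))\<^sup>2))"
    using integrable_mult_indicator[OF T, of "\<lambda>x. indicat_real S x *\<^sub>R (cmod (f x))\<^sup>2"] f
    by (simp only: sq_int_def set_integrable_def)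
  have e: "AE x in lebesgue. indicat_real T x *\<^sub>R (indicat_real S x *\<^sub>R (cmod (f x))\<^sup>2)
      = indicat_real T x *\<^sub>R (cmod (f x))\<^sup>2"
    using ae by eventually_elim (auto simp: indicator_def)
  have "integrable lebesgue (\<lambda>x. indicat_real T x *\<^sub>R (cmod (f x))\<^sup>2)"
    by (rule integrable_cong_AE_imp[OF i borel_measurable_AE[OF borel_measurable_integrable[OF i] e] e])
  then show ?thesis using m by (simp add: sq_int_def set_borel_measurable_def set_integrable_def)
qed

text \<open>
  The inner products of the Helmholtz problem arise from \<open>\<Phi>\<close> being the identity, a weak partial
  derivative or the trace. Linearity of \<open>\<Phi>\<close> is only asked for almost everywhere, as the
  weak gradient is determined up to null sets.
\<close>

lemma psd_on_integral:
  assumes X: "fun_subspace X"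
    and L2: "\<And>u. u \<in> X \<Longrightarrow> sq_int M S (\<Phi> u)"
    and add: "\<And>u v. u \<in> X \<Longrightarrow> v \<in> X \<Longrightarrow> AE x in M. x \<in> S \<longrightarrow> \<Phi> (\<lambda>x. u x + v x) x = \<Phi> u x + \<Phi> v x"
    and scale: "\<And>c u. u \<in> X \<Longrightarrow> AE x in M. x \<in> S \<longrightarrow> \<Phi> (\<lambda>x. c * u x) x = c * \<Phi> u x"
  shows "psd_on X (\<lambda>v w. LINT x:S|M. \<Phi> v x * cnj (\<Phi> w x))"
proof (rule psd_onI)
  let ?B = "\<lambda>v w. LINT x:S|M. \<Phi> v x * cnj (\<Phi> w x)"
  have int: "set_integrable M S (\<lambda>x. \<Phi> u x * cnj (\<Phi> v x))" if "u \<in> X" "v \<in> X" for u v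
    using that L2 sq_int_mult by blast
  show herm: "?B v u = cnj (?B u v)" if "u \<in> X" "v \<in> X" for u v
  proof -
    have "(\<lambda>x. indicat_real S x *\<^sub>R cnj (\<Phi> u x * cnj (\<Phi> v x)))
        = (\<lambda>x. cnj (indicat_real S x *\<^sub>R (\<Phi> u x * cnj (\<Phi> v x))))" by simp
    then have "(LINT x:S|M. cnj (\<Phi> u x * cnj (\<Phi> v x))) = cnj (?B u v)"
      unfolding set_lebesgue_integral_def by (simp only: Bochner_Integration.integral_cnj)
    then show ?thesis by (simp add: mult.commute)
  qed
  have l1: "?B (\<lambda>x. u x + v x) w = ?B u w + ?B v w" if "u \<in> X" "v \<in> X" "w \<in> X" for u v w
  proof -
    have uv: "(\<lambda>x. u x + v x) \<in> X" using fun_subspaceD(2)[OF X] that by blast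
    have "?B (\<lambda>x. u x + v x) w = (LINT x:S|M. \<Phi> u x * cnj (\<Phi> w x) + \<Phi> v x * cnj (\<Phi> w x))"
      using add[OF that(1,2)] 
      by (intro set_lint_cong_AE set_integral_add int that uv) (auto simp: algebra_simps elim!: eventually_mono)
    then show ?thesis using set_integral_add(2)[OF int int] that by simp
  qed
  have l2: "?B (\<lambda>x. c * u x) w = c * ?B u w" if "u \<in> X" "w \<in> X" for c u w
  proof -
    have cu: "(\<lambda>x. c * u x) \<in> X" using fun_subspaceD(3)[OF X] that by blast
    have "?B (\<lambda>x. c * u x) w = (LINT x:S|M. c * (\<Phi> u x * cnj (\<Phi> w x)))"
      using scale[OF that(1), of c] 
      by (intro set_lint_cong_AE set_integrable_mult_right int that cu) (auto simp: algebra_simps elim!: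
          eventually_mono)
    then show ?thesis by simp
  qed
  show "sesq_on X ?B"
    unfolding sesq_on_def
  proof (intro conjI ballI allI)
    fix u v w assume *: "u \<in> X" "v \<in> X" "w \<in> X"
    have uv: "(\<lambda>x. u x + v x) \<in> X" using fun_subspaceD(2)[OF X] * by blast
    show "?B (\<lambda>x. u x + v x) w = ?B u w + ?B v w" using l1 * by blast
    have "?B w (\<lambda>x. u x + v x) = cnj (?B u w + ?B v w)" using herm[OF uv *(3)] l1[OF *] by simp
    then show "?B w (\<lambda>x. u x + v x) = ?B w u + ?B w v"
      using herm[OF *(1,3)] herm[OF *(2,3)] by simp
  next
    fix c u w assume *: "u \<in> X" "w \<in> X"
    have cu: "(\<lambda>x. c * u x) \<in> X" using fun_subspaceD(3)[OF X] * by blast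
    show "?B (\<lambda>x. c * u x) w = c * ?B u w" using l2 * by blast
    have "?B w (\<lambda>x. c * u x) = cnj (c * ?B u w)" using herm[OF cu *(2)] l2[OF *] by simp
    then show "?B w (\<lambda>x. c * u x) = cnj c * ?B w u"
      using herm[OF *] by simp
  qed
  fix u assume u: "u \<in> X"
  have "Re (?B u u) = (LINT x:S|M. Re (\<Phi> u x * cnj (\<Phi> u x)))"
    using int[OF u u] unfolding set_lebesgue_integral_def set_integrable_def
    by (subst integral_Re[symmetric]) auto
  also have "\<dots> \<ge> 0" unfolding set_lebesgue_integral_def
    by (intro integral_nonneg_AE AE_I2) (auto simp: indicator_def)
  finally show "0 \<le> Re (?B u u)" .
qed

lemma psd_on_sum:
  assumes "finite I" "\<And>i. i \<in> I \<Longrightarrow> psd_on X (B i)"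
  shows "psd_on X (\<lambda>v w. \<Sum>i\<in>I. B i v w)"
  using assms
proof (induction I rule: finite_induct)
  case empty then show ?case by (auto simp: psd_on_def sesq_on_def)
next
  case (insert i I)
  then show ?case using psd_on_add[of X "B i" "\<lambda>v w. \<Sum>i\<in>I. B i v w"] by simp
qed

section \<open>The fundamental lemma of the calculus of variations\<close>

lemma max_square_bound: "\<bar>(max 0 (t + h))\<^sup>2 - (max 0 t)\<^sup>2 - 2 * max 0 t * h\<bar> \<le> (h::real)\<^sup>2"
proof -
  consider "0 \<le> t" "0 \<le> t + h" | "0 \<le> t" "t + h < 0" | "t < 0" "0 \<le> t + h" | "t < 0" "t + h < 0" by linarith
  then show ?thesis
  proof cases
    case 1 then show ?thesis by (simp add: power2_eq_square algebra_simps)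
  next
    case 2
    have "0 \<le> t * (t + 2 * h) + h * h" using zero_le_square[of "t + h"] by (simp add: algebra_simps)
    moreover have "0 \<le> t * (- (t + 2 * h))" using 2 by (intro mult_nonneg_nonneg) auto
    ultimately show ?thesis using 2 by (simp add: power2_eq_square algebra_simps max_def)
  next
    case 3
    then have "(t + h)\<^sup>2 \<le> h\<^sup>2" by (intro power_mono) auto
    then show ?thesis using 3 by (simp add: max_def)
  next
    case 4 then show ?thesis by simp
  qed
qed

text \<open>
  The square of the positive part is the building block of continuously differentiable cutoff
  functions.
\<close>

lemma max_square_has_derivative: "((\<lambda>t. (max 0 t)\<^sup>2) has_real_derivative 2 * max 0 t) (at t)"
  unfolding has_field_derivative_iff
proof -
  have "((\<lambda>y. ((max 0 y)\<^sup>2 - (max 0 t)\<^sup>2) / (y - t) - 2 * max 0 t) \<longlongrightarrow> 0) (at t)"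
  proof (rule Lim_null_comparison)
    show "((\<lambda>y. \<bar>y - t\<bar>) \<longlongrightarrow> 0) (at t)" by (auto intro!: tendsto_eq_intros)
    show "\<forall>\<^sub>F y in at t. norm (((max 0 y)\<^sup>2 - (max 0 t)\<^sup>2) / (y - t) - 2 * max 0 t) \<le> \<bar>y - t\<bar>"
      unfolding eventually_at_filter
    proof (intro always_eventually allI impI)
      fix y assume y: "y \<noteq> t"
      have eq: "((max 0 y)\<^sup>2 - (max 0 t)\<^sup>2) / (y - t) - 2 * max 0 t
          = ((max 0 y)\<^sup>2 - (max 0 t)\<^sup>2 - 2 * max 0 t * (y - t)) / (y - t)"
        using y by (simp add: field_simps)
      have "\<bar>(max 0 y)\<^sup>2 - (max 0 t)\<^sup>2 - 2 * max 0 t * (y - t)\<bar> \<le> \<bar>y - t\<bar> * \<bar>y - t\<bar>"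
        using max_square_bound[of t "y - t"] by (simp add: power2_eq_square)
      then show "norm (((max 0 y)\<^sup>2 - (max 0 t)\<^sup>2) / (y - t) - 2 * max 0 t) \<le> \<bar>y - t\<bar>"
        unfolding eq using y by (simp add: abs_divide divide_le_eq)
    qed
  qed
  then show "((\<lambda>y. ((max 0 y)\<^sup>2 - (max 0 t)\<^sup>2) / (y - t)) \<longlongrightarrow> 2 * max 0 t) (at t)"
    by (rule LIM_zero_cancel)
qed

text \<open>
  The sum \<open>s\<close> of squared positive parts of paraboloids, taken over a finite cover of \<open>K\<close> by small balls, is
  continuously differentiable, supported near \<open>K\<close>, and at least some \<open>d > 0\<close> on \<open>K\<close>. A profile that
  is constant beyond \<open>d\<close> turns it into a cutoff function.
\<close>

lemma test_function_cutoff: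
  assumes K: "compact K" "K \<subseteq> U" and U: "open U" "U \<subseteq> \<Omega>"
  obtains \<phi> where "test_function \<Omega> \<phi>" "\<And>x. 0 \<le> \<phi> x \<and> \<phi> x \<le> 1" "\<And>x. x \<in> K \<Longrightarrow> \<phi> x = 1"
    "\<And>x. x \<notin> U \<Longrightarrow> \<phi> x = 0"
proof -
  obtain r where r: "0 < r" "(\<Union>x\<in>K. cball x r) \<subseteq> U"
    using compact_subset_open_imp_cball_epsilon_subset[OF K(1) U(1) K(2)] by blast
  obtain C where C: "C \<subseteq> K" "finite C" "K \<subseteq> (\<Union>c\<in>C. ball c r)"
    using compactE_image[OF K(1), of K "\<lambda>x. ball x r"] r(1) by force
  define s :: "plane \<Rightarrow> real" where "s x = (\<Sum>c\<in>C. (max 0 (r\<^sup>2 - (x - c) \<bullet> (x - c)))\<^sup>2)" for x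
  define Ds :: "plane \<Rightarrow> plane \<Rightarrow> real" where
    "Ds x h = (\<Sum>c\<in>C. 2 * max 0 (r\<^sup>2 - (x - c) \<bullet> (x - c)) * (- 2 * ((x - c) \<bullet> h)))" for x h
  have s_cont: "continuous_on A s" for A unfolding s_def by (intro continuous_intros)
  have s_nonneg: "0 \<le> s x" for x unfolding s_def by (intro sum_nonneg) auto
  have in_ball: "r\<^sup>2 - (x - c) \<bullet> (x - c) > 0 \<longleftrightarrow> x \<in> ball c r" for x c :: plane
  proof -
    have "(x - c) \<bullet> (x - c) < r\<^sup>2 \<longleftrightarrow> norm (x - c) < r"
      using r(1) norm_lt_square[of "x - c" r] by simp
    then show ?thesis by (simp add: dist_norm norm_minus_commute)
  qed
  have s_pos: "0 < s x" if x: "x \<in> (\<Union>c\<in>C. ball c r)" for x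
  proof -
    obtain c where c: "c \<in> C" "x \<in> ball c r" using x by blast
    then have "0 < (max 0 (r\<^sup>2 - (x - c) \<bullet> (x - c)))\<^sup>2" using in_ball[of x c] by simp
    also have "\<dots> \<le> s x" unfolding s_def using c C(2) by (intro member_le_sum) auto
    finally show ?thesis .
  qed
  have s_zero: "s x = 0" if "x \<notin> (\<Union>c\<in>C. ball c r)" for x
  proof -
    have "max 0 (r\<^sup>2 - (x - c) \<bullet> (x - c)) = 0" if "c \<in> C" for c
      using in_ball[of x c] \<open>x \<notin> _\<close> that by auto
    then show ?thesis unfolding s_def by simp
  qed
  obtain d where d: "0 < d" "\<And>x. x \<in> K \<Longrightarrow> d \<le> s x"
  proof (cases "K = {}")
    case True then show ?thesis using that[of 1] by auto
  next
    case False
    then obtain x0 where "x0 \<in> K" "\<And>x. x \<in> K \<Longrightarrow> s x0 \<le> s x"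
      using continuous_attains_inf[OF K(1) _ s_cont] by blast
    then show ?thesis using that[of "s x0"] s_pos C(3) by blast
  qed
  \<comment> \<open>equals \<open>0\<close> where \<open>s\<close> vanishes and \<open>1\<close> where \<open>s\<close> is at least \<open>d\<close>\<close>
  define \<phi> where "\<phi> x = 1 - (max 0 (1 - s x / d))\<^sup>2" for x
  have Ds: "(s has_derivative Ds x) (at x)" for x
  proof -
    have 1: "((\<lambda>x. r\<^sup>2 - (x - c) \<bullet> (x - c)) has_derivative (\<lambda>h. - 2 * ((x - c) \<bullet> h))) (at x)" for c :: plane
      by (auto intro!: derivative_eq_intros simp: inner_commute)
    have "((\<lambda>x. (max 0 (r\<^sup>2 - (x - c) \<bullet> (x - c)))\<^sup>2) has_derivative
        (\<lambda>h. 2 * max 0 (r\<^sup>2 - (x - c) \<bullet> (x - c)) * (- 2 * ((x - c) \<bullet> h)))) (at x)" for c :: plane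
      using has_derivative_compose[OF 1, of "\<lambda>t. (max 0 t)\<^sup>2" "(*) (2 * max 0 (r\<^sup>2 - (x - c) \<bullet> (x - c)))"]
        max_square_has_derivative[of "r\<^sup>2 - (x - c) \<bullet> (x - c)"] by (simp add: has_field_derivative_def)
    then show ?thesis unfolding s_def[abs_def] Ds_def[abs_def] by (intro has_derivative_sum)
  qed
  have D\<phi>: "(\<phi> has_derivative (\<lambda>h. 2 * max 0 (1 - s x / d) * (Ds x h / d))) (at x)" for x
  proof -
    have 1: "((\<lambda>x. 1 - s x / d) has_derivative (\<lambda>h. - (Ds x h / d))) (at x)"
      using d(1) by (auto intro!: derivative_eq_intros Ds)
    have "((\<lambda>x. (max 0 (1 - s x / d))\<^sup>2) has_derivative (\<lambda>h. 2 * max 0 (1 - s x / d) * (- (Ds x h / d)))) (at x)"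
      using has_derivative_compose[OF 1, of "\<lambda>t. (max 0 t)\<^sup>2" "(*) (2 * max 0 (1 - s x / d))"]
        max_square_has_derivative[of "1 - s x / d"] by (simp add: has_field_derivative_def)
    from has_derivative_diff[OF has_derivative_const[of 1] this]
    show ?thesis unfolding \<phi>_def[abs_def] by simp
  qed
  have pd: "pderiv_at i \<phi> x = 2 * max 0 (1 - s x / d) * (Ds x (axis i 1) / d)" for i x
    unfolding pderiv_at_def using frechet_derivative_at[OF D\<phi>, symmetric] by simp
  have pd_cont: "continuous_on UNIV (pderiv_at i \<phi>)" for i
    unfolding pd[abs_def] Ds_def using s_cont d by (intro continuous_intros) auto
  have supp: "{x. \<phi> x \<noteq> 0} \<subseteq> (\<Union>c\<in>C. cball c r)"
  proof (rule subsetI, rule ccontr)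
    fix x assume x: "x \<in> {x. \<phi> x \<noteq> 0}" "x \<notin> (\<Union>c\<in>C. cball c r)"
    then have "x \<notin> (\<Union>c\<in>C. ball c r)" using ball_subset_cball by blast
    then show False using x s_zero[of x] by (simp add: \<phi>_def)
  qed
  have cpt: "compact (\<Union>c\<in>C. cball c r)" using C(2) by (intro compact_UN) auto
  then have cl: "closure {x. \<phi> x \<noteq> 0} \<subseteq> (\<Union>c\<in>C. cball c r)"
    using supp compact_imp_closed closure_minimal by blast
  have sub: "(\<Union>c\<in>C. cball c r) \<subseteq> U" using r(2) C(1) by blast
  show ?thesis
  proof
    show "test_function \<Omega> \<phi>"
      unfolding test_function_def
    proof (intro conjI allI)
      show "\<phi> differentiable (at x)" for x using D\<phi> differentiableI by blast
      show "compact (closure {x. \<phi> x \<noteq> 0})"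
        using compact_Int_closed[OF cpt closed_closure[of "{x. \<phi> x \<noteq> 0}"]] cl by (simp add: Int_absorb1)
      show "closure {x. \<phi> x \<noteq> 0} \<subseteq> \<Omega>" using cl sub U by blast
    qed (rule pd_cont)
    show "0 \<le> \<phi> x \<and> \<phi> x \<le> 1" for x
    proof -
      have "(max 0 (1 - s x / d))\<^sup>2 \<le> 1"
        using s_nonneg[of x] d by (intro power_le_one) auto
      then show ?thesis by (simp add: \<phi>_def)
    qed
    show "\<phi> x = 1" if "x \<in> K" for x using d(1) d(2)[OF that] by (simp add: \<phi>_def)
    show "\<phi> x = 0" if "x \<notin> U" for x using supp sub that by blast
  qed
qed

lemma test_function_facts:
  assumes "test_function \<Omega> \<phi>"
  shows "continuous_on A \<phi>" "\<phi> \<in> borel_measurable lebesgue" "\<exists>C. \<forall>x. \<bar>\<phi> x\<bar> \<le> C" "x \<notin> \<Omega> \<Longrightarrow> \<phi> x = 0"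
proof -
  have d: "\<phi> differentiable (at x)" for x using assms by (simp add: test_function_def)
  show c: "continuous_on A \<phi>" for A
    using d by (intro continuous_at_imp_continuous_on) (auto intro: differentiable_imp_continuous_within)
  then show "\<phi> \<in> borel_measurable lebesgue"
    by (intro measurable_completion) (simp add: borel_measurable_continuous_onI)
  let ?K = "closure {x. \<phi> x \<noteq> 0}"
  have "bounded (\<phi> ` ?K)" using assms c compact_continuous_image compact_imp_bounded
    unfolding test_function_def by blast
  then obtain C where C: "\<And>x. x \<in> ?K \<Longrightarrow> \<bar>\<phi> x\<bar> \<le> C" unfolding bounded_iff by auto
  have "\<bar>\<phi> x\<bar> \<le> max 0 C" for x
    using C[of x] closure_subset[of "{x. \<phi> x \<noteq> 0}"] by (cases "\<phi> x = 0") auto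
  then show "\<exists>C. \<forall>x. \<bar>\<phi> x\<bar> \<le> C" by blast
  show "x \<notin> \<Omega> \<Longrightarrow> \<phi> x = 0"
    using assms closure_subset[of "{x. \<phi> x \<noteq> 0}"] unfolding test_function_def by blast
qed

text \<open>
  Cutoff functions for shrinking neighbourhoods of \<open>K\<close> converge boundedly to the indicator of \<open>K\<close>.
\<close>

lemma integral_compact_zero:
  fixes h :: "plane \<Rightarrow> real"
  assumes \<Omega>: "open \<Omega>" and h: "set_integrable lebesgue \<Omega> h"
    and z: "\<And>\<phi>. test_function \<Omega> \<phi> \<Longrightarrow> (LINT x:\<Omega>|lebesgue. h x * \<phi> x) = 0"
    and K: "compact K" "K \<subseteq> \<Omega>"
  shows "(LINT x:K|lebesgue. h x) = 0"
proof (cases "K = {}")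
  case True then show ?thesis by (simp add: set_lebesgue_integral_def)
next
  case False
  define U where "U n = \<Omega> \<inter> {x. infdist x K < 1 / Suc n}" for n :: nat
  have U: "open (U n)" "K \<subseteq> U n" "U n \<subseteq> \<Omega>" for n
  proof -
    have "open {x. infdist x K < 1 / Suc n}" by (intro open_Collect_less continuous_intros)
    then show "open (U n)" unfolding U_def using \<Omega> by blast
    show "K \<subseteq> U n" "U n \<subseteq> \<Omega>" using K(2) by (auto simp: U_def)
  qed
  have "\<exists>\<phi>. test_function \<Omega> \<phi> \<and> (\<forall>x. 0 \<le> \<phi> x \<and> \<phi> x \<le> 1) \<and> (\<forall>x\<in>K. \<phi> x = 1) \<and> (\<forall>x. x \<notin> U n \<longrightarrow> \<phi> x = 0)" for n
    using test_function_cutoff[OF K(1) U(2,1,3)] by metis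
  then obtain \<phi> where \<phi>: "\<And>n. test_function \<Omega> (\<phi> n)" "\<And>n x. 0 \<le> \<phi> n x \<and> \<phi> n x \<le> 1"
    "\<And>n x. x \<in> K \<Longrightarrow> \<phi> n x = 1" "\<And>n x. x \<notin> U n \<Longrightarrow> \<phi> n x = 0" by metis
  let ?g = "\<lambda>x. indicat_real \<Omega> x *\<^sub>R h x"
  have gi: "integrable lebesgue ?g" using h by (simp add: set_integrable_def)
  have lim: "(\<lambda>n. LINT x|lebesgue. ?g x * \<phi> n x) \<longlonglongrightarrow> (LINT x|lebesgue. indicat_real K x *\<^sub>R h x)"
  proof (rule integral_dominated_convergence[where w = "\<lambda>x. norm (?g x)"])
    have gK: "(\<lambda>x. indicat_real K x *\<^sub>R h x) = (\<lambda>x. indicat_real K x *\<^sub>R ?g x)"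
      by (rule ext) (use K(2) in \<open>auto simp: indicator_def\<close>)
    have "K \<in> sets lebesgue" using K(1) by (simp add: borel_compact)
    from integrable_mult_indicator[OF this gi]
    show "(\<lambda>x. indicat_real K x *\<^sub>R h x) \<in> borel_measurable lebesgue"
      unfolding gK by (rule borel_measurable_integrable)
    show "(\<lambda>x. ?g x * \<phi> n x) \<in> borel_measurable lebesgue" for n
      by (rule borel_measurable_times[OF borel_measurable_integrable[OF gi] test_function_facts(2)[OF \<phi>(1)]])
    show "integrable lebesgue (\<lambda>x. norm (?g x))" using gi by (rule integrable_norm)
    show "AE x in lebesgue. norm (?g x * \<phi> n x) \<le> norm (?g x)" for n
      using \<phi>(2) by (intro AE_I2) (auto simp: abs_mult intro!: mult_left_le)
    show "AE x in lebesgue. (\<lambda>n. ?g x * \<phi> n x) \<longlonglongrightarrow> indicat_real K x *\<^sub>R h x"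
    proof (intro AE_I2)
      fix x :: plane
      show "(\<lambda>n. ?g x * \<phi> n x) \<longlonglongrightarrow> indicat_real K x *\<^sub>R h x"
      proof (cases "x \<in> K")
        case True
        then show ?thesis using \<phi>(3)[OF True] K(2) by (auto simp: indicator_def)
      next
        case F: False
        have "infdist x K \<noteq> 0" using F False K(1) compact_imp_closed in_closed_iff_infdist_zero by blast
        then have "infdist x K > 0" using infdist_nonneg[of x K] by linarith
        then obtain N where N: "inverse (real (Suc N)) < infdist x K" using reals_Archimedean by blast
        have "\<phi> n x = 0" if "n \<ge> N" for n
        proof (rule \<phi>(4))
          have "1 / real (Suc n) \<le> 1 / real (Suc N)" using that by (simp add: frac_le)
          then show "x \<notin> U n" using N by (auto simp: U_def inverse_eq_divide)
        qed
        then have "\<forall>\<^sub>F n in sequentially. ?g x * \<phi> n x = 0"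
          unfolding eventually_sequentially by auto
        then show ?thesis using F by (simp add: tendsto_eventually)
      qed
    qed
  qed
  have zero: "(LINT x|lebesgue. ?g x * \<phi> n x) = 0" for n
    using z[OF \<phi>(1)[of n]] by (simp add: set_lebesgue_integral_def mult.assoc)
  have "0 = (LINT x|lebesgue. indicat_real K x *\<^sub>R h x)"
    using lim unfolding zero LIMSEQ_const_iff .
  then show ?thesis by (simp add: set_lebesgue_integral_def)
qed

text \<open>
  By inner regularity the set where \<open>h\<close> is positive is exhausted, up to small measure, by compact
  sets; these are null sets because the integral of \<open>h\<close> over them vanishes.
\<close>

lemma fundamental_lemma_nonpos:
  fixes h :: "plane \<Rightarrow> real"
  assumes \<Omega>: "open \<Omega>" "bounded \<Omega>" and h: "set_integrable lebesgue \<Omega> h"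
    and z: "\<And>\<phi>. test_function \<Omega> \<phi> \<Longrightarrow> (LINT x:\<Omega>|lebesgue. h x * \<phi> x) = 0"
  shows "AE x in lebesgue. x \<in> \<Omega> \<longrightarrow> h x \<le> 0"
proof -
  define S where "S = {x. 0 < indicat_real \<Omega> x *\<^sub>R h x}"
  have S_eq: "S = {x\<in>\<Omega>. 0 < h x}" by (auto simp: S_def indicator_def)
  have "(\<lambda>x. indicat_real \<Omega> x *\<^sub>R h x) \<in> borel_measurable lebesgue"
    using h by (auto simp: set_integrable_def)
  then have S: "S \<in> sets lebesgue"
    using borel_measurable_less[of "\<lambda>_. 0::real" lebesgue "\<lambda>x. indicat_real \<Omega> x *\<^sub>R h x"] by (simp add: S_def)
  have "emeasure lebesgue S \<le> ennreal e" if e: "0 < e" for e :: real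
  proof -
    obtain T where T: "closed T" "T \<subseteq> S" "S - T \<in> lmeasurable" "emeasure lebesgue (S - T) < ennreal e"
      using sets_lebesgue_inner_closed[OF S e] .
    have T\<Omega>: "T \<subseteq> \<Omega>" using T(2) S_eq by blast
    then have cT: "compact T" using T(1) \<Omega>(2) bounded_subset compact_eq_bounded_closed by blast
    have Tm: "T \<in> sets lebesgue" using cT by (simp add: borel_compact)
    have hT: "set_integrable lebesgue T h" using set_integrable_subset[OF h Tm T\<Omega>] .
    have "(LINT x|lebesgue. indicat_real T x *\<^sub>R h x) = 0"
      using integral_compact_zero[OF \<Omega>(1) h z cT T\<Omega>] by (simp add: set_lebesgue_integral_def)
    moreover have "AE x in lebesgue. 0 \<le> indicat_real T x *\<^sub>R h x"
      using T(2) S_eq by (intro AE_I2) (auto simp: indicator_def)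
    ultimately have "AE x in lebesgue. indicat_real T x *\<^sub>R h x = 0"
      using integral_nonneg_eq_0_iff_AE hT unfolding set_integrable_def by blast
    then have "AE x in lebesgue. x \<notin> T"
      by eventually_elim (use T(2) S_eq in \<open>auto simp: indicator_def\<close>)
    then have "T \<in> null_sets lebesgue" using AE_iff_null_sets[OF Tm] by simp
    then have "emeasure lebesgue T = 0" by blast
    moreover have "emeasure lebesgue S \<le> emeasure lebesgue (S - T) + emeasure lebesgue T"
      using S Tm by (metis (no_types) Un_Diff_cancel2 Un_absorb2 T(2) emeasure_subadditive sets.Diff)
    ultimately show ?thesis using T(4) by simp
  qed
  then have "emeasure lebesgue S = 0"
    using ennreal_le_epsilon[of 0 "emeasure lebesgue S"] by (metis add_0 le_zero_eq)
  then have "S \<in> null_sets lebesgue" using S by auto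
  then have "AE x in lebesgue. x \<notin> S" by (rule AE_not_in)
  then show ?thesis by eventually_elim (auto simp: S_eq)
qed

lemma fundamental_lemma:
  fixes h :: "plane \<Rightarrow> real"
  assumes \<Omega>: "open \<Omega>" "bounded \<Omega>" and h: "set_integrable lebesgue \<Omega> h"
    and z: "\<And>\<phi>. test_function \<Omega> \<phi> \<Longrightarrow> (LINT x:\<Omega>|lebesgue. h x * \<phi> x) = 0"
  shows "AE x in lebesgue. x \<in> \<Omega> \<longrightarrow> h x = 0"
proof -
  have "set_integrable lebesgue \<Omega> (\<lambda>x. - h x)" using h by (simp add: set_integrable_def)
  moreover have "(LINT x:\<Omega>|lebesgue. - h x * \<phi> x) = 0" if "test_function \<Omega> \<phi>" for \<phi>
    using z[OF that] by (simp add: set_lebesgue_integral_def)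
  ultimately have "AE x in lebesgue. x \<in> \<Omega> \<longrightarrow> - h x \<le> 0"
    using fundamental_lemma_nonpos[OF \<Omega>] by blast
  moreover have "AE x in lebesgue. x \<in> \<Omega> \<longrightarrow> h x \<le> 0" using fundamental_lemma_nonpos[OF \<Omega> h] z by blast
  ultimately show ?thesis by eventually_elim auto
qed

section \<open>Uniqueness and linearity of weak gradients\<close>

lemma test_function_sq_int:
  assumes "open \<Omega>" "bounded \<Omega>" "test_function \<Omega> \<phi>"
  shows "sq_int lebesgue \<Omega> (\<lambda>x. complex_of_real (\<phi> x))" "sq_int lebesgue \<Omega> (\<lambda>x. complex_of_real (pderiv_at i \<phi> x))"
proof -
  have fin: "\<Omega> \<in> sets lebesgue" "emeasure lebesgue \<Omega> < \<infinity>"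
    using assms(1,2) lmeasurable_open[of \<Omega>] by (auto simp: fmeasurable_def)
  have gen: "sq_int lebesgue \<Omega> (\<lambda>x. complex_of_real (f x))" if "continuous_on UNIV f" "\<forall>x\<in>\<Omega>. \<bar>f x\<bar>
      \<le> C" for f :: "plane \<Rightarrow> real" and C
  proof (rule sq_int_finite_bounded[OF _ fin, where C=C])
    have "(\<lambda>x. complex_of_real (f x)) \<in> borel_measurable lebesgue"
      using that(1) by (intro measurable_completion) (auto intro!: borel_measurable_continuous_onI continuous_intros)
    then show "set_borel_measurable lebesgue \<Omega> (\<lambda>x. complex_of_real (f x))"
      unfolding set_borel_measurable_def using fin(1) borel_measurable_scaleR[OF borel_measurable_indicator] by blast
  qed (use that in auto)
  show "sq_int lebesgue \<Omega> (\<lambda>x. complex_of_real (\<phi> x))"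
    using test_function_facts(1,3)[OF assms(3)] gen by blast
  have pc: "continuous_on A (pderiv_at i \<phi>)" for A
    using assms(3) continuous_on_subset unfolding test_function_def by blast
  have "compact (closure \<Omega>)" using assms(2) by simp
  then have "bounded (pderiv_at i \<phi> ` closure \<Omega>)"
    using pc compact_continuous_image compact_imp_bounded by blast
  then obtain C where "\<forall>x\<in>closure \<Omega>. \<bar>pderiv_at i \<phi> x\<bar> \<le> C" unfolding bounded_iff by auto
  then have "\<forall>x\<in>\<Omega>. \<bar>pderiv_at i \<phi> x\<bar> \<le> C" using closure_subset by blast
  then show "sq_int lebesgue \<Omega> (\<lambda>x. complex_of_real (pderiv_at i \<phi> x))" using gen[OF pc] by blast
qed

lemma test_pairing_integrable:
  assumes "open \<Omega>" "bounded \<Omega>" "test_function \<Omega> \<phi>" "sq_int lebesgue \<Omega> f"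
  shows "set_integrable lebesgue \<Omega> (\<lambda>x. f x * complex_of_real (\<phi> x))"
    "set_integrable lebesgue \<Omega> (\<lambda>x. f x * complex_of_real (pderiv_at i \<phi> x))"
  using sq_int_mult[OF assms(4) test_function_sq_int(1)[OF assms(1-3)]]
    sq_int_mult[OF assms(4) test_function_sq_int(2)[OF assms(1-3), of i]] by simp_all

lemma weak_gradient_unique:
  assumes \<Omega>: "open \<Omega>" "bounded \<Omega>" and g: "L2_gradient \<Omega> v g" and h: "L2_gradient \<Omega> v h"
  shows "AE x in lebesgue. x \<in> \<Omega> \<longrightarrow> g x $ i = h x $ i"
proof -
  have gh: "sq_int lebesgue \<Omega> (\<lambda>x. g x $ i)" "sq_int lebesgue \<Omega> (\<lambda>x. h x $ i)"
    using g h by (auto simp: L2_gradient_def L2_on_sq_int)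
  let ?d = "\<lambda>x. g x $ i - h x $ i"
  have d: "sq_int lebesgue \<Omega> ?d" using gh by (rule sq_int_diff)
  have zero: "(LINT x:\<Omega>|lebesgue. ?d x * complex_of_real (\<phi> x)) = 0" if \<phi>: "test_function \<Omega> \<phi>" for \<phi>
  proof -
    have "(LINT x:\<Omega>|lebesgue. g x $ i * complex_of_real (\<phi> x)) = (LINT x:\<Omega>|lebesgue. h x $ i * complex_of_real (\<phi> x))"
    proof -
      have "(LINT x:\<Omega>|lebesgue. v x * complex_of_real (pderiv_at i \<phi> x))
          = - (LINT x:\<Omega>|lebesgue. g x $ i * complex_of_real (\<phi> x))"
        using g \<phi> unfolding L2_gradient_def weak_gradient_def by blast
      moreover have "(LINT x:\<Omega>|lebesgue. v x * complex_of_real (pderiv_at i \<phi> x))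
          = - (LINT x:\<Omega>|lebesgue. h x $ i * complex_of_real (\<phi> x))"
        using h \<phi> unfolding L2_gradient_def weak_gradient_def by blast
      ultimately show ?thesis by simp
    qed
    then show ?thesis
      using set_integral_diff(2)[OF test_pairing_integrable(1)[OF \<Omega> \<phi> gh(1)] test_pairing_integrable(1)[OF \<Omega> \<phi> gh(2)]]
      by (simp add: algebra_simps)
  qed
  have "\<Omega> \<in> sets lebesgue" "emeasure lebesgue \<Omega> < \<infinity>"
    using \<Omega> lmeasurable_open[of \<Omega>] by (auto simp: fmeasurable_def)
  then have "sq_int lebesgue \<Omega> (\<lambda>x. 1)"
    by (intro sq_int_finite_bounded[where C=1]) (auto simp: set_borel_measurable_def)
  then have di: "set_integrable lebesgue \<Omega> ?d" using sq_int_mult[OF d, of "\<lambda>x. 1"] by simp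
  have eqs: "indicat_real \<Omega> x *\<^sub>R Re (?d x) = Re (indicat_real \<Omega> x *\<^sub>R ?d x)"
    "indicat_real \<Omega> x *\<^sub>R Im (?d x) = Im (indicat_real \<Omega> x *\<^sub>R ?d x)" 
    "indicat_real \<Omega> x *\<^sub>R (Re (?d x) * r) = Re (indicat_real \<Omega> x *\<^sub>R (?d x * complex_of_real r))"
    "indicat_real \<Omega> x *\<^sub>R (Im (?d x) * r) = Im (indicat_real \<Omega> x *\<^sub>R (?d x * complex_of_real r))" for x r
    by simp_all
  have "AE x in lebesgue. x \<in> \<Omega> \<longrightarrow> Re (?d x) = 0"
  proof (rule fundamental_lemma[OF \<Omega>])
    show "set_integrable lebesgue \<Omega> (\<lambda>x. Re (?d x))"
      using di unfolding set_integrable_def eqs by (rule integrable_Re)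
    show "(LINT x:\<Omega>|lebesgue. Re (?d x) * \<phi> x) = 0" if "test_function \<Omega> \<phi>" for \<phi>
      using zero[OF that] test_pairing_integrable(1)[OF \<Omega> that d]
      unfolding set_lebesgue_integral_def eqs set_integrable_def by (subst integral_Re) auto
  qed
  moreover have "AE x in lebesgue. x \<in> \<Omega> \<longrightarrow> Im (?d x) = 0"
  proof (rule fundamental_lemma[OF \<Omega>])
    show "set_integrable lebesgue \<Omega> (\<lambda>x. Im (?d x))"
      using di unfolding set_integrable_def eqs by (rule integrable_Im)
    show "(LINT x:\<Omega>|lebesgue. Im (?d x) * \<phi> x) = 0" if "test_function \<Omega> \<phi>" for \<phi>
      using zero[OF that] test_pairing_integrable(1)[OF \<Omega> that d]
      unfolding set_lebesgue_integral_def eqs set_integrable_def by (subst integral_Im) auto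
  qed
  ultimately show ?thesis by eventually_elim (auto simp: complex_eq_iff)
qed

lemma L2_gradient_add:
  assumes \<Omega>: "open \<Omega>" "bounded \<Omega>" and v: "L2_on \<Omega> v" "L2_gradient \<Omega> v g" and w: "L2_on \<Omega> w" "L2_gradient \<Omega> w h"
  shows "L2_gradient \<Omega> (\<lambda>x. v x + w x) (\<lambda>x. g x + h x)"
  unfolding L2_gradient_def
proof
  have gh: "sq_int lebesgue \<Omega> (\<lambda>x. g x $ i)" "sq_int lebesgue \<Omega> (\<lambda>x. h x $ i)" for i
    using v w by (auto simp: L2_gradient_def L2_on_sq_int)
  have vw: "sq_int lebesgue \<Omega> v" "sq_int lebesgue \<Omega> w" using v w by (auto simp: L2_on_sq_int)
  show "\<forall>i. L2_on \<Omega> (\<lambda>x. (g x + h x) $ i)" using sq_int_add[OF gh] by (simp add: L2_on_sq_int)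
  show "weak_gradient \<Omega> (\<lambda>x. v x + w x) (\<lambda>x. g x + h x)"
    unfolding weak_gradient_def
  proof (intro allI impI)
    fix \<phi> i assume \<phi>: "test_function \<Omega> \<phi>"
    note int = test_pairing_integrable[OF \<Omega> \<phi>]
    show "(LINT x:\<Omega>|lebesgue. (v x + w x) * complex_of_real (pderiv_at i \<phi> x))
        = - (LINT x:\<Omega>|lebesgue. (g x + h x) $ i * complex_of_real (\<phi> x))"
      using set_integral_add(2)[OF int(2)[OF vw(1)] int(2)[OF vw(2)], of i i]
        set_integral_add(2)[OF int(1)[OF gh(1)] int(1)[OF gh(2)], of i i] v(2) w(2) \<phi>
      by (simp add: L2_gradient_def weak_gradient_def algebra_simps)
  qed
qed

lemma L2_gradient_scale:
  assumes v: "L2_gradient \<Omega> v g"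
  shows "L2_gradient \<Omega> (\<lambda>x. c * v x) (\<lambda>x. \<chi> i. c * g x $ i)"
  unfolding L2_gradient_def
proof
  show "\<forall>i. L2_on \<Omega> (\<lambda>x. (\<chi> i. c * g x $ i) $ i)"
    using v by (auto intro!: sq_int_scale simp: L2_on_sq_int L2_gradient_def)
  show "weak_gradient \<Omega> (\<lambda>x. c * v x) (\<lambda>x. \<chi> i. c * g x $ i)"
    using v by (simp add: weak_gradient_def L2_gradient_def mult.assoc)
qed

lemma set_lint_cnj: "(LINT x:S|M. cnj (f x)) = cnj (LINT x:S|M. f x)"
proof -
  have "(\<lambda>x. indicat_real S x *\<^sub>R cnj (f x)) = (\<lambda>x. cnj (indicat_real S x *\<^sub>R f x))" by simp
  then show ?thesis
    unfolding set_lebesgue_integral_def by (simp only: Bochner_Integration.integral_cnj)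
qed

lemma L2_gradient_cnj:
  assumes v: "L2_gradient \<Omega> v g"
  shows "L2_gradient \<Omega> (\<lambda>x. cnj (v x)) (\<lambda>x. \<chi> i. cnj (g x $ i))"
  unfolding L2_gradient_def
proof
  show "\<forall>i. L2_on \<Omega> (\<lambda>x. (\<chi> i. cnj (g x $ i)) $ i)"
    using v sq_int_cnj by (auto simp: L2_on_sq_int L2_gradient_def)
  show "weak_gradient \<Omega> (\<lambda>x. cnj (v x)) (\<lambda>x. \<chi> i. cnj (g x $ i))"
    unfolding weak_gradient_def
  proof (intro allI impI)
    fix \<phi> i assume \<phi>: "test_function \<Omega> \<phi>"
    have "cnj (LINT x:\<Omega>|lebesgue. v x * complex_of_real (pderiv_at i \<phi> x)) =
      cnj (- (LINT x:\<Omega>|lebesgue. g x $ i * complex_of_real (\<phi> x)))"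
      using v \<phi> by (simp add: L2_gradient_def weak_gradient_def)
    then show "(LINT x:\<Omega>|lebesgue. cnj (v x) * complex_of_real (pderiv_at i \<phi> x))
        = - (LINT x:\<Omega>|lebesgue. (\<chi> i. cnj (g x $ i)) $ i * complex_of_real (\<phi> x))"
      by (simp flip: set_lint_cnj)
  qed
qed

lemma grad_L2_gradient: 
  assumes "v \<in> H1 \<Omega>" shows "L2_gradient \<Omega> v (grad \<Omega> v)"
proof -
  have "\<exists>g. L2_gradient \<Omega> v g" using assms by (simp add: H1_def)
  then show ?thesis unfolding grad_def by (rule someI_ex)
qed

lemma grad_sq_int: "v \<in> H1 \<Omega> \<Longrightarrow> sq_int lebesgue \<Omega> (\<lambda>x. grad \<Omega> v x $ i)"
  using grad_L2_gradient by (auto simp: L2_gradient_def L2_on_sq_int)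

lemma H1_sq_int: "v \<in> H1 \<Omega> \<Longrightarrow> sq_int lebesgue \<Omega> v"
  by (simp add: H1_def L2_on_sq_int)

lemma H1_subspace:
  assumes \<Omega>: "open \<Omega>" "bounded \<Omega>"
  shows "fun_subspace (H1 \<Omega>)"
  unfolding fun_subspace_def
proof (intro conjI ballI allI)
  have "L2_gradient \<Omega> (\<lambda>_. 0) (\<lambda>_. 0)"
    by (auto simp: L2_gradient_def weak_gradient_def L2_on_def set_borel_measurable_def set_integrable_def
        set_lebesgue_integral_def)
  moreover have "L2_on \<Omega> (\<lambda>_. 0)" by (auto simp: L2_on_def set_borel_measurable_def set_integrable_def)
  ultimately show "(\<lambda>_. 0) \<in> H1 \<Omega>" unfolding H1_def by blast
  show "(\<lambda>x. u x + v x) \<in> H1 \<Omega>" if "u \<in> H1 \<Omega>" "v \<in> H1 \<Omega>" for u v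
    using that L2_gradient_add[OF \<Omega>] sq_int_add unfolding H1_def L2_on_sq_int by blast
  show "(\<lambda>x. c * u x) \<in> H1 \<Omega>" if "u \<in> H1 \<Omega>" for u c
    using that L2_gradient_scale sq_int_scale unfolding H1_def L2_on_sq_int by blast
qed

lemma H1_cnj: "v \<in> H1 \<Omega> \<Longrightarrow> (\<lambda>x. cnj (v x)) \<in> H1 \<Omega>"
  using L2_gradient_cnj sq_int_cnj unfolding H1_def L2_on_sq_int by blast

text \<open>
  The chosen gradients of a sum, a multiple and a conjugate compete with the
  gradients formed from those of the given functions, and weak gradients agree almost everywhere.
\<close>

lemma grad_linear:
  assumes \<Omega>: "open \<Omega>" "bounded \<Omega>" and v: "v \<in> H1 \<Omega>"
  shows "w \<in> H1 \<Omega> \<Longrightarrow> AE x in lebesgue. x \<in> \<Omega> \<longrightarrow> grad \<Omega> (\<lambda>x. v x + w x) x $ i = grad \<Omega> v x $ i + grad \<Omega> w x $ i"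
    "AE x in lebesgue. x \<in> \<Omega> \<longrightarrow> grad \<Omega> (\<lambda>x. c * v x) x $ i = c * grad \<Omega> v x $ i"
    "AE x in lebesgue. x \<in> \<Omega> \<longrightarrow> grad \<Omega> (\<lambda>x. cnj (v x)) x $ i = cnj (grad \<Omega> v x $ i)"
proof -
  note sub = fun_subspaceD[OF H1_subspace[OF \<Omega>]]
  note unq = weak_gradient_unique[OF \<Omega> grad_L2_gradient]
  have L2: "L2_on \<Omega> u" if "u \<in> H1 \<Omega>" for u using that by (simp add: H1_def)
  show "AE x in lebesgue. x \<in> \<Omega> \<longrightarrow> grad \<Omega> (\<lambda>x. v x + w x) x $ i = grad \<Omega> v x $ i + grad \<Omega> w x $ i" if w: "w \<in> H1 \<Omega>"
    using unq[OF sub(2)[OF v w] L2_gradient_add[OF \<Omega> L2[OF v] grad_L2_gradient[OF v] L2[OF w]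
        grad_L2_gradient[OF w]], where i=i]
    by simp
  show "AE x in lebesgue. x \<in> \<Omega> \<longrightarrow> grad \<Omega> (\<lambda>x. c * v x) x $ i = c * grad \<Omega> v x $ i"
    using unq[OF sub(3)[OF v] L2_gradient_scale[OF grad_L2_gradient[OF v]], where i=i] by simp
  show "AE x in lebesgue. x \<in> \<Omega> \<longrightarrow> grad \<Omega> (\<lambda>x. cnj (v x)) x $ i = cnj (grad \<Omega> v x $ i)"
    using unq[OF H1_cnj[OF v] L2_gradient_cnj[OF grad_L2_gradient[OF v]], where i=i] by simp
qed

section \<open>Piecewise affine functions on triangular meshes\<close>

lemma affine_field_iff:
  "affine_field p \<longleftrightarrow> (\<exists>c L. linear (L :: plane \<Rightarrow> complex) \<and> p = (\<lambda>x. c + L x))"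
proof
  assume "affine_field p"
  then obtain c and b :: "complex^2" where p: "\<And>x. p x = c + (\<Sum>i\<in>UNIV. complex_of_real (x $ i) * b $ i)"
    unfolding affine_field_def by blast
  have "linear (\<lambda>x :: plane. \<Sum>i\<in>UNIV. complex_of_real (x $ i) * b $ i)"
    by (intro linearI) (simp_all add: distrib_right sum.distrib sum_distrib_left scaleR_conv_of_real[where
        'a=complex] mult.assoc)
  then show "\<exists>c L. linear (L :: plane \<Rightarrow> complex) \<and> p = (\<lambda>x. c + L x)"
    using p by blast
next
  assume "\<exists>c L. linear (L :: plane \<Rightarrow> complex) \<and> p = (\<lambda>x. c + L x)"
  then obtain c and L :: "plane \<Rightarrow> complex" where L: "linear L" and p: "p = (\<lambda>x. c + L x)" by blast
  have "L x = (\<Sum>i\<in>UNIV. complex_of_real (x $ i) * (\<chi> i. L (axis i 1)) $ i)" for x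
  proof -
    have "x = (\<Sum>i\<in>UNIV. (x $ i) *\<^sub>R axis i 1)"
      using basis_expansion[of x] by (simp add: scalar_mult_eq_scaleR)
    then have "L x = (\<Sum>i\<in>UNIV. (x $ i) *\<^sub>R L (axis i 1))"
      by (metis (no_types, lifting) L linear_scale linear_sum sum.cong)
    then show ?thesis by (simp add: scaleR_conv_of_real)
  qed
  then show "affine_field p" unfolding affine_field_def p
    by (intro exI[of _ c] exI[of _ "\<chi> i. L (axis i 1)"] allI) (rule arg_cong)
qed

lemma affine_field_subspace: "fun_subspace (Collect affine_field)"
  unfolding fun_subspace_def
proof (intro conjI ballI allI)
  show "(\<lambda>_. 0) \<in> Collect affine_field"
    unfolding affine_field_def by (auto intro!: exI[of _ 0])
next
  fix u v assume "u \<in> Collect affine_field" "v \<in> Collect affine_field"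
  then obtain c L d M where *: "linear (L :: plane \<Rightarrow> complex)" "u
      = (\<lambda>x. c + L x)" "linear (M :: plane \<Rightarrow> complex)" "v = (\<lambda>x. d + M x)"
    unfolding affine_field_iff mem_Collect_eq by blast
  then have "linear (\<lambda>x. L x + M x)" "(\<lambda>x. u x + v x) = (\<lambda>x. (c + d) + (L x + M x))"
    by (auto intro: linear_compose_add)
  then show "(\<lambda>x. u x + v x) \<in> Collect affine_field" unfolding affine_field_iff mem_Collect_eq
    by (intro exI[of _ "c + d"] exI[of _ "\<lambda>x. L x + M x"]) simp
next
  fix u a assume "u \<in> Collect affine_field"
  then obtain c L where *: "linear (L :: plane \<Rightarrow> complex)" "u = (\<lambda>x. c + L x)"
    unfolding affine_field_iff mem_Collect_eq by blast
  then have "linear (\<lambda>x. a * L x)" "(\<lambda>x. a * u x) = (\<lambda>x. (a * c) + a * L x)"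
    by (auto simp: linear_iff algebra_simps)
  then show "(\<lambda>x. a * u x) \<in> Collect affine_field" unfolding affine_field_iff mem_Collect_eq
    by (intro exI[of _ "a * c"] exI[of _ "\<lambda>x. a * L x"]) simp
qed

lemma affine_field_cnj: 
  assumes "affine_field p" shows "affine_field (\<lambda>x. cnj (p x))"
proof -
  obtain c and b :: "complex^2" where p: "\<And>x. p x = c + (\<Sum>i\<in>UNIV. complex_of_real (x $ i) * b $ i)"
    using assms unfolding affine_field_def by blast
  show ?thesis unfolding affine_field_def
    by (intro exI[of _ "cnj c"] exI[of _ "\<chi> i. cnj (b $ i)"]) (simp add: p)
qed

lemma affine_field_continuous: 
  assumes "affine_field p" shows "continuous_on A p"
proof -
  obtain c and b :: "complex^2" where p: "p = (\<lambda>x. c + (\<Sum>i\<in>UNIV. complex_of_real (x $ i) * b $ i))"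
    using assms unfolding affine_field_def by blast
  show ?thesis unfolding p by (intro continuous_intros)
qed

lemma affine_field_zero_hull:
  assumes "affine_field p" "\<And>z. z \<in> C \<Longrightarrow> p z = 0" "x \<in> affine hull C"
  shows "p x = 0"
proof -
  obtain c L where *: "linear (L :: plane \<Rightarrow> complex)" "p = (\<lambda>x. c + L x)"
    using assms(1) unfolding affine_field_iff by blast
  have "affine {x. p x = 0}"
    unfolding affine_def
  proof (intro ballI allI impI)
    fix x y and u v :: real assume xy: "x \<in> {x. p x = 0}" "y \<in> {x. p x = 0}" and uv: "u + v = 1"
    have "p (u *\<^sub>R x + v *\<^sub>R y) = (u + v) *\<^sub>R c + (u *\<^sub>R L x + v *\<^sub>R L y)"
      using uv by (simp add: *(2) linear_add[OF *(1)] linear_scale[OF *(1)])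
    also have "\<dots> = u *\<^sub>R p x + v *\<^sub>R p y" unfolding *(2) by (simp add: algebra_simps)
    finally show "u *\<^sub>R x + v *\<^sub>R y \<in> {x. p x = 0}" using xy by simp
  qed
  moreover have "C \<subseteq> {x. p x = 0}" using assms(2) by auto
  ultimately have "affine hull C \<subseteq> {x. p x = 0}" by (intro hull_minimal)
  then show ?thesis using assms(3) by auto
qed

definition corners :: "plane set \<Rightarrow> plane set" where
  "corners T = {z. z extreme_point_of T}"

lemma triangle_facts:
  assumes "2 simplex T"
  shows "finite (corners T)" "\<not> affine_dependent (corners T)" "corners T \<noteq> {}" "T
      = convex hull corners T" "affine hull T = UNIV"
    "interior T \<noteq> {}" "compact T" "convex T" "closed T" "bounded T" "corners T \<subseteq> T" "affine hull (corners T) = UNIV"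
proof -
  obtain C where C: "finite C" "\<not> affine_dependent C" "int (card C) = 3" "T = convex hull C"
    using assms unfolding simplex by auto
  have eq: "corners T = C"
    unfolding corners_def C(4) using extreme_point_of_convex_hull_affine_independent[OF C(2)] by blast
  show "finite (corners T)" "\<not> affine_dependent (corners T)" "T
      = convex hull corners T" "corners T \<noteq> {}" "corners T \<subseteq> T"
    using C eq by (auto simp: hull_inc)
  show "compact T" "convex T" "closed T" using compact_simplex convex_simplex closed_simplex assms by blast+
  then show "bounded T" using compact_imp_bounded by blast
  have "aff_dim T = DIM(plane)" using aff_dim_simplex[OF assms] by simp
  then show hull: "affine hull T = UNIV" using aff_dim_eq_full by blast
  then show "affine hull (corners T) = UNIV" using \<open>T = convex hull corners T\<close> affine_hull_convex_hull by metis
  show "interior T \<noteq> {}"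
    using hull \<open>convex T\<close> rel_interior_interior rel_interior_eq_empty by (metis C(4) affine_hull_empty empty_not_UNIV)
qed

lemma triangle_unisolvent:
  assumes "2 simplex T" "affine_field p" "\<And>z. z \<in> corners T \<Longrightarrow> p z = 0"
  shows "p = (\<lambda>_. 0)"
  using affine_field_zero_hull[OF assms(2,3)] triangle_facts(12)[OF assms(1)] by auto

lemma triangle_interpolation:
  assumes "2 simplex T"
  obtains p where "affine_field p" "\<And>z. z \<in> corners T \<Longrightarrow> p z = f z"
proof -
  obtain a where a: "a \<in> corners T" using triangle_facts(3)[OF assms] by blast
  have "independent ((\<lambda>x. - a + x) ` (corners T - {a}))"
    using triangle_facts(2)[OF assms] affine_dependent_iff_dependent2[OF a] by blast
  from linear_independent_extend[OF this, of "\<lambda>y. f (a + y) - f a"]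
  obtain L :: "plane \<Rightarrow> complex" where L: "linear L" "\<forall>y\<in>(\<lambda>x. - a + x) ` (corners T - {a}). L y = f (a + y) - f a"
    by blast
  have "f a - L a + L z = f z" if z: "z \<in> corners T" for z
  proof (cases "z = a")
    case False
    then have "L (- a + z) = f z - f a" using L(2) z by auto
    moreover have "L (- a + z) = L z - L a" using linear_diff[OF L(1), of z a] by simp
    ultimately have "L z - L a = f z - f a" by (simp only:)
    then show ?thesis by (simp add: algebra_simps)
  qed simp
  moreover have "affine_field (\<lambda>x. (f a - L a) + L x)" unfolding affine_field_iff using L(1) by blast
  ultimately show ?thesis using that by blast
qed

text \<open>
  A face is the convex hull of its extreme points, and these are corners of the triangle.
\<close>

lemma affine_field_zero_face:
  assumes T: "2 simplex T" and F: "F face_of T" and p: "affine_field p" "\<And>z. z \<in> corners T \<Longrightarrow> z \<in> F \<Longrightarrow> p z = 0"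
    and x: "x \<in> F"
  shows "p x = 0"
proof -
  have "compact F" "convex F"
    using F triangle_facts(7,8)[OF T] face_of_imp_compact face_of_imp_convex by blast+
  then have "F = convex hull {z. z extreme_point_of F}" by (rule Krein_Milman_Minkowski)
  then have hull: "x \<in> affine hull {z. z extreme_point_of F}" using x convex_hull_subset_affine_hull by blast
  have "p z = 0" if "z extreme_point_of F" for z
    using that p(2)[of z] extreme_point_of_face[OF F] by (auto simp: corners_def)
  then show ?thesis by (intro affine_field_zero_hull[OF p(1) _ hull]) auto
qed

locale mesh =
  fixes \<Omega> :: "plane set" and \<T> :: "plane set set"
  assumes \<Omega>: "open \<Omega>" "bounded \<Omega>" "\<Omega> \<noteq> {}" and frontier_null: "negligible (frontier \<Omega>)"
    and mesh: "triangular_mesh \<Omega> \<T>"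
begin

lemma finite_mesh: "finite \<T>"
  using mesh by (auto simp: triangular_mesh_def triangulation_def)

lemma triangle: "T \<in> \<T> \<Longrightarrow> 2 simplex T"
  using mesh by (auto simp: triangular_mesh_def)

lemma Union_mesh: "\<Union>\<T> = closure \<Omega>"
  using mesh by (auto simp: triangular_mesh_def)

lemma mesh_face:
  assumes "T \<in> \<T>" "T' \<in> \<T>" shows "T \<inter> T' face_of T" "T \<inter> T' face_of T'"
proof -
  have "T \<inter> T' face_of T" if "T \<in> \<T>" "T' \<in> \<T>" for T T'
    using mesh that by (simp add: triangular_mesh_def triangulation_def)
  from this[OF assms] this[OF assms(2,1)] show "T \<inter> T' face_of T" "T \<inter> T' face_of T'"
    by (simp_all add: Int_commute)
qed

lemma mesh_nonempty: "\<T> \<noteq> {}"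
  using Union_mesh \<Omega>(3) closure_subset by fastforce

lemma vertices_eq: "vertices \<T> = (\<Union>T\<in>\<T>. corners T)"
  by (auto simp: vertices_def corners_def)

lemma finite_vertices: "finite (vertices \<T>)"
  unfolding vertices_eq using finite_mesh triangle triangle_facts(1) by blast

lemma vertices_sub: "vertices \<T> \<subseteq> closure \<Omega>"
  unfolding vertices_eq using triangle triangle_facts(11) Union_mesh by blast

text \<open>
  Two elements meet in a face of both, and a proper face does not reach the interior.
\<close>

lemma interiors_disjoint:
  assumes "T \<in> \<T>" "T' \<in> \<T>" "x \<in> interior T" "x \<in> T'"
  shows "T = T'"
proof -
  have "T \<inter> T' = T"
    using face_of_disjoint_interior[OF mesh_face(1)[OF assms(1,2)]] assms interior_subset by blast
  then have sub: "T \<subseteq> T'" by blast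
  have "T face_of T'" using mesh_face(2)[OF assms(1,2)] \<open>T \<inter> T' = T\<close> by simp
  moreover have "T \<inter> interior T' \<noteq> {}" using interior_mono[OF sub] assms(3) interior_subset by blast
  ultimately show ?thesis using face_of_disjoint_interior by blast
qed

lemma AE_interior: "AE x in lebesgue. x \<in> closure \<Omega> \<longrightarrow> (\<exists>T\<in>\<T>. x \<in> interior T)"
proof -
  have "negligible (\<Union>T\<in>\<T>. frontier T)"
    using finite_mesh triangle triangle_facts(8) negligible_convex_frontier by (intro negligible_Union) auto
  then have "AE x in lebesgue. x \<notin> (\<Union>T\<in>\<T>. frontier T)"
    using AE_not_in negligible_iff_null_sets by blast
  then show ?thesis
  proof eventually_elim
    case (elim x)
    show ?case
    proof
      assume "x \<in> closure \<Omega>"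
      then obtain T where T: "T \<in> \<T>" "x \<in> T" using Union_mesh by blast
      then show "\<exists>T\<in>\<T>. x \<in> interior T"
        using elim triangle_facts(9)[OF triangle[OF T(1)]] by (auto simp: frontier_def)
    qed
  qed
qed

lemma AE_overlap:
  assumes "T \<in> \<T>" "T' \<in> \<T>"
  shows "AE x in lebesgue. x \<in> T \<and> x \<in> T' \<longrightarrow> T = T'"
  using AE_interior
proof eventually_elim
  case (elim x)
  show ?case
  proof
    assume x: "x \<in> T \<and> x \<in> T'"
    then obtain K where "K \<in> \<T>" "x \<in> interior K" using elim Union_mesh assms by blast
    then show "T = T'" using interiors_disjoint[of K T x] interiors_disjoint[of K T' x] assms x by blast
  qed
qed

lemma mesh_sets: 
  assumes "T \<in> \<T>" shows "T \<in> sets lebesgue" "T \<in> sets borel" "negligible (T - \<Omega>)" "T \<subseteq> closure \<Omega>"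
proof -
  show "T \<in> sets borel" using triangle_facts(9)[OF triangle[OF assms]] by simp
  then show "T \<in> sets lebesgue" by simp
  show sub: "T \<subseteq> closure \<Omega>" using Union_mesh assms by blast
  have "T - \<Omega> \<subseteq> frontier \<Omega>" using sub \<Omega>(1) by (auto simp: frontier_def interior_open)
  then show "negligible (T - \<Omega>)" using frontier_null negligible_subset by blast
qed

lemma P1_affine:
  assumes "v \<in> P1 \<T>" "T \<in> \<T>"
  obtains p where "affine_field p" "\<forall>x\<in>T. v x = p x"
  using assms unfolding P1_def by blast

lemma P1_continuous: "v \<in> P1 \<T> \<Longrightarrow> continuous_on (closure \<Omega>) v"
  unfolding P1_def Union_mesh by blast

lemma P1_outside: "v \<in> P1 \<T> \<Longrightarrow> x \<notin> closure \<Omega> \<Longrightarrow> v x = 0"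
  unfolding P1_def Union_mesh by blast

lemma P1_I:
  assumes "\<And>x. x \<notin> closure \<Omega> \<Longrightarrow> v x = 0" "\<And>T. T \<in> \<T> \<Longrightarrow> \<exists>p. affine_field p \<and> (\<forall>x\<in>T. v x = p x)"
  shows "v \<in> P1 \<T>"
proof -
  have "continuous_on (\<Union>T\<in>\<T>. T) v"
  proof (rule continuous_on_closed_Union[OF finite_mesh])
    fix T assume T: "T \<in> \<T>"
    show "closed T" using triangle_facts(9)[OF triangle[OF T]] .
    obtain p where p: "affine_field p" "\<forall>x\<in>T. v x = p x" using assms(2)[OF T] by blast
    show "continuous_on T v"
      using affine_field_continuous[OF p(1), of T] p(2) by (simp cong: continuous_on_cong)
  qed
  then show ?thesis using assms unfolding P1_def Union_mesh[symmetric] by simp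
qed

lemma P1_subspace: "fun_subspace (P1 \<T>)"
proof -
  note A = fun_subspaceD[OF affine_field_subspace, unfolded mem_Collect_eq]
  show ?thesis unfolding fun_subspace_def
  proof (intro conjI ballI allI)
    show "(\<lambda>_. 0) \<in> P1 \<T>" using A(1) by (intro P1_I) auto
    show "(\<lambda>x. u x + v x) \<in> P1 \<T>" if uv: "u \<in> P1 \<T>" "v \<in> P1 \<T>" for u v
    proof (rule P1_I)
      show "u x + v x = 0" if "x \<notin> closure \<Omega>" for x using P1_outside[OF uv(1) that] P1_outside[OF uv(2) that] by simp
      fix T assume T: "T \<in> \<T>"
      obtain p where p: "affine_field p" "\<forall>x\<in>T. u x = p x" using P1_affine[OF uv(1) T] .
      obtain q where q: "affine_field q" "\<forall>x\<in>T. v x = q x" using P1_affine[OF uv(2) T] .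
      show "\<exists>p. affine_field p \<and> (\<forall>x\<in>T. u x + v x = p x)"
        using A(2)[OF p(1) q(1)] p(2) q(2) by (intro exI[of _ "\<lambda>x. p x + q x"]) auto
    qed
    show "(\<lambda>x. c * u x) \<in> P1 \<T>" if u: "u \<in> P1 \<T>" for c u
    proof (rule P1_I)
      show "c * u x = 0" if "x \<notin> closure \<Omega>" for x using P1_outside[OF u that] by simp
      fix T assume T: "T \<in> \<T>"
      obtain p where p: "affine_field p" "\<forall>x\<in>T. u x = p x" using P1_affine[OF u T] .
      show "\<exists>p. affine_field p \<and> (\<forall>x\<in>T. c * u x = p x)"
        using A(3)[OF p(1), of c] p(2) by (intro exI[of _ "\<lambda>x. c * p x"]) auto
    qed
  qed
qed

lemma P1_cnj:
  assumes v: "v \<in> P1 \<T>" shows "(\<lambda>x. cnj (v x)) \<in> P1 \<T>"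
proof (rule P1_I)
  show "cnj (v x) = 0" if "x \<notin> closure \<Omega>" for x using P1_outside[OF v that] by simp
  fix T assume T: "T \<in> \<T>"
  obtain p where p: "affine_field p" "\<forall>x\<in>T. v x = p x" using P1_affine[OF v T] .
  show "\<exists>p. affine_field p \<and> (\<forall>x\<in>T. cnj (v x) = p x)"
    using affine_field_cnj[OF p(1)] p(2) by (intro exI[of _ "\<lambda>x. cnj (p x)"]) auto
qed

text \<open>
  The vertices separate continuous piecewise affine functions. This is how the finite dimension of
  the finite element spaces enters \<open>form_representation\<close>.
\<close>

lemma P1_unisolvent:
  assumes v: "v \<in> P1 \<T>" and z: "\<forall>z\<in>vertices \<T>. v z = 0"
  shows "v = (\<lambda>_. 0)"
proof
  fix x show "v x = 0"
  proof (cases "x \<in> closure \<Omega>")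
    case False then show ?thesis using P1_outside[OF v] by simp
  next
    case True
    then obtain T where T: "T \<in> \<T>" "x \<in> T" using Union_mesh by blast
    obtain p where p: "affine_field p" "\<forall>x\<in>T. v x = p x" using P1_affine[OF v T(1)] .
    have "p z = 0" if "z \<in> corners T" for z
      using z p(2) that T(1) triangle_facts(11)[OF triangle[OF T(1)]] vertices_eq by (metis UN_I subsetD)
    then have "p = (\<lambda>_. 0)" using triangle_unisolvent[OF triangle[OF T(1)] p(1)] by blast
    then show ?thesis using bspec[OF p(2) T(2)] by simp
  qed
qed

text \<open>
  The affine interpolants on two elements agree on the common face, since the extreme points of that
  face are corners of both elements; hence they glue to a continuous function.
\<close>

lemma nodal_interpolant: "\<exists>!v. v \<in> P1 \<T> \<and> (\<forall>z\<in>vertices \<T>. v z = f z)"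
proof (rule ex_ex1I)
  have "\<exists>p. affine_field p \<and> (\<forall>z\<in>corners T. p z = f z)" if T: "T \<in> \<T>" for T
    by (rule triangle_interpolation[OF triangle[OF T], of f]) blast
  then obtain p where p: "\<And>T. T \<in> \<T> \<Longrightarrow> affine_field (p T)" "\<And>T z. T \<in> \<T> \<Longrightarrow> z \<in> corners T \<Longrightarrow> p T z = f z"
    by metis
  have agree: "p T x = p T' x" if T: "T \<in> \<T>" "T' \<in> \<T>" and x: "x \<in> T" "x \<in> T'" for T T' x
  proof -
    have "(\<lambda>x. p T x - p T' x) x = 0"
    proof (rule affine_field_zero_face[OF triangle[OF T(1)] mesh_face(1)[OF T]])
      show "affine_field (\<lambda>x. p T x - p T' x)"
        using fun_subspaceD(4)[OF affine_field_subspace] p(1) T by simp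
      show "x \<in> T \<inter> T'" using x by blast
      fix z assume z: "z \<in> corners T" "z \<in> T \<inter> T'"
      then have "z extreme_point_of (T \<inter> T')"
        using extreme_point_of_face[OF mesh_face(1)[OF T]] by (simp add: corners_def)
      then have "z \<in> corners T'" using extreme_point_of_face[OF mesh_face(2)[OF T]] by (simp add: corners_def)
      then show "p T z - p T' z = 0" using p(2) z(1) T by simp
    qed
    then show ?thesis by simp
  qed
  define v where "v x = (if x \<in> closure \<Omega> then p (SOME T. T \<in> \<T> \<and> x \<in> T) x else 0)" for x
  have v: "v x = p T x" if T: "T \<in> \<T>" "x \<in> T" for T x
  proof -
    have "(SOME T. T \<in> \<T> \<and> x \<in> T) \<in> \<T> \<and> x \<in> (SOME T. T \<in> \<T> \<and> x \<in> T)"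
      by (rule someI[of _ T]) (use T in blast)
    then have "p (SOME T. T \<in> \<T> \<and> x \<in> T) x = p T x"
      using agree[OF _ T(1) _ T(2)] by blast
    moreover have "x \<in> closure \<Omega>" using T Union_mesh by blast
    ultimately show ?thesis by (simp add: v_def)
  qed
  have "v \<in> P1 \<T>"
    using p(1) v by (intro P1_I) (simp add: v_def, blast)
  moreover have "v z = f z" if z: "z \<in> vertices \<T>" for z
  proof -
    obtain T where T: "T \<in> \<T>" "z \<in> corners T" using z unfolding vertices_eq by blast
    then have "z \<in> T" using triangle_facts(11)[OF triangle[OF T(1)]] by blast
    then show ?thesis using v[OF T(1)] p(2)[OF T] by simp
  qed
  ultimately show "\<exists>v. v \<in> P1 \<T> \<and> (\<forall>z\<in>vertices \<T>. v z = f z)" by blast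
next
  fix v w assume v: "v \<in> P1 \<T> \<and> (\<forall>z\<in>vertices \<T>. v z = f z)" and w: "w \<in> P1 \<T> \<and> (\<forall>z\<in>vertices \<T>. w z = f z)"
  then have "(\<lambda>x. v x - w x) = (\<lambda>_. 0)"
    using fun_subspaceD(4)[OF P1_subspace, of v w] by (intro P1_unisolvent) simp_all
  then show "v = w" by (simp add: fun_eq_iff)
qed

end

section \<open>Weak gradients and traces of piecewise affine functions\<close>

lemma affine_field_lipschitz:
  assumes "affine_field p"
  obtains L where "0 \<le> L" "\<And>x y. cmod (p x - p y) \<le> L * norm (x - y)"
proof -
  obtain c D where *: "linear (D :: plane \<Rightarrow> complex)" "p = (\<lambda>x. c + D x)"
    using assms unfolding affine_field_iff by blast
  obtain B where B: "0 < B" "\<And>x. norm (D x) \<le> B * norm x" using linear_bounded_pos[OF *(1)] by blast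
  have "cmod (p x - p y) \<le> B * norm (x - y)" for x y
    using B(2)[of "x - y"] by (simp add: *(2) linear_diff[OF *(1)])
  then show ?thesis using that[of B] B(1) by simp
qed

lemma test_function_has_pderiv:
  assumes "test_function \<Omega> \<phi>"
  shows "((\<lambda>s. \<phi> (x + s *\<^sub>R axis i 1)) has_real_derivative pderiv_at i \<phi> (x + s *\<^sub>R axis i 1)) (at s)"
proof -
  have d: "(\<phi> has_derivative frechet_derivative \<phi> (at (x + s *\<^sub>R axis i 1))) (at (x + s *\<^sub>R axis i 1))"
    using assms unfolding test_function_def by (simp add: frechet_derivative_works)
  have 1: "((\<lambda>s. x + s *\<^sub>R axis i 1) has_derivative (\<lambda>h. h *\<^sub>R axis i 1)) (at s)"
    by (auto intro!: derivative_eq_intros)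
  have "((\<lambda>s. \<phi> (x + s *\<^sub>R axis i 1)) has_derivative (\<lambda>h. frechet_derivative \<phi> (at (x + s *\<^sub>R axis i 1)) (h *\<^sub>R
      axis i 1))) (at s)"
    by (rule has_derivative_compose[OF 1 d])
  moreover have "frechet_derivative \<phi> (at (x + s *\<^sub>R axis i 1)) (h *\<^sub>R axis i 1)
      = pderiv_at i \<phi> (x + s *\<^sub>R axis i 1) * h" for h
    using linear_scale[OF has_derivative_linear[OF d], of h "axis i 1"] by (simp add: pderiv_at_def)
  ultimately show ?thesis by (simp add: has_field_derivative_def)
qed

text \<open>
  The partial derivative is continuous and vanishes off the compact support, so it is bounded.
\<close>

lemma test_function_lipschitz:
  assumes "test_function \<Omega> \<phi>"
  obtains C where "0 \<le> C" "\<And>x s. \<bar>\<phi> (x + s *\<^sub>R axis i 1) - \<phi> x\<bar> \<le> C * \<bar>s\<bar>"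
proof -
  let ?K = "closure {x. \<phi> x \<noteq> 0}"
  have out: "pderiv_at i \<phi> x = 0" if x: "x \<notin> ?K" for x
  proof -
    have "(\<phi> has_derivative (\<lambda>_. 0)) (at x)"
    proof (rule has_derivative_transform_within_open[OF has_derivative_const[of 0], of "- ?K"])
      show "0 = \<phi> y" if "y \<in> - ?K" for y
        using that closure_subset[of "{x. \<phi> x \<noteq> 0}"] by (metis (mono_tags) ComplD mem_Collect_eq subsetD)
    qed (use x in auto)
    then show ?thesis unfolding pderiv_at_def using frechet_derivative_at by metis
  qed
  have "bounded (pderiv_at i \<phi> ` ?K)"
    using assms compact_continuous_image compact_imp_bounded continuous_on_subset subset_UNIV
    unfolding test_function_def by metis
  then obtain C where C: "\<And>x. x \<in> ?K \<Longrightarrow> \<bar>pderiv_at i \<phi> x\<bar> \<le> C" unfolding bounded_iff by auto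
  have bnd: "\<bar>pderiv_at i \<phi> x\<bar> \<le> max 0 C" for x
  proof (cases "x \<in> ?K")
    case True then show ?thesis using C[OF True] by simp
  qed (simp add: out)
  have "\<bar>\<phi> (x + s *\<^sub>R axis i 1) - \<phi> x\<bar> \<le> max 0 C * \<bar>s\<bar>" for x s
    using field_differentiable_bound[of UNIV "\<lambda>s. \<phi> (x + s *\<^sub>R axis i 1)"
        "\<lambda>s. pderiv_at i \<phi> (x + s *\<^sub>R axis i 1)" "max 0 C" s 0]
      test_function_has_pderiv[OF assms] bnd by simp
  then show ?thesis using that[of "max 0 C"] by simp
qed

lemma lborel_integral_shift:
  fixes f :: "'a::euclidean_space \<Rightarrow> 'b::{banach, second_countable_topology}"
  assumes "f \<in> borel_measurable borel"
  shows "(LINT x|lborel. f (x + c)) = (LINT x|lborel. f x)"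
proof -
  have "(LINT x|lborel. f x) = (LINT x|distr lborel borel ((+) c). f x)" by (simp add: lborel_distr_plus)
  also have "\<dots> = (LINT x|lborel. f (c + x))" using assms by (intro integral_distr) simp_all
  finally show ?thesis by (simp add: add.commute)
qed

lemma integrable_lborel_bounded:
  fixes f :: "'a::euclidean_space \<Rightarrow> complex"
  assumes "f \<in> borel_measurable borel" "\<And>x. cmod (f x) \<le> C" "bounded S" "S \<in> sets borel" "\<And>x. x \<notin> S \<Longrightarrow> f x = 0"
  shows "integrable lborel f"
  by (rule integrableI_bounded_set[of S _ _ C]) (use assms emeasure_bounded_finite in auto)

context mesh begin

text \<open>
  The elements cut a segment into finitely many closed pieces, on each of which the function is
  Lipschitz. Only segments inside the closed domain are considered, because the slopes do not bound the
  difference between two points on opposite sides of a reentrant part of the boundary.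
\<close>

lemma P1_lipschitz:
  assumes v: "v \<in> P1 \<T>"
  obtains L where "0 \<le> L" "\<And>x y. closed_segment x y \<subseteq> closure \<Omega> \<Longrightarrow> cmod (v y - v x) \<le> L * norm (y - x)"
proof -
  have "\<exists>L\<ge>0. \<forall>x\<in>T. \<forall>y\<in>T. cmod (v x - v y) \<le> L * norm (x - y)" if T: "T \<in> \<T>" for T
  proof -
    obtain p where p: "affine_field p" "\<forall>x\<in>T. v x = p x" using P1_affine[OF v T] .
    obtain L where "0 \<le> L" "\<And>x y. cmod (p x - p y) \<le> L * norm (x - y)" using affine_field_lipschitz[OF p(1)] by blast
    then show ?thesis using p(2) by auto
  qed
  then obtain l where l: "\<And>T. T \<in> \<T> \<Longrightarrow> 0 \<le> l T" "\<And>T x y. T \<in> \<T> \<Longrightarrow> x \<in> T \<Longrightarrow> y \<in> T \<Longrightarrow> cmod (v x - v y) \<le> l T * norm (x - y)"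
    by metis
  define L where "L = (\<Sum>T\<in>\<T>. l T)"
  have L: "l T \<le> L" if "T \<in> \<T>" for T unfolding L_def using that l(1) finite_mesh by (intro member_le_sum) auto
  have L0: "0 \<le> L" unfolding L_def using l(1) by (intro sum_nonneg)
  have "cmod (v y - v x) \<le> L * norm (y - x)" if seg: "closed_segment x y \<subseteq> closure \<Omega>" for x y
  proof -
    let ?g = "\<lambda>t. x + t *\<^sub>R (y - x)"
    let ?U = "\<lambda>T. ?g -` T"
    have "(L * norm (y - x))-lipschitz_on {0..1} (\<lambda>t. v (?g t))"
    proof (rule lipschitz_on_closed_Union[where U="?U", OF _ _ finite_mesh])
      show "{0..1} \<subseteq> (\<Union>T\<in>\<T>. ?U T)"
      proof
        fix t :: real assume t: "t \<in> {0..1}"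
        then have "?g t \<in> closed_segment x y"
          unfolding closed_segment_def by (auto intro!: exI[of _ t] simp: algebra_simps)
        then show "t \<in> (\<Union>T\<in>\<T>. ?U T)" using seg Union_mesh by fastforce
      qed
      fix T assume T: "T \<in> \<T>"
      show "closed (?U T)"
        using triangle_facts(9)[OF triangle[OF T]] by (intro closed_vimage) (auto intro!: continuous_intros)
      show "(L * norm (y - x))-lipschitz_on (?U T) (\<lambda>t. v (?g t))"
      proof (rule lipschitz_onI)
        fix s t assume st: "s \<in> ?U T" "t \<in> ?U T"
        have "?g s - ?g t = (s - t) *\<^sub>R (y - x)" by (simp add: algebra_simps)
        then have "cmod (v (?g s) - v (?g t)) \<le> l T * (\<bar>s - t\<bar> * norm (y - x))"
          using l(2)[OF T, of "?g s" "?g t"] st by simp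
        also have "\<dots> \<le> L * (\<bar>s - t\<bar> * norm (y - x))" using L[OF T] by (intro mult_right_mono) auto
        finally show "dist (v (?g s)) (v (?g t)) \<le> L * norm (y - x) * dist s t"
          by (simp add: dist_norm algebra_simps)
      qed (use L0 in auto)
    qed (use L0 in auto)
    from lipschitz_onD[OF this, of 1 0] show ?thesis by (simp add: dist_norm)
  qed
  then show ?thesis using that L0 by blast
qed

lemma P1_bounded:
  assumes "v \<in> P1 \<T>" obtains M where "\<And>x. cmod (v x) \<le> M"
proof -
  have "bounded (v ` closure \<Omega>)"
    using P1_continuous[OF assms] \<Omega>(2) compact_continuous_image compact_imp_bounded compact_closure by blast
  then obtain M where "\<And>x. x \<in> closure \<Omega> \<Longrightarrow> cmod (v x) \<le> M" unfolding bounded_iff by auto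
  then have "cmod (v x) \<le> max 0 M" for x
    using P1_outside[OF assms, of x] by (cases "x \<in> closure \<Omega>") (auto simp: le_max_iff_disj)
  then show ?thesis using that by blast
qed

lemma P1_borel:
  assumes "v \<in> P1 \<T>" shows "v \<in> borel_measurable borel"
proof -
  have "(\<lambda>x. indicat_real (closure \<Omega>) x *\<^sub>R v x) \<in> borel_measurable borel"
    using P1_continuous[OF assms] by (intro borel_measurable_continuous_on_indicator) auto
  moreover have "indicat_real (closure \<Omega>) x *\<^sub>R v x = v x" for x
    using P1_outside[OF assms, of x] by (auto simp: indicator_def)
  ultimately show ?thesis by simp
qed

lemma sq_int_bounded:
  assumes "f \<in> borel_measurable borel" "\<And>x. cmod (f x) \<le> C"
  shows "sq_int lebesgue \<Omega> f"
proof (rule sq_int_finite_bounded)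
  show "\<Omega> \<in> sets lebesgue" "emeasure lebesgue \<Omega> < \<infinity>"
    using \<Omega> lmeasurable_open[of \<Omega>] by (auto simp: fmeasurable_def)
  then show "set_borel_measurable lebesgue \<Omega> f"
    unfolding set_borel_measurable_def
    by (intro borel_measurable_scaleR[OF borel_measurable_indicator] measurable_completion) (use assms in auto)
qed (use assms in auto)

text \<open>
  The elementwise gradient is a weak gradient. Instead of a Green formula on each element, the proof
  uses that translation invariance moves a difference quotient from \<open>\<phi>\<close> to \<open>v\<close>:
  \<open>\<integral> v(x) (\<phi>(x + t e) - \<phi>(x)) / t = \<integral> (v(x - t e) - v(x)) / t \<phi>(x)\<close>. As \<open>t\<close> tends to \<open>0\<close>, the left side
  tends to \<open>\<integral> v \<partial>\<phi>\<close>. On the right side the quotients are bounded on the support of \<open>\<phi>\<close>, and at an interior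
  point of an element they are eventually equal to minus the slope there. Dominated convergence
  applies on both sides.
\<close>

lemma P1_L2_gradient:
  assumes v: "v \<in> P1 \<T>"
  shows "\<exists>g. L2_gradient \<Omega> v g"
proof -
  have "\<exists>b. \<exists>c. \<forall>x\<in>T. v x = c + (\<Sum>i\<in>UNIV. complex_of_real (x $ i) * b $ i)" if T: "T \<in> \<T>" for T
  proof -
    obtain p where p: "affine_field p" "\<forall>x\<in>T. v x = p x" using P1_affine[OF v T] .
    then show ?thesis unfolding affine_field_def by auto
  qed
  then obtain b :: "plane set \<Rightarrow> complex^2" and c
    where bc: "\<And>T x. T \<in> \<T> \<Longrightarrow> x \<in> T \<Longrightarrow> v x = c T + (\<Sum>i\<in>UNIV. complex_of_real (x $ i) * b T $ i)" by metis
  define D where "D x = (\<Sum>T\<in>\<T>. indicat_real (interior T) x *\<^sub>R b T)" for x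
  have D_eq: "D x $ i = (\<Sum>T\<in>\<T>. indicat_real (interior T) x *\<^sub>R b T $ i)" for x i
    by (simp add: D_def)
  have D_int: "D x $ i = b T $ i" if T: "T \<in> \<T>" "x \<in> interior T" for x T i
  proof -
    have "D x $ i = (\<Sum>T'\<in>{T}. indicat_real (interior T') x *\<^sub>R b T' $ i)"
      unfolding D_eq
    proof (rule sum.mono_neutral_right[OF finite_mesh])
      show "\<forall>T'\<in>\<T> - {T}. indicat_real (interior T') x *\<^sub>R b T' $ i = 0"
        using interiors_disjoint[OF T(1) _ T(2)] interior_subset by (fastforce simp: indicator_def)
    qed (use T in auto)
    then show ?thesis using T(2) by simp
  qed
  have D_borel: "(\<lambda>x. D x $ i) \<in> borel_measurable borel" for i
    unfolding D_eq by (intro borel_measurable_sum borel_measurable_scaleR borel_measurable_indicator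
        borel_measurable_const) auto
  have D_bnd: "cmod (D x $ i) \<le> (\<Sum>T\<in>\<T>. cmod (b T $ i))" for x i
    unfolding D_eq by (rule sum_norm_le) (auto simp: indicator_def)
  obtain M where M: "\<And>x. cmod (v x) \<le> M" using P1_bounded[OF v] by blast
  have M0: "0 \<le> M" using M[of 0] norm_ge_zero order_trans by blast
  obtain L where L: "0 \<le> L" "\<And>x y. closed_segment x y \<subseteq> closure \<Omega> \<Longrightarrow> cmod (v y - v x) \<le> L * norm (y - x)"
    using P1_lipschitz[OF v] by blast
  have v_borel: "v \<in> borel_measurable borel" by (rule P1_borel[OF v])
  have "weak_gradient \<Omega> v D"
    unfolding weak_gradient_def
  proof (intro allI impI)
    fix \<phi> i assume \<phi>: "test_function \<Omega> \<phi>"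
    let ?e = "axis i 1 :: plane"
    define S where "S = closure {x. \<phi> x \<noteq> 0}"
    have K: "compact S" "S \<subseteq> \<Omega>" using \<phi> by (auto simp: test_function_def S_def)
    obtain d where d: "0 < d" "(\<Union>x\<in>S. cball x d) \<subseteq> \<Omega>"
      using compact_subset_open_imp_cball_epsilon_subset[OF K(1) \<Omega>(1) K(2)] by blast
    have \<phi>_out: "\<phi> x = 0" if "x \<notin> S" for x using that closure_subset[of "{x. \<phi> x \<noteq> 0}"] unfolding S_def by blast
    obtain C where C: "0 \<le> C" "\<And>x s. \<bar>\<phi> (x + s *\<^sub>R ?e) - \<phi> x\<bar> \<le> C * \<bar>s\<bar>"
      using test_function_lipschitz[OF \<phi>, of i] by blast
    obtain B where B: "\<And>x. \<bar>\<phi> x\<bar> \<le> B" using test_function_facts(3)[OF \<phi>] by blast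
    have B0: "0 \<le> B" using B[of 0] by simp
    have \<phi>c: "continuous_on UNIV \<phi>" by (rule test_function_facts(1)[OF \<phi>])
    have \<phi>_borel: "(\<lambda>x. \<phi> (x + h)) \<in> borel_measurable borel" for h
      by (intro borel_measurable_continuous_onI continuous_on_compose2[OF \<phi>c] continuous_intros) auto
    then have \<phi>_borel': "(\<lambda>x. complex_of_real (\<phi> (x + h))) \<in> borel_measurable borel" for h by simp
    note \<phi>0_borel = \<phi>_borel'[of 0, simplified]
    have v_borel': "(\<lambda>x. v (x + h)) \<in> borel_measurable borel" for h
      using measurable_compose[OF _ v_borel, of "\<lambda>x. x + h" borel] by simp
    have clb: "bounded (closure \<Omega>)" "closure \<Omega> \<in> sets borel" using \<Omega>(2) by auto
    have Kb: "bounded S" "S \<in> sets borel" using K(1) compact_imp_bounded borel_compact by blast+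
    have pd_borel: "(\<lambda>x. complex_of_real (pderiv_at i \<phi> x)) \<in> borel_measurable borel"
      using \<phi> by (intro borel_measurable_continuous_onI continuous_intros) (auto simp: test_function_def)
    have i1: "integrable lborel (\<lambda>x. v x * complex_of_real (\<phi> (x + h)))" for h
    proof (rule integrable_lborel_bounded[OF _ _ clb, where C="M * B"])
      show "(\<lambda>x. v x * complex_of_real (\<phi> (x + h))) \<in> borel_measurable borel"
        using v_borel \<phi>_borel' by (intro borel_measurable_times)
      show "cmod (v x * complex_of_real (\<phi> (x + h))) \<le> M * B" for x
        using M B M0 by (auto simp: norm_mult intro!: mult_mono)
    qed (use P1_outside[OF v] in auto)
    have i2: "integrable lborel (\<lambda>x. v (x - h) * complex_of_real (\<phi> x))" for h
    proof (rule integrable_lborel_bounded[OF _ _ Kb, where C="M * B"])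
      show "(\<lambda>x. v (x - h) * complex_of_real (\<phi> x)) \<in> borel_measurable borel"
        using v_borel'[of "- h"] \<phi>0_borel by (intro borel_measurable_times) auto
      show "cmod (v (x - h) * complex_of_real (\<phi> x)) \<le> M * B" for x
        using M B M0 by (auto simp: norm_mult intro!: mult_mono)
    qed (use \<phi>_out in auto)
    define t where "t n = d / Suc n" for n
    have t: "0 < t n" "t n \<le> d" for n unfolding t_def using d(1) by (auto simp: field_simps)
    have t_lim: "t \<longlonglongrightarrow> 0"
      unfolding t_def using lim_const_over_n[of d, THEN LIMSEQ_Suc] by simp
    let ?A = "\<lambda>n x. v x * complex_of_real ((\<phi> (x + t n *\<^sub>R ?e) - \<phi> x) / t n)"
    let ?B = "\<lambda>n x. ((v (x - t n *\<^sub>R ?e) - v x) / complex_of_real (t n)) * complex_of_real (\<phi> x)"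
    have AB: "(LINT x|lborel. ?A n x) = (LINT x|lborel. ?B n x)" for n
    proof -
      let ?h = "t n *\<^sub>R ?e"
      have "(LINT x|lborel. ?A n x) = (LINT x|lborel. (v x * complex_of_real (\<phi> (x + ?h)) - v x *
          complex_of_real (\<phi> x)) / complex_of_real (t n))"
        by (intro Bochner_Integration.integral_cong) (auto simp: diff_divide_distrib algebra_simps)
      also have "\<dots> = ((LINT x|lborel. v x * complex_of_real (\<phi> (x + ?h))) - (LINT x|lborel. v x *
          complex_of_real (\<phi> x))) / complex_of_real (t n)"
        using Bochner_Integration.integral_diff[OF i1[of ?h] i1[of 0]] by simp
      also have "(LINT x|lborel. v x * complex_of_real (\<phi> (x + ?h)))
          = (LINT x|lborel. v (x - ?h) * complex_of_real (\<phi> x))"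
        using lborel_integral_shift[of "\<lambda>x. v (x - ?h) * complex_of_real (\<phi> x)" ?h] i2[of ?h]
            by (simp add: borel_measurable_integrable)
      also have "(LINT x|lborel. v (x - ?h) * complex_of_real (\<phi> x)) - (LINT x|lborel. v x * complex_of_real (\<phi> x))
          = (LINT x|lborel. v (x - ?h) * complex_of_real (\<phi> x) - v x * complex_of_real (\<phi> x))"
        using Bochner_Integration.integral_diff[OF i2[of ?h] i2[of 0]] by simp
      also have "\<dots> / complex_of_real (t n) = (LINT x|lborel. ?B n x)"
        by (subst integral_divide_zero[symmetric]) (intro Bochner_Integration.integral_cong, auto simp:
            diff_divide_distrib algebra_simps)
      finally show ?thesis .
    qed
    have A_lim: "(\<lambda>n. LINT x|lborel. ?A n x) \<longlonglongrightarrow> (LINT x|lborel. v x * complex_of_real (pderiv_at i \<phi> x))"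
    proof (rule integral_dominated_convergence[where w = "\<lambda>x. M * C * indicat_real (closure \<Omega>) x"])
      show "(\<lambda>x. v x * complex_of_real (pderiv_at i \<phi> x)) \<in> borel_measurable lborel"
        using v_borel pd_borel by (simp add: borel_measurable_times)
      show "?A n \<in> borel_measurable lborel" for n
      proof -
        have "(\<lambda>x. (\<phi> (x + t n *\<^sub>R ?e) - \<phi> x) / t n) \<in> borel_measurable borel"
          using \<phi>_borel[of "t n *\<^sub>R ?e"] \<phi>_borel[of 0] by simp
        from borel_measurable_times[OF v_borel measurable_compose[OF this borel_measurable_of_real]]
        show ?thesis by (simp only: measurable_lborel2)
      qed
      show "integrable lborel (\<lambda>x. M * C * indicat_real (closure \<Omega>) x)"
        using clb emeasure_bounded_finite[OF clb(1)] by (intro integrable_mult_right integrable_real_indicator) auto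
      show "AE x in lborel. norm (?A n x) \<le> M * C * indicat_real (closure \<Omega>) x" for n
      proof (intro AE_I2)
        fix x
        have "\<bar>(\<phi> (x + t n *\<^sub>R ?e) - \<phi> x) / t n\<bar> \<le> C"
          using C(2)[of x "t n"] t(1)[of n] by (simp add: abs_divide divide_le_eq)
        then have "norm (?A n x) \<le> M * C" unfolding norm_mult norm_of_real using M M0 by (intro mult_mono) auto
        then show "norm (?A n x) \<le> M * C * indicat_real (closure \<Omega>) x"
          using P1_outside[OF v, of x] by (cases "x \<in> closure \<Omega>") auto
      qed
      show "AE x in lborel. (\<lambda>n. ?A n x) \<longlonglongrightarrow> v x * complex_of_real (pderiv_at i \<phi> x)"
      proof (intro AE_I2 tendsto_mult tendsto_const tendsto_of_real)
        fix x
        have "((\<lambda>h. (\<phi> (x + h *\<^sub>R ?e) - \<phi> x) / h) \<longlongrightarrow> pderiv_at i \<phi> x) (at 0)"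
          using test_function_has_pderiv[OF \<phi>, of x i 0] by (simp add: DERIV_def)
        moreover have "filterlim t (at 0) sequentially"
          using t_lim t(1) by (intro filterlim_atI) (auto intro!: always_eventually simp:
              less_imp_neq[symmetric] dual_order.strict_implies_not_eq)
        ultimately show "(\<lambda>n. (\<phi> (x + t n *\<^sub>R ?e) - \<phi> x) / t n) \<longlonglongrightarrow> pderiv_at i \<phi> x"
          by (rule filterlim_compose)
      qed
    qed
    have B_lim: "(\<lambda>n. LINT x|lborel. ?B n x) \<longlonglongrightarrow> (LINT x|lborel. - (D x $ i) * complex_of_real (\<phi> x))"
    proof (rule integral_dominated_convergence[where w = "\<lambda>x. L * B * indicat_real S x"])
      show "(\<lambda>x. - (D x $ i) * complex_of_real (\<phi> x)) \<in> borel_measurable lborel"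
        using D_borel \<phi>0_borel by (simp add: borel_measurable_times)
      show "?B n \<in> borel_measurable lborel" for n
        using v_borel'[of "- (t n *\<^sub>R ?e)"] v_borel \<phi>0_borel
            by (simp add: borel_measurable_times borel_measurable_divide borel_measurable_diff)
      show "integrable lborel (\<lambda>x. L * B * indicat_real S x)"
        using Kb emeasure_bounded_finite[OF Kb(1)] by (intro integrable_mult_right integrable_real_indicator) auto
      show "AE x in lborel. norm (?B n x) \<le> L * B * indicat_real S x" for n
      proof (intro AE_I2)
        fix x
        show "norm (?B n x) \<le> L * B * indicat_real S x"
        proof (cases "x \<in> S")
          case True
          have "closed_segment x (x - t n *\<^sub>R ?e) \<subseteq> cball x d"
            using t[of n] d(1) by (intro closed_segment_subset) (auto simp: dist_norm norm_axis_1)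
          then have "closed_segment x (x - t n *\<^sub>R ?e) \<subseteq> closure \<Omega>" using d(2) True closure_subset by fast
          from L(2)[OF this] have "cmod (v (x - t n *\<^sub>R ?e) - v x) \<le> L * t n"
            using t(1)[of n] by (simp add: norm_axis_1)
          then have "cmod ((v (x - t n *\<^sub>R ?e) - v x) / complex_of_real (t n)) \<le> L"
            using t(1)[of n] by (simp add: norm_divide divide_le_eq)
          then show ?thesis unfolding norm_mult norm_of_real using B L(1) True by (auto intro!: mult_mono)
        qed (simp add: \<phi>_out)
      qed
      have "AE x in lborel. x \<in> closure \<Omega> \<longrightarrow> (\<exists>T\<in>\<T>. x \<in> interior T)"
        using AE_interior by (simp add: AE_completion_iff)
      then show "AE x in lborel. (\<lambda>n. ?B n x) \<longlonglongrightarrow> - (D x $ i) * complex_of_real (\<phi> x)"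
      proof eventually_elim
        case (elim x)
        show ?case
        proof (cases "x \<in> S")
          case False then show ?thesis by (simp add: \<phi>_out)
        next
          case True
          then obtain T where T: "T \<in> \<T>" "x \<in> interior T" using elim K(2) closure_subset by blast
          have "(\<lambda>n. x - t n *\<^sub>R ?e) \<longlonglongrightarrow> x - 0 *\<^sub>R ?e" using t_lim by (intro tendsto_intros)
          then have "\<forall>\<^sub>F n in sequentially. x - t n *\<^sub>R ?e \<in> interior T"
            using T(2) topological_tendstoD[OF _ open_interior] by fastforce
          then have "\<forall>\<^sub>F n in sequentially. ?B n x = - (D x $ i) * complex_of_real (\<phi> x)"
          proof eventually_elim
            case (elim n)
            have "v (x - t n *\<^sub>R ?e) - v x = (\<Sum>j\<in>UNIV. complex_of_real ((x - t n *\<^sub>R ?e) $ j) * b T $ j) -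
                (\<Sum>j\<in>UNIV. complex_of_real (x $ j) * b T $ j)"
              using bc[OF T(1) subsetD[OF interior_subset T(2)]] bc[OF T(1) subsetD[OF interior_subset elim]] by simp
            also have "\<dots> = (\<Sum>j\<in>UNIV. - complex_of_real (t n) * (if j = i then b T $ j else 0))"
              unfolding sum_subtractf[symmetric] by (intro sum.cong) (auto simp: axis_def algebra_simps)
            also have "\<dots> = - complex_of_real (t n) * b T $ i"
              by (subst sum_distrib_left[symmetric]) simp
            finally show ?case using t(1)[of n] D_int[OF T] by simp
          qed
          then show ?thesis by (rule tendsto_eventually)
        qed
      qed
    qed
    have eq: "(LINT x|lborel. v x * complex_of_real (pderiv_at i \<phi> x))
        = (LINT x|lborel. - (D x $ i) * complex_of_real (\<phi> x))"
      using LIMSEQ_unique[OF A_lim] B_lim unfolding AB by blast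
    have "(LINT x:\<Omega>|lebesgue. v x * complex_of_real (pderiv_at i \<phi> x))
        = (LINT x|lebesgue. v x * complex_of_real (pderiv_at i \<phi> x))"
      unfolding set_lebesgue_integral_def
    proof (rule integral_cong_AE)
      show m: "(\<lambda>x. v x * complex_of_real (pderiv_at i \<phi> x)) \<in> borel_measurable lebesgue"
        using v_borel pd_borel by (intro measurable_completion) (simp add: borel_measurable_times)
      show "(\<lambda>x. indicat_real \<Omega> x *\<^sub>R (v x * complex_of_real (pderiv_at i \<phi> x))) \<in> borel_measurable lebesgue"
        using \<Omega>(1) by (intro borel_measurable_scaleR[OF borel_measurable_indicator m]) auto
      have "AE x in lebesgue. x \<notin> frontier \<Omega>" using frontier_null AE_not_in negligible_iff_null_sets by blast
      then show "AE x in lebesgue. indicat_real \<Omega> x *\<^sub>R (v x * complex_of_real (pderiv_at i \<phi> x))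
          = v x * complex_of_real (pderiv_at i \<phi> x)"
      proof eventually_elim
        case (elim x)
        then have "x \<in> \<Omega> \<or> x \<notin> closure \<Omega>" using \<Omega>(1) by (auto simp: frontier_def interior_open)
        then show ?case using P1_outside[OF v, of x] by (auto simp: indicator_def)
      qed
    qed
    also have "\<dots> = (LINT x|lborel. v x * complex_of_real (pderiv_at i \<phi> x))"
      using v_borel pd_borel by (intro integral_completion) (simp add: borel_measurable_times)
    also have "\<dots> = - (LINT x|lborel. D x $ i * complex_of_real (\<phi> x))" unfolding eq by simp
    also have "(LINT x|lborel. D x $ i * complex_of_real (\<phi> x)) = (LINT x|lebesgue. D x $ i * complex_of_real (\<phi> x))"
      using D_borel \<phi>0_borel by (intro integral_completion[symmetric]) (simp add: borel_measurable_times)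
    also have "\<dots> = (LINT x:\<Omega>|lebesgue. D x $ i * complex_of_real (\<phi> x))"
      unfolding set_lebesgue_integral_def using test_function_facts(4)[OF \<phi>]
      by (intro Bochner_Integration.integral_cong) (auto simp: indicator_def)
    finally show "(LINT x:\<Omega>|lebesgue. v x * complex_of_real (pderiv_at i \<phi> x))
        = - (LINT x:\<Omega>|lebesgue. D x $ i * complex_of_real (\<phi> x))" .
  qed
  moreover have "L2_on \<Omega> (\<lambda>x. D x $ i)" for i
    unfolding L2_on_sq_int by (rule sq_int_bounded[OF D_borel D_bnd])
  ultimately show ?thesis unfolding L2_gradient_def by blast
qed

lemma P1_sub_H1: "P1 \<T> \<subseteq> H1 \<Omega>"
proof
  fix v assume v: "v \<in> P1 \<T>"
  obtain M where "\<And>x. cmod (v x) \<le> M" using P1_bounded[OF v] by blast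
  then have "L2_on \<Omega> v" unfolding L2_on_sq_int using sq_int_bounded[OF P1_borel[OF v]] by blast
  then show "v \<in> H1 \<Omega>" using P1_L2_gradient[OF v] by (simp add: H1_def)
qed

text \<open>
  Averages over shrinking balls converge because the function is continuous up to the boundary.
\<close>

lemma P1_trace:
  assumes v: "v \<in> P1 \<T>" and x: "x \<in> closure \<Omega>"
  shows "has_trace_at \<Omega> v x (v x)" "boundary_trace \<Omega> v x = v x"
proof -
  show tr: "has_trace_at \<Omega> v x (v x)"
    unfolding has_trace_at_def tendsto_iff
  proof (intro allI impI)
    fix e :: real assume e: "0 < e"
    have "0 < e / 2" using e by simp
    then obtain d where d: "0 < d" "\<And>y. y \<in> closure \<Omega> \<Longrightarrow> dist y x < d \<Longrightarrow> dist (v y) (v x) < e / 2"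
      using P1_continuous[OF v] x unfolding continuous_on_iff by meson
    have "dist (local_average \<Omega> v x r) (v x) < e" if r: "0 < r" "r < d" for r
    proof -
      let ?S = "\<Omega> \<inter> ball x r"
      have S: "open ?S" "bounded ?S" "?S \<noteq> {}"
        using \<Omega> x r(1) open_Int_closure_eq_empty[OF open_ball, of x r \<Omega>] bounded_Int by (auto simp: Int_commute)
      then have Sm: "?S \<in> lmeasurable" by (intro lmeasurable_open)
      let ?m = "measure lebesgue ?S"
      have m: "0 < ?m"
        using S Sm open_not_negligible by (metis measure_nonneg less_le negligible_iff_measure)
      have vi: "set_integrable lebesgue ?S v"
      proof -
        obtain M where M: "\<And>x. cmod (v x) \<le> M" using P1_bounded[OF v] by blast
        have "v \<in> borel_measurable lebesgue" using P1_borel[OF v] by (intro measurable_completion) simp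
        then show ?thesis unfolding set_integrable_def using M Sm 
          by (intro integrableI_bounded_set_indicator[where B=M]) (auto simp: fmeasurable_def)
      qed
      have ci: "set_integrable lebesgue ?S (\<lambda>_. c)" for c :: complex
        using Sm unfolding set_integrable_def
        by (intro integrableI_bounded_set_indicator[where B="cmod c"]) (auto simp: fmeasurable_def)
      have c_val: "(LINT y:?S|lebesgue. c) = complex_of_real ?m * c" for c
        unfolding set_lebesgue_integral_def using Sm by (simp add: fmeasurable_def scaleR_conv_of_real)
      have "local_average \<Omega> v x r - v x = (LINT y:?S|lebesgue. v y - v x) / complex_of_real ?m"
        unfolding local_average_def using set_integral_diff(2)[OF vi ci[of "v x"]] c_val[of "v x"] m
        by (simp add: diff_divide_distrib)
      also have "cmod \<dots> = cmod (LINT y:?S|lebesgue. v y - v x) / ?m" using m by (simp add: norm_divide)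
      also have "cmod (LINT y:?S|lebesgue. v y - v x) \<le> (LINT y:?S|lebesgue. e / 2)"
        unfolding set_lebesgue_integral_def
      proof (rule order_trans[OF integral_norm_bound integral_mono_AE])
        show "integrable lebesgue (\<lambda>y. norm (indicat_real ?S y *\<^sub>R (v y - v x)))"
          using set_integral_diff(1)[OF vi ci[of "v x"]] unfolding set_integrable_def by (rule integrable_norm)
        show "integrable lebesgue (\<lambda>y. indicat_real ?S y *\<^sub>R (e / 2))"
          using Sm by (intro integrableI_bounded_set_indicator[where B="e/2"]) (use e in \<open>auto simp: fmeasurable_def\<close>)
        show "AE y in lebesgue. norm (indicat_real ?S y *\<^sub>R (v y - v x)) \<le> indicat_real ?S y *\<^sub>R (e / 2)"
        proof (intro AE_I2)
          fix y show "norm (indicat_real ?S y *\<^sub>R (v y - v x)) \<le> indicat_real ?S y *\<^sub>R (e / 2)"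
          proof (cases "y \<in> ?S")
            case True
            then have "y \<in> closure \<Omega>" "dist y x < d" using closure_subset r(2) by (auto simp: dist_commute)
            from d(2)[OF this] show ?thesis using True by (simp add: dist_norm)
          qed simp
        qed
      qed
      also have "(LINT y:?S|lebesgue. e / 2) = ?m * (e / 2)"
        unfolding set_lebesgue_integral_def using Sm by (simp add: fmeasurable_def)
      finally have "cmod (local_average \<Omega> v x r - v x) \<le> e / 2" using m by (simp add: divide_right_mono)
      then show ?thesis using e by (simp add: dist_norm)
    qed
    then show "\<forall>\<^sub>F r in at_right 0. dist (local_average \<Omega> v x r) (v x) < e"
      unfolding eventually_at_right_field using d(1) by blast
  qed
  show "boundary_trace \<Omega> v x = v x"
    unfolding boundary_trace_def using tr unfolding has_trace_at_def
    by (intro tendsto_Lim) (auto simp: trivial_limit_at_right_real)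
qed

end

section \<open>Arc length and the inner products of the Helmholtz problem\<close>

lemma sets_arclength: "sets arclength = sets borel" "space arclength = UNIV"
  unfolding arclength_def by (simp_all add: sets.sigma_sets_eq[of borel, simplified])

lemma diameter_closed_segment: "diameter (closed_segment a b) = dist a (b :: 'a::euclidean_space)"
proof (rule antisym)
  show "diameter (closed_segment a b) \<le> dist a b"
  proof (rule diameter_le)
    fix x y assume "x \<in> closed_segment a b" "y \<in> closed_segment a b"
    then obtain s t where st: "0 \<le> s" "s \<le> 1" "x = (1 - s) *\<^sub>R a + s *\<^sub>R b" "0 \<le> t" "t \<le> 1" "y
        = (1 - t) *\<^sub>R a + t *\<^sub>R b"
      unfolding closed_segment_def by blast
    have "x - y = (t - s) *\<^sub>R (a - b)" unfolding st(3,6) by (simp add: algebra_simps)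
    then have "norm (x - y) = \<bar>t - s\<bar> * dist a b" by (simp add: dist_norm)
    also have "\<dots> \<le> 1 * dist a b" using st by (intro mult_right_mono) auto
    finally show "norm (x - y) \<le> dist a b" by simp
  qed simp
  show "dist a b \<le> diameter (closed_segment a b)"
    by (intro diameter_bounded_bound compact_imp_bounded compact_segment) auto
qed

text \<open>
  Cutting every segment into \<open>N\<close> equal pieces gives covers by arbitrarily small sets whose diameters
  add up to the total length.
\<close>

lemma hausdorff1_outer_segments:
  assumes "finite S"
  shows "hausdorff1_outer (\<Union>(a, b)\<in>S. closed_segment a b) < \<infinity>"
proof -
  obtain e :: "nat \<Rightarrow> plane \<times> plane" and m where e: "S = e ` {..<m}"
    using finite_imp_nat_seg_image_inj_on[OF assms] by (metis lessThan_def)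
  define l where "l j = dist (fst (e j)) (snd (e j))" for j
  define A where "A = (\<Union>(a, b)\<in>S. closed_segment a b)"
  have bound: "(INF C\<in>{C :: nat \<Rightarrow> plane set. A \<subseteq> (\<Union>n. C n) \<and> (\<forall>n. bounded (C n) \<and> diameter (C n) \<le> \<delta>)}.
        \<Sum>n. ennreal (diameter (C n))) \<le> ennreal (\<Sum>j<m. l j)" if \<delta>: "0 < \<delta>" for \<delta>
  proof -
    obtain N :: nat where N: "0 < N" "\<And>j. j < m \<Longrightarrow> l j / real N \<le> \<delta>"
    proof -
      obtain N :: nat where N: "(\<Sum>j<m. l j) / \<delta> < real N" using reals_Archimedean2 by blast
      have "0 \<le> (\<Sum>j<m. l j) / \<delta>" using \<delta> by (intro divide_nonneg_pos sum_nonneg) (auto simp: l_def)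
      then have N0: "0 < N" using N by linarith
      have "l j / real N \<le> \<delta>" if j: "j < m" for j
      proof -
        have "l j \<le> (\<Sum>j<m. l j)" using j by (intro member_le_sum) (auto simp: l_def)
        then have "l j \<le> \<delta> * real N" using N \<delta> by (simp add: field_simps)
        then show ?thesis using N0 by (simp add: field_simps)
      qed
      then show ?thesis using that N0 by blast
    qed
    \<comment> \<open>\<open>C n\<close> is piece number \<open>n mod N\<close> of segment number \<open>n div N\<close>\<close>
    define pt where "pt j k = fst (e j) + (real k / real N) *\<^sub>R (snd (e j) - fst (e j))" for j k
    define C where "C n = (if n < m * N then closed_segment (pt (n div N) (n mod N)) (pt (n div N) (Suc (n mod
        N))) else {})" for n
    have len: "dist (pt j k) (pt j (Suc k)) = l j / real N" for j k
    proof -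
      have "pt j k - pt j (Suc k) = (real k / real N - real (Suc k) / real N) *\<^sub>R (snd (e j) - fst (e j))"
        unfolding pt_def by (simp add: scaleR_left_diff_distrib)
      also have "real k / real N - real (Suc k) / real N = - (1 / real N)"
        by (simp add: diff_divide_distrib[symmetric])
      finally show ?thesis by (simp add: dist_norm l_def norm_minus_commute)
    qed
    have diam: "diameter (C n) = (if n < m * N then l (n div N) / real N else 0)" for n
      unfolding C_def using len by (simp add: diameter_closed_segment)
    have "A \<subseteq> (\<Union>n. C n)"
    proof
      fix x assume "x \<in> A"
      then obtain j where j: "j < m" "x \<in> closed_segment (fst (e j)) (snd (e j))"
        unfolding A_def e by (auto simp: split_beta)
      then obtain u where u: "0 \<le> u" "u \<le> 1" "x = fst (e j) + u *\<^sub>R (snd (e j) - fst (e j))"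
        unfolding closed_segment_def by (auto simp: algebra_simps)
      define k where "k = min (N - 1) (nat \<lfloor>u * real N\<rfloor>)"
      have kN: "k < N" using N(1) by (auto simp: k_def)
      have lo: "real k \<le> u * real N"
      proof -
        have "real (nat \<lfloor>u * real N\<rfloor>) \<le> u * real N" using u(1) by simp
        then show ?thesis unfolding k_def by linarith
      qed
      have hi: "u * real N \<le> real (Suc k)"
      proof (cases "nat \<lfloor>u * real N\<rfloor> \<le> N - 1")
        case True
        then have "k = nat \<lfloor>u * real N\<rfloor>" by (simp add: k_def)
        then show ?thesis using u(1) by (simp add: of_nat_nat) linarith
      next
        case False
        then have "Suc k = N" using N(1) by (auto simp: k_def)
        then show ?thesis using u(2) N(1) by (simp add: mult_left_le_one_le)
      qed
      define n where "n = j * N + k"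
      have nd: "n div N = j" "n mod N = k" using kN by (auto simp: n_def)
      have nm: "n < m * N"
      proof -
        have "n < j * N + N" using kN by (simp add: n_def)
        also have "\<dots> = Suc j * N" by simp
        also have "\<dots> \<le> m * N" using j(1) by (intro mult_le_mono1) simp
        finally show ?thesis .
      qed
      define s where "s = u * real N - real k"
      have s: "0 \<le> s" "s \<le> 1" using lo hi by (auto simp: s_def)
      have "x = (1 - s) *\<^sub>R pt j k + s *\<^sub>R pt j (Suc k)"
      proof -
        have "(1 - s) *\<^sub>R pt j k + s *\<^sub>R pt j (Suc k)
            = fst (e j) + ((1 - s) * (real k / real N) + s * (real (Suc k) / real N)) *\<^sub>R (snd (e j) - fst (e j))"
          unfolding pt_def by (simp add: algebra_simps)
        also have "(1 - s) * (real k / real N) + s * (real (Suc k) / real N) = (real k + s) / real N"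
          by (simp add: add_divide_distrib[symmetric] algebra_simps)
        also have "\<dots> = u" using N(1) by (simp add: s_def)
        finally show ?thesis using u(3) by simp
      qed
      then have "x \<in> C n" unfolding C_def closed_segment_def using nd nm s by auto
      then show "x \<in> (\<Union>n. C n)" by blast
    qed
    moreover have "bounded (C n) \<and> diameter (C n) \<le> \<delta>" for n
    proof
      show "bounded (C n)" by (simp add: C_def compact_imp_bounded)
      show "diameter (C n) \<le> \<delta>"
        unfolding diam using N(2)[of "n div N"] \<delta> by (auto simp: less_mult_imp_div_less)
    qed
    ultimately have "(INF C\<in>{C :: nat \<Rightarrow> plane set. A \<subseteq> (\<Union>n. C n) \<and> (\<forall>n. bounded (C n) \<and> diameter (C n) \<le> \<delta>)}.
        \<Sum>n. ennreal (diameter (C n))) \<le> (\<Sum>n. ennreal (diameter (C n)))"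
      by (intro INF_lower) auto
    also have "(\<Sum>n. ennreal (diameter (C n))) = (\<Sum>n<m * N. ennreal (diameter (C n)))"
      by (intro suminf_finite) (auto simp: diam)
    also have "\<dots> = ennreal (\<Sum>n<m * N. diameter (C n))"
      by (intro sum_ennreal) (auto simp: diam l_def)
    also have "(\<Sum>n<m * N. diameter (C n)) = (\<Sum>n<m * N. l (n div N) / real N)"
      by (intro sum.cong) (auto simp: diam)
    also have "\<dots> = (\<Sum>j<m. \<Sum>k<N. l j / real N)"
    proof -
      have "(\<Sum>n<m * N. l (n div N) / real N) = (\<Sum>j<m. \<Sum>n=j * N..<j * N + N. l (n div N) / real N)"
        by (rule sum.nat_group[symmetric])
      also have "\<dots> = (\<Sum>j<m. \<Sum>k<N. l j / real N)"
      proof (rule sum.cong[OF refl])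
        fix j
        have "(\<Sum>n=j * N..<j * N + N. l (n div N) / real N) = (\<Sum>n=j * N..<j * N + N. l j / real N)"
        proof (rule sum.cong[OF refl])
          fix n assume "n \<in> {j * N..<j * N + N}"
          then have "n div N = j" by (intro div_nat_eqI) (auto simp: algebra_simps)
          then show "l (n div N) / real N = l j / real N" by simp
        qed
        then show "(\<Sum>n=j * N..<j * N + N. l (n div N) / real N) = (\<Sum>k<N. l j / real N)" by simp
      qed
      finally show ?thesis .
    qed
    also have "\<dots> = (\<Sum>j<m. l j)" using N(1) by simp
    finally show ?thesis .
  qed
  have "hausdorff1_outer A \<le> ennreal (\<Sum>j<m. l j)"
    unfolding hausdorff1_outer_def by (rule SUP_least) (use bound in auto)
  also have "\<dots> < \<infinity>" by simp
  finally show ?thesis unfolding A_def .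
qed

lemma set_borel_measurable_continuous_arclength:
  assumes "closed A" "continuous_on A f" "G \<in> sets borel" "G \<subseteq> A"
  shows "set_borel_measurable arclength G (f :: plane \<Rightarrow> complex)"
proof -
  have "(\<lambda>x. indicat_real A x *\<^sub>R f x) \<in> borel_measurable borel"
    using assms by (intro borel_measurable_continuous_on_indicator) auto
  from borel_measurable_scaleR[OF borel_measurable_indicator[OF assms(3)] this]
  have "(\<lambda>x. indicat_real G x *\<^sub>R (indicat_real A x *\<^sub>R f x)) \<in> borel_measurable borel" .
  moreover have "(\<lambda>x. indicat_real G x *\<^sub>R (indicat_real A x *\<^sub>R f x)) = (\<lambda>x. indicat_real G x *\<^sub>R f x)"
    by (rule ext) (use assms(4) in \<open>auto simp: indicator_def\<close>)
  ultimately show ?thesis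
    unfolding set_borel_measurable_def using measurable_cong_sets[OF sets_arclength(1) refl] by metis
qed

lemma Re_integral_square:
  shows "Re (LINT x:S|M. f x * cnj (f x)) = (LINT x:S|M. (cmod (f x))\<^sup>2)"
proof -
  have "(\<lambda>x. indicat_real S x *\<^sub>R (f x * cnj (f x))) = (\<lambda>x. complex_of_real (indicat_real S x *\<^sub>R (cmod (f x))\<^sup>2))"
    by (simp add: complex_norm_square[symmetric] scaleR_conv_of_real)
  then show ?thesis unfolding set_lebesgue_integral_def by (simp only: integral_complex_of_real Re_complex_of_real)
qed

lemma psd_on_cong:
  assumes X: "fun_subspace X" and A: "psd_on X A" and eq: "\<And>u v. u \<in> X \<Longrightarrow> v \<in> X \<Longrightarrow> B u v = A u v"
  shows "psd_on X B"
proof (rule psd_onI)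
  show "sesq_on X B"
    unfolding sesq_on_def
  proof (intro conjI ballI allI)
    fix u v w assume *: "u \<in> X" "v \<in> X" "w \<in> X"
    note uv = fun_subspaceD(2)[OF X *(1,2)]
    show "B (\<lambda>x. u x + v x) w = B u w + B v w" "B w (\<lambda>x. u x + v x) = B w u + B w v"
      unfolding eq[OF uv *(3)] eq[OF *(3) uv] eq[OF *(1,3)] eq[OF *(2,3)] eq[OF *(3,1)] eq[OF *(3,2)]
      by (rule sesq_onD(1,2)[OF psd_onD(1)[OF A] *(1,3,2)])+
  next
    fix c u w assume *: "u \<in> X" "w \<in> X"
    note cu = fun_subspaceD(3)[OF X *(1), of c]
    show "B (\<lambda>x. c * u x) w = c * B u w" "B w (\<lambda>x. c * u x) = cnj c * B w u"
      unfolding eq[OF cu *(2)] eq[OF *(2) cu] eq[OF *] eq[OF *(2,1)]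
      by (rule sesq_onD(3,4)[OF psd_onD(1)[OF A] *])+
  qed
  show "B v u = cnj (B u v)" if "u \<in> X" "v \<in> X" for u v
    unfolding eq[OF that] eq[OF that(2,1)] by (rule psd_onD(2)[OF A that])
  show "0 \<le> Re (B u u)" if "u \<in> X" for u
    unfolding eq[OF that that] by (rule psd_onD(3)[OF A that])
qed

locale helmholtz_problem =
  fixes P :: helmholtz
  assumes setting: "helmholtz_setting P" and wavenumber_pos: "0 < wavenumber P"
begin

abbreviation "\<Omega> \<equiv> Omega P"

lemma domain: "open \<Omega>" "bounded \<Omega>" "\<Omega> \<noteq> {}"
  using setting by (auto simp: helmholtz_setting_def lipschitz_domain_def)

lemma frontier_segments:
  obtains S :: "(plane \<times> plane) set" where "finite S" "frontier \<Omega> = (\<Union>(a, b)\<in>S. closed_segment a b)"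
  using setting unfolding helmholtz_setting_def polygonal_def by blast

lemma frontier_negligible: "negligible (frontier \<Omega>)"
proof -
  obtain S :: "(plane \<times> plane) set" where S: "finite S" "frontier \<Omega> = (\<Union>(a, b)\<in>S. closed_segment a b)"
    by (rule frontier_segments)
  have "negligible (closed_segment a b)" for a b :: plane
    using negligible_convex_interior[of "closed_segment a b"] interior_closed_segment_ge2[of a b] by simp
  then show ?thesis unfolding S(2) using S(1) by (intro negligible_Union) auto
qed

sublocale H: mesh "Omega P" "TH P"
  by unfold_locales (use domain frontier_negligible setting in \<open>auto simp: helmholtz_setting_def\<close>)

sublocale h: mesh "Omega P" "Th P"
  by unfold_locales (use domain frontier_negligible setting in \<open>auto simp: helmholtz_setting_def\<close>)

lemma Gamma_sub:
  assumes "G \<in> {Gamma_D P, Gamma_N P, Gamma_R P}"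
  shows "G \<subseteq> frontier \<Omega>" "G \<subseteq> closure \<Omega>" "closure G \<subseteq> closure \<Omega>" "G \<in> sets borel"
proof -
  have o: "openin (top_of_set (frontier \<Omega>)) G"
    using assms setting by (auto simp: helmholtz_setting_def boundary_partition_def)
  then show 1: "G \<subseteq> frontier \<Omega>" by (rule openin_imp_subset)
  then show 2: "G \<subseteq> closure \<Omega>" by (auto simp: frontier_def)
  then show "closure G \<subseteq> closure \<Omega>" by (simp add: closure_minimal)
  obtain U where "open U" "G = frontier \<Omega> \<inter> U" using o by (auto simp: openin_open)
  then show "G \<in> sets borel" by auto
qed

lemma P1_coarse_fine: "P1 (TH P) \<subseteq> P1 (Th P)"
proof
  fix v assume v: "v \<in> P1 (TH P)"
  show "v \<in> P1 (Th P)"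
  proof (rule h.P1_I)
    show "v x = 0" if "x \<notin> closure \<Omega>" for x using H.P1_outside[OF v that] .
    fix T assume "T \<in> Th P"
    then obtain K where K: "K \<in> TH P" "T \<subseteq> K"
      using setting unfolding helmholtz_setting_def refines_def by blast
    obtain p where "affine_field p" "\<forall>x\<in>K. v x = p x" using H.P1_affine[OF v K(1)] .
    then show "\<exists>p. affine_field p \<and> (\<forall>x\<in>T. v x = p x)" using K(2) by blast
  qed
qed

lemma fe_coarse_fine: "V_H P \<subseteq> V_h P"
  using P1_coarse_fine by (auto simp: fe_space_def)

lemma fe_fine_P1: "V_h P \<subseteq> P1 (Th P)"
  by (auto simp: fe_space_def)

lemma fe_fine_subspace: "fun_subspace (V_h P)"
  using h.P1_subspace by (auto simp: fe_space_def fun_subspace_def)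

lemma fe_coarse_subspace: "fun_subspace (V_H P)"
  using H.P1_subspace by (auto simp: fe_space_def fun_subspace_def)

lemma fe_cnj: "v \<in> V_h P \<Longrightarrow> (\<lambda>x. cnj (v x)) \<in> V_h P" "v \<in> V_H P \<Longrightarrow> (\<lambda>x. cnj (v x)) \<in> V_H P"
  using h.P1_cnj H.P1_cnj by (auto simp: fe_space_def)

lemma fe_fine_sub_V: "V_h P \<subseteq> V P"
proof
  fix v assume v: "v \<in> V_h P"
  then have p: "v \<in> P1 (Th P)" using fe_fine_P1 by blast
  have "has_trace_at \<Omega> v x 0" if x: "x \<in> Gamma_D P" for x
  proof -
    have "x \<in> closure \<Omega>" using Gamma_sub(2) x by blast
    then have "has_trace_at \<Omega> v x (v x)" by (rule h.P1_trace(1)[OF p])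
    moreover have "v x = 0" using v x by (simp add: fe_space_def)
    ultimately show ?thesis by simp
  qed
  then show "v \<in> V P" using p h.P1_sub_H1 by (auto simp: V_def)
qed

lemma fe_fine_H1: "V_h P \<subseteq> H1 \<Omega>"
  using fe_fine_P1 h.P1_sub_H1 by blast

lemma H1_subsp: "fun_subspace (H1 \<Omega>)"
  by (rule H1_subspace[OF domain(1,2)])

lemma AE_not_outside:
  assumes "negligible (S - \<Omega>)" "AE x in lebesgue. x \<in> \<Omega> \<longrightarrow> Q x"
  shows "AE x in lebesgue. x \<in> S \<longrightarrow> Q x"
proof -
  have "AE x in lebesgue. x \<notin> S - \<Omega>" using assms(1) AE_not_in negligible_iff_null_sets by blast
  then show ?thesis using assms(2) by eventually_elim blast
qed

context
  fixes S assumes S: "S \<in> sets lebesgue" "negligible (S - \<Omega>)"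
begin

lemma sq_int_S: "sq_int lebesgue \<Omega> f \<Longrightarrow> sq_int lebesgue S f"
  by (rule sq_int_lebesgue_mono[OF _ S])

lemma L2_ip_psd: "psd_on (H1 \<Omega>) (L2_ip S)"
  unfolding L2_ip_def[abs_def]
  by (rule psd_on_integral[OF H1_subsp]) (auto intro: sq_int_S H1_sq_int)

lemma grad_ip_sum:
  assumes "v \<in> H1 \<Omega>" "w \<in> H1 \<Omega>"
  shows "grad_ip P S v w = (\<Sum>i\<in>UNIV. LINT x:S|lebesgue. grad \<Omega> v x $ i * cnj (grad \<Omega> w x $ i))"
proof -
  have int: "set_integrable lebesgue S (\<lambda>x. grad \<Omega> v x $ i * cnj (grad \<Omega> w x $ i))" for i
    using assms by (intro sq_int_mult sq_int_S grad_sq_int)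
  show ?thesis
    unfolding grad_ip_def set_lebesgue_integral_def scaleR_sum_right
    using int unfolding set_integrable_def by (intro Bochner_Integration.integral_sum) auto
qed

lemma grad_ip_psd: "psd_on (H1 \<Omega>) (grad_ip P S)"
proof -
  have "psd_on (H1 \<Omega>) (\<lambda>v w. \<Sum>i\<in>UNIV. LINT x:S|lebesgue. grad \<Omega> v x $ i * cnj (grad \<Omega> w x $ i))"
  proof (rule psd_on_sum)
    fix i :: 2
    show "psd_on (H1 \<Omega>) (\<lambda>v w. LINT x:S|lebesgue. grad \<Omega> v x $ i * cnj (grad \<Omega> w x $ i))"
    proof (rule psd_on_integral[OF H1_subsp])
      show "sq_int lebesgue S (\<lambda>x. grad \<Omega> u x $ i)" if "u \<in> H1 \<Omega>" for u
        by (rule sq_int_S[OF grad_sq_int[OF that]])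
    qed (intro AE_not_outside[OF S(2)] grad_linear domain; assumption)+
  qed simp
  then show ?thesis by (rule psd_on_cong[OF H1_subsp _ grad_ip_sum])
qed

lemma ip_cnj:
  assumes "v \<in> H1 \<Omega>" "w \<in> H1 \<Omega>"
  shows "L2_ip S (\<lambda>x. cnj (w x)) (\<lambda>x. cnj (v x)) = L2_ip S v w"
    "grad_ip P S (\<lambda>x. cnj (w x)) (\<lambda>x. cnj (v x)) = grad_ip P S v w"
proof -
  show "L2_ip S (\<lambda>x. cnj (w x)) (\<lambda>x. cnj (v x)) = L2_ip S v w" by (simp add: L2_ip_def mult.commute)
  have "(LINT x:S|lebesgue. grad \<Omega> (\<lambda>x. cnj (w x)) x $ i * cnj (grad \<Omega> (\<lambda>x. cnj (v x)) x $ i))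
    = (LINT x:S|lebesgue. grad \<Omega> v x $ i * cnj (grad \<Omega> w x $ i))" for i
  proof (rule set_lint_cong_AE)
    show "AE x in lebesgue. x \<in> S \<longrightarrow> grad \<Omega> (\<lambda>x. cnj (w x)) x $ i * cnj (grad \<Omega> (\<lambda>x. cnj (v x)) x $ i)
        = grad \<Omega> v x $ i * cnj (grad \<Omega> w x $ i)"
      using AE_not_outside[OF S(2) grad_linear(3)[OF domain(1,2) assms(1), where i=i]]
        AE_not_outside[OF S(2) grad_linear(3)[OF domain(1,2) assms(2), where i=i]]
      by eventually_elim simp
  qed (intro sq_int_mult sq_int_S grad_sq_int H1_cnj assms)+
  then show "grad_ip P S (\<lambda>x. cnj (w x)) (\<lambda>x. cnj (v x)) = grad_ip P S v w"
    using grad_ip_sum assms H1_cnj by simp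
qed

end

context
  fixes G assumes G: "G \<in> sets borel" "G \<subseteq> frontier \<Omega>"
begin

text \<open>
  A bounded function on a boundary of finite length.
\<close>

lemma trace_sq_int: 
  assumes v: "v \<in> P1 (Th P)" shows "sq_int arclength G v"
proof -
  obtain S :: "(plane \<times> plane) set" where "finite S" "frontier \<Omega> = (\<Union>(a, b)\<in>S. closed_segment a b)"
    by (rule frontier_segments)
  then have h: "hausdorff1_outer (frontier \<Omega>) < \<infinity>" using hausdorff1_outer_segments by simp
  have "emeasure arclength G \<le> emeasure arclength (frontier \<Omega>)"
    using G(2) by (intro emeasure_mono) (auto simp: sets_arclength)
  also have "\<dots> \<le> hausdorff1_outer (frontier \<Omega>)"
    \<comment> \<open>the measure generated by a set function either extends that function or vanishes\<close>
    unfolding arclength_def by (simp add: emeasure_measure_of_conv)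
  finally have fin: "emeasure arclength G < \<infinity>" using h by (rule le_less_trans)
  obtain M where M: "\<And>x. cmod (v x) \<le> M" using h.P1_bounded[OF v] by blast
  show ?thesis
  proof (rule sq_int_finite_bounded[OF _ _ fin])
    show "set_borel_measurable arclength G v"
      using set_borel_measurable_continuous_arclength[OF _ h.P1_continuous[OF v] G(1)] G(2)
      by (auto simp: frontier_def)
    show "G \<in> sets arclength" using G(1) by (simp add: sets_arclength)
  qed (rule M)
qed

text \<open>
  For finite element functions the trace is the pointwise value, which removes the limit from the
  boundary inner product and makes it sesquilinear.
\<close>

lemma boundary_ip_eq:
  assumes "v \<in> P1 (Th P)" "w \<in> P1 (Th P)"
  shows "boundary_ip P G v w = (LINT x:G|arclength. v x * cnj (w x))"
  unfolding boundary_ip_def set_lebesgue_integral_def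
proof (rule Bochner_Integration.integral_cong[OF refl])
  fix x
  have "x \<in> closure \<Omega>" if "x \<in> G" using that G(2) by (auto simp: frontier_def)
  then show "indicat_real G x *\<^sub>R (boundary_trace \<Omega> v x * cnj (boundary_trace \<Omega> w x))
      = indicat_real G x *\<^sub>R (v x * cnj (w x))"
    using h.P1_trace(2)[OF assms(1), of x] h.P1_trace(2)[OF assms(2), of x] by (cases "x \<in> G") auto
qed

lemma boundary_ip_psd: "psd_on (P1 (Th P)) (boundary_ip P G)"
proof -
  have "psd_on (P1 (Th P)) (\<lambda>v w. LINT x:G|arclength. v x * cnj (w x))"
    by (rule psd_on_integral[OF h.P1_subspace]) (auto intro: trace_sq_int)
  then show ?thesis by (rule psd_on_cong[OF h.P1_subspace _ boundary_ip_eq])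
qed

lemma boundary_ip_cnj:
  assumes "v \<in> P1 (Th P)" "w \<in> P1 (Th P)"
  shows "boundary_ip P G (\<lambda>x. cnj (w x)) (\<lambda>x. cnj (v x)) = boundary_ip P G v w"
  using boundary_ip_eq assms h.P1_cnj by (simp add: mult.commute)

end

lemma boundary_ip_mono:
  assumes G: "G \<in> sets borel" "G \<subseteq> frontier \<Omega>" and A: "A \<in> sets borel" "A \<subseteq> G" and v: "v \<in> P1 (Th P)"
  shows "Re (boundary_ip P A v v) \<le> Re (boundary_ip P G v v)"
proof -
  have A': "A \<subseteq> frontier \<Omega>" using A G by blast
  have "(LINT x:A|arclength. (cmod (v x))\<^sup>2) \<le> (LINT x:G|arclength. (cmod (v x))\<^sup>2)"
    unfolding set_lebesgue_integral_def
  proof (rule integral_mono_AE)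
    show "integrable arclength (\<lambda>x. indicat_real A x *\<^sub>R (cmod (v x))\<^sup>2)"
        "integrable arclength (\<lambda>x. indicat_real G x *\<^sub>R (cmod (v x))\<^sup>2)"
      using trace_sq_int[OF A(1) A' v] trace_sq_int[OF G v] by (auto simp: sq_int_def set_integrable_def)
    show "AE x in arclength. indicat_real A x *\<^sub>R (cmod (v x))\<^sup>2 \<le> indicat_real G x *\<^sub>R (cmod (v x))\<^sup>2"
      using A(2) by (intro AE_I2) (auto simp: indicator_def)
  qed
  then show ?thesis
    using boundary_ip_eq[OF A(1) A' v v] boundary_ip_eq[OF G v v] by (simp add: Re_integral_square)
qed

end

section \<open>Quasi-interpolation\<close>

lemma fun_subspace_sq_int: "fun_subspace {f. sq_int M S f}"
proof -
  have "sq_int M S (\<lambda>_. 0)" by (simp add: sq_int_def set_borel_measurable_def set_integrable_def)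
  then show ?thesis unfolding fun_subspace_def by (auto intro: sq_int_add sq_int_scale)
qed

lemma L2_ip_psd_sq_int: "psd_on {f. sq_int lebesgue S f} (L2_ip S)"
  unfolding L2_ip_def[abs_def]
  by (rule psd_on_integral[OF fun_subspace_sq_int]) auto

lemma L2_ip_zero_AE:
  assumes f: "sq_int lebesgue S f" and z: "L2_ip S f f = 0"
  shows "AE x in lebesgue. x \<in> S \<longrightarrow> f x = 0"
proof -
  have i: "integrable lebesgue (\<lambda>x. indicat_real S x *\<^sub>R (cmod (f x))\<^sup>2)"
    using f by (simp add: sq_int_def set_integrable_def)
  have "(LINT x:S|lebesgue. (cmod (f x))\<^sup>2) = 0"
    using z Re_integral_square[where S=S and M=lebesgue and f=f] by (simp add: L2_ip_def)
  then have "AE x in lebesgue. indicat_real S x *\<^sub>R (cmod (f x))\<^sup>2 = 0"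
    using integral_nonneg_eq_0_iff_AE[OF i] by (simp add: set_lebesgue_integral_def)
  then show ?thesis by eventually_elim (auto simp: indicator_def)
qed

lemma continuous_AE_zero_on_open:
  fixes f :: "plane \<Rightarrow> complex"
  assumes U: "open U" and f: "continuous_on U f" and z: "AE x in lebesgue. x \<in> U \<longrightarrow> f x = 0" and x: "x \<in> U"
  shows "f x = 0"
proof (rule ccontr)
  assume nz: "f x \<noteq> 0"
  have eq: "{x \<in> U. f x \<noteq> 0} = U \<inter> f -` (- {0})" by auto
  have o: "open {x \<in> U. f x \<noteq> 0}"
    unfolding eq by (rule continuous_open_preimage[OF f U]) auto
  have "{x \<in> U. f x \<noteq> 0} \<in> null_sets lebesgue"
  proof (subst AE_iff_null_sets)
    show "{x \<in> U. f x \<noteq> 0} \<in> sets lebesgue" using o by simp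
    show "AE x in lebesgue. x \<notin> {x \<in> U. f x \<noteq> 0}" using z by eventually_elim auto
  qed
  then have "negligible {x \<in> U. f x \<noteq> 0}" by (simp add: negligible_iff_null_sets)
  then show False using open_not_negligible[OF o] nz x by blast
qed

lemma affine_sq_int:
  assumes "affine_field p" "2 simplex T"
  shows "sq_int lebesgue T p"
proof -
  note T = triangle_facts[OF assms(2)]
  have c: "continuous_on A p" for A by (rule affine_field_continuous[OF assms(1)])
  have "bounded (p ` T)" using c T(7) compact_continuous_image compact_imp_bounded by blast
  then obtain C where C: "\<And>x. x \<in> T \<Longrightarrow> cmod (p x) \<le> C" unfolding bounded_iff by auto
  have Tm: "T \<in> lmeasurable" using T(7) by (rule lmeasurable_compact)
  show ?thesis
  proof (rule sq_int_finite_bounded[OF _ _ _ C])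
    have "p \<in> borel_measurable lebesgue"
      using c by (intro measurable_completion) (simp add: borel_measurable_continuous_onI)
    then show "set_borel_measurable lebesgue T p"
      unfolding set_borel_measurable_def using Tm by (intro borel_measurable_scaleR[OF borel_measurable_indicator]) auto
  qed (use Tm in \<open>auto simp: fmeasurable_def\<close>)
qed

text \<open>
  An affine function that vanishes on the interior of a triangle vanishes on its affine hull, the
  plane.
\<close>

lemma affine_L2_definite:
  assumes T: "2 simplex T" and p: "affine_field p" and z: "L2_ip T p p = 0"
  shows "p = (\<lambda>_. 0)"
proof -
  have "AE x in lebesgue. x \<in> interior T \<longrightarrow> p x = 0"
    using L2_ip_zero_AE[OF affine_sq_int[OF p T] z] by eventually_elim (use interior_subset in blast)
  then have zero: "p x = 0" if "x \<in> interior T" for x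
    using continuous_AE_zero_on_open[OF open_interior affine_field_continuous[OF p]] that by blast
  have "affine hull (interior T) = UNIV"
    using triangle_facts(6)[OF T] by (intro affine_hull_nonempty_interior) simp
  then show ?thesis using affine_field_zero_hull[OF p zero] by auto
qed

text \<open>
  Affine functions are separated by the corners of \<open>T\<close>, so \<open>form_representation\<close> yields the elementwise
  projection together with its characterisation.
\<close>

lemma dg_projection:
  assumes T: "2 simplex T" and v: "sq_int lebesgue T v"
  shows "affine_field (dg_projection T v)"
    "affine_field q \<Longrightarrow> L2_ip T (dg_projection T v) q = L2_ip T v q"
    "affine_field p \<Longrightarrow> (\<And>q. affine_field q \<Longrightarrow> L2_ip T p q = L2_ip T v q) \<Longrightarrow> dg_projection T v = p"
proof -
  let ?X = "{f. sq_int lebesgue T f}"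
  have s: "sesq_on ?X (L2_ip T)" using L2_ip_psd_sq_int psd_onD(1) by blast
  have sub: "Collect affine_field \<subseteq> ?X" using affine_sq_int[OF _ T] by blast
  have ex: "\<exists>!p. p \<in> Collect affine_field \<and> (\<forall>q\<in>Collect affine_field. L2_ip T p q = L2_ip T v q)"
  proof (rule form_representation[OF triangle_facts(1)[OF T] affine_field_subspace])
    show "p = (\<lambda>_. 0)" if "p \<in> Collect affine_field" "\<forall>z\<in>corners T. p z = 0" for p
      using triangle_unisolvent[OF T, of p] that by blast
    show "sesq_on (Collect affine_field) (L2_ip T)" by (rule sesq_on_subset[OF s sub])
    show "p = (\<lambda>_. 0)" if "p \<in> Collect affine_field" "L2_ip T p p = 0" for p
      using affine_L2_definite[OF T, of p] that by blast
    show "antilinear_on (Collect affine_field) (L2_ip T v)"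
      using antilinear_on_subset[OF sesq_on_antilinear[OF s] sub] v by simp
  qed
  have iff: "L2_ip T (\<lambda>x. v x - p x) q = 0 \<longleftrightarrow> L2_ip T p q = L2_ip T v q" if "affine_field p" "affine_field q" for p q
    using sesq_on_diff(1)[OF fun_subspace_sq_int s, of v p q] v that affine_sq_int[OF _ T] by auto
  have iff': "(affine_field p \<and> (\<forall>q. affine_field q \<longrightarrow> L2_ip T (\<lambda>x. v x - p x) q = 0)) \<longleftrightarrow>
      (p \<in> Collect affine_field \<and> (\<forall>q\<in>Collect affine_field. L2_ip T p q = L2_ip T v q))" for p
    using iff by auto
  have eq: "dg_projection T v = (THE p. p \<in> Collect affine_field \<and> (\<forall>q\<in>Collect affine_field. L2_ip T p q
      = L2_ip T v q))"
    unfolding dg_projection_def iff' ..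
  have sat: "dg_projection T v \<in> Collect affine_field \<and> (\<forall>q\<in>Collect affine_field. L2_ip T (dg_projection T v) q
      = L2_ip T v q)"
    unfolding eq by (rule theI'[OF ex])
  then show "affine_field (dg_projection T v)" by blast
  show "L2_ip T (dg_projection T v) q = L2_ip T v q" if "affine_field q" using sat that by blast
  show "dg_projection T v = p" if "affine_field p" "\<And>q. affine_field q \<Longrightarrow> L2_ip T p q = L2_ip T v q"
  proof -
    have "p \<in> Collect affine_field \<and> (\<forall>q\<in>Collect affine_field. L2_ip T p q = L2_ip T v q)" using that by simp
    then show ?thesis using ex sat by blast
  qed
qed

lemma dg_projection_linear:
  assumes T: "2 simplex T" and v: "sq_int lebesgue T v"
  shows "sq_int lebesgue T w \<Longrightarrow> dg_projection T (\<lambda>x. v x + w x) = (\<lambda>x. dg_projection T v x + dg_projection T w x)"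
    "dg_projection T (\<lambda>x. c * v x) = (\<lambda>x. c * dg_projection T v x)"
    "dg_projection T (\<lambda>x. cnj (v x)) = (\<lambda>x. cnj (dg_projection T v x))"
    "affine_field p \<Longrightarrow> (\<And>x. x \<in> T \<Longrightarrow> v x = p x) \<Longrightarrow> dg_projection T v = p"
proof -
  let ?X = "{f. sq_int lebesgue T f}"
  have s: "sesq_on ?X (L2_ip T)" using L2_ip_psd_sq_int psd_onD(1) by blast
  have sub: "sq_int lebesgue T p" if "affine_field p" for p using affine_sq_int[OF that T] .
  note A = fun_subspaceD[OF affine_field_subspace, unfolded mem_Collect_eq]
  note dg = dg_projection[OF T]
  show "dg_projection T (\<lambda>x. v x + w x) = (\<lambda>x. dg_projection T v x + dg_projection T w x)" if w: "sq_int lebesgue T w"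
  proof (rule dg(3)[OF sq_int_add[OF v w] A(2)[OF dg(1)[OF v] dg(1)[OF w]]])
    fix q assume q: "affine_field q"
    show "L2_ip T (\<lambda>x. dg_projection T v x + dg_projection T w x) q = L2_ip T (\<lambda>x. v x + w x) q"
      using sesq_onD(1)[OF s, of v q w] sesq_onD(1)[OF s, of "dg_projection T v" q "dg_projection T w"]
        v w sub[OF q] sub[OF dg(1)[OF v]] sub[OF dg(1)[OF w]] dg(2)[OF v q] dg(2)[OF w q] by simp
  qed
  show "dg_projection T (\<lambda>x. c * v x) = (\<lambda>x. c * dg_projection T v x)"
  proof (rule dg(3)[OF sq_int_scale[OF v] A(3)[OF dg(1)[OF v]]])
    fix q assume q: "affine_field q"
    show "L2_ip T (\<lambda>x. c * dg_projection T v x) q = L2_ip T (\<lambda>x. c * v x) q"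
      using sesq_onD(3)[OF s, of v q c] sesq_onD(3)[OF s, of "dg_projection T v" q c]
        v sub[OF q] sub[OF dg(1)[OF v]] dg(2)[OF v q] by simp
  qed
  show "dg_projection T (\<lambda>x. cnj (v x)) = (\<lambda>x. cnj (dg_projection T v x))"
  proof (rule dg(3)[OF sq_int_cnj[OF v] affine_field_cnj[OF dg(1)[OF v]]])
    fix q assume q: "affine_field q"
    have c: "L2_ip T (\<lambda>x. cnj (f x)) q = cnj (L2_ip T f (\<lambda>x. cnj (q x)))" for f
      unfolding L2_ip_def set_lint_cnj[symmetric] by simp
    show "L2_ip T (\<lambda>x. cnj (dg_projection T v x)) q = L2_ip T (\<lambda>x. cnj (v x)) q"
      unfolding c using dg(2)[OF v affine_field_cnj[OF q]] by simp
  qed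
  show "dg_projection T v = p" if p: "affine_field p" "\<And>x. x \<in> T \<Longrightarrow> v x = p x"
  proof (rule dg(3)[OF v p(1)])
    show "L2_ip T p q = L2_ip T v q" for q
      unfolding L2_ip_def set_lebesgue_integral_def
      by (intro Bochner_Integration.integral_cong) (auto simp: indicator_def p(2))
  qed
qed

lemma nodal_average_cong:
  assumes "\<And>T. T \<in> TH P \<Longrightarrow> q T = r T"
  shows "nodal_average P q z = nodal_average P r z"
proof -
  have "(\<Sum>T\<in>{T \<in> TH P. z \<in> T}. q T z * complex_of_real (measure lebesgue T))
      = (\<Sum>T\<in>{T \<in> TH P. z \<in> T}. r T z * complex_of_real (measure lebesgue T))"
    by (rule sum.cong[OF refl]) (use assms in auto)
  then show ?thesis by (simp only: nodal_average_def)
qed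

lemma nodal_average_linear:
  "nodal_average P (\<lambda>T x. q T x + r T x) z = nodal_average P q z + nodal_average P r z"
  "nodal_average P (\<lambda>T x. c * q T x) z = c * nodal_average P q z"
  "nodal_average P (\<lambda>T x. cnj (q T x)) z = cnj (nodal_average P q z)"
  by (simp_all add: nodal_average_def distrib_right sum.distrib add_divide_distrib sum_distrib_left mult.assoc)

context helmholtz_problem begin

lemma coarse_sq_int: "T \<in> TH P \<Longrightarrow> v \<in> V_h P \<Longrightarrow> sq_int lebesgue T v"
  using sq_int_lebesgue_mono[OF H1_sq_int H.mesh_sets(1,3)] fe_fine_H1 by blast

lemma E_H_eq:
  "E_H P q \<in> P1 (TH P)" "z \<in> vertices (TH P) \<Longrightarrow> E_H P q z = nodal_average P q z"
  using theI'[OF H.nodal_interpolant[of "nodal_average P q"]] unfolding E_H_def[symmetric] by blast+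

lemma E_H_unique:
  assumes "v \<in> P1 (TH P)" "\<And>z. z \<in> vertices (TH P) \<Longrightarrow> v z = nodal_average P q z"
  shows "E_H P q = v"
  using H.nodal_interpolant[of "nodal_average P q"] E_H_eq assms by blast

lemma I_H_linear:
  assumes v: "v \<in> V_h P"
  shows "w \<in> V_h P \<Longrightarrow> I_H P (\<lambda>x. v x + w x) = (\<lambda>x. I_H P v x + I_H P w x)"
    "I_H P (\<lambda>x. c * v x) = (\<lambda>x. c * I_H P v x)"
    "I_H P (\<lambda>x. cnj (v x)) = (\<lambda>x. cnj (I_H P v x))"
proof -
  note sub = fun_subspaceD[OF H.P1_subspace]
  have dgl: "dg_projection T (\<lambda>x. c * v x) = (\<lambda>x. c * dg_projection T v x)"
    "dg_projection T (\<lambda>x. cnj (v x)) = (\<lambda>x. cnj (dg_projection T v x))"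
    if "T \<in> TH P" for T
    using dg_projection_linear[OF H.triangle[OF that] coarse_sq_int[OF that v]] by blast+
  show "I_H P (\<lambda>x. v x + w x) = (\<lambda>x. I_H P v x + I_H P w x)" if w: "w \<in> V_h P"
    unfolding I_H_def
  proof (rule E_H_unique)
    have dga: "dg_projection T (\<lambda>x. v x + w x) = (\<lambda>x. dg_projection T v x + dg_projection T w x)" if "T \<in> TH P" for T
      using dg_projection_linear(1)[OF H.triangle[OF that] coarse_sq_int[OF that v] coarse_sq_int[OF that w]] .
    show "(\<lambda>x. E_H P (\<lambda>T. dg_projection T v) x + E_H P (\<lambda>T. dg_projection T w) x) \<in> P1 (TH P)"
      by (rule sub(2)[OF E_H_eq(1) E_H_eq(1)])
    show "E_H P (\<lambda>T. dg_projection T v) z + E_H P (\<lambda>T. dg_projection T w) z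
        = nodal_average P (\<lambda>T. dg_projection T (\<lambda>x. v x + w x)) z"
      if "z \<in> vertices (TH P)" for z
      unfolding E_H_eq(2)[OF that] nodal_average_linear[symmetric] by (rule nodal_average_cong[OF dga, symmetric])
  qed
  show "I_H P (\<lambda>x. c * v x) = (\<lambda>x. c * I_H P v x)"
    unfolding I_H_def
  proof (rule E_H_unique)
    show "(\<lambda>x. c * E_H P (\<lambda>T. dg_projection T v) x) \<in> P1 (TH P)" by (rule sub(3)[OF E_H_eq(1)])
    show "c * E_H P (\<lambda>T. dg_projection T v) z = nodal_average P (\<lambda>T. dg_projection T (\<lambda>x. c * v x)) z"
      if "z \<in> vertices (TH P)" for z
      unfolding E_H_eq(2)[OF that] nodal_average_linear[symmetric] by (rule nodal_average_cong[OF dgl(1), symmetric])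
  qed
  show "I_H P (\<lambda>x. cnj (v x)) = (\<lambda>x. cnj (I_H P v x))"
    unfolding I_H_def
  proof (rule E_H_unique)
    show "(\<lambda>x. cnj (E_H P (\<lambda>T. dg_projection T v) x)) \<in> P1 (TH P)" by (rule H.P1_cnj[OF E_H_eq(1)])
    show "cnj (E_H P (\<lambda>T. dg_projection T v) z) = nodal_average P (\<lambda>T. dg_projection T (\<lambda>x. cnj (v x))) z"
      if "z \<in> vertices (TH P)" for z
      unfolding E_H_eq(2)[OF that] nodal_average_linear[symmetric] by (rule nodal_average_cong[OF dgl(2), symmetric])
  qed
qed

text \<open>
  An edge in the closure of the Dirichlet part has both endpoints in that closure, where the nodal
  values are zero, so the interpolant vanishes along the edge.
\<close>

lemma I_H_in_V_H: "I_H P v \<in> V_H P"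
proof -
  let ?u = "I_H P v"
  have u: "?u \<in> P1 (TH P)" unfolding I_H_def by (rule E_H_eq(1))
  have uz: "?u z = 0" if "z \<in> vertices (TH P)" "z \<in> closure (Gamma_D P)" for z
    using that by (simp add: I_H_def E_H_eq(2) nodal_average_def)
  have "?u x = 0" if x: "x \<in> Gamma_D P" for x
  proof -
    have "resolves (TH P) (Gamma_D P)" using setting by (auto simp: helmholtz_setting_def)
    then obtain E where E: "E \<subseteq> mesh_edges (TH P)" "closure (Gamma_D P) = \<Union>E" unfolding resolves_def by blast
    have "x \<in> \<Union>E" using x closure_subset E(2) by blast
    then obtain e T where e: "e \<in> E" "x \<in> e" "T \<in> TH P" "e facet_of T" using E(1) unfolding mesh_edges_def by blast
    have face: "e face_of T" using e(4) by (rule facet_of_imp_face_of)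
    obtain p where p: "affine_field p" "\<forall>x\<in>T. ?u x = p x" using H.P1_affine[OF u e(3)] .
    have "p x = 0"
    proof (rule affine_field_zero_face[OF H.triangle[OF e(3)] face p(1) _ e(2)])
      fix z assume z: "z \<in> corners T" "z \<in> e"
      have "z \<in> vertices (TH P)" using z(1) e(3) H.vertices_eq by blast
      moreover have "z \<in> closure (Gamma_D P)" using z(2) e(1) E(2) by blast
      ultimately have "?u z = 0" by (rule uz)
      then show "p z = 0" using p(2) face_of_imp_subset[OF face] z(2) by auto
    qed
    then show ?thesis using p(2) face_of_imp_subset[OF face] e(2) by auto
  qed
  then show ?thesis using u by (simp add: fe_space_def)
qed

text \<open>
  At a free vertex all values entering the weighted average agree; at a Dirichlet vertex
  the function vanishes by continuity.
\<close>

lemma I_H_projection: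
  assumes v: "v \<in> V_H P" shows "I_H P v = v"
  unfolding I_H_def
proof (rule E_H_unique)
  show vP: "v \<in> P1 (TH P)" using v by (simp add: fe_space_def)
  have vh: "v \<in> V_h P" using v fe_coarse_fine by blast
  fix z assume z: "z \<in> vertices (TH P)"
  show "v z = nodal_average P (\<lambda>T. dg_projection T v) z"
  proof (cases "z \<in> closure (Gamma_D P)")
    case True
    have "v z = 0"
    proof (rule continuous_constant_on_closure[of "Gamma_D P" v 0])
      show "continuous_on (closure (Gamma_D P)) v"
        by (rule continuous_on_subset[OF H.P1_continuous[OF vP] Gamma_sub(3)]) simp
      show "v x = 0" if "x \<in> Gamma_D P" for x using v that by (simp add: fe_space_def)
    qed (rule True)
    then show ?thesis using True by (simp add: nodal_average_def)
  next
    case False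
    let ?S = "{T \<in> TH P. z \<in> T}"
    let ?m = "\<lambda>T. complex_of_real (measure lebesgue T)"
    have dg: "dg_projection T v z = v z" if T: "T \<in> ?S" for T
    proof -
      have TH: "T \<in> TH P" using T by blast
      obtain p where p: "affine_field p" "\<forall>x\<in>T. v x = p x" using H.P1_affine[OF vP TH] .
      have "dg_projection T v = p"
        using p by (intro dg_projection_linear(4)[OF H.triangle[OF TH] coarse_sq_int[OF TH vh]]) auto
      then show ?thesis using p(2) T by auto
    qed
    have pos: "0 < measure lebesgue T" if T: "T \<in> TH P" for T
    proof -
      note t = triangle_facts[OF H.triangle[OF T]]
      have "\<not> negligible T"
        using negligible_convex_interior[OF t(8)] t(6) by simp
      then show ?thesis using t(7) by (metis lmeasurable_compact measure_nonneg negligible_iff_measure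
          order_le_imp_less_or_eq)
    qed
    obtain T0 where T0: "T0 \<in> ?S" using z H.Union_mesh H.vertices_sub by blast
    have "(\<Sum>T\<in>?S. measure lebesgue T) > 0"
      using T0 pos H.finite_mesh by (intro sum_pos) auto
    then have nz: "(\<Sum>T\<in>?S. ?m T) \<noteq> 0" unfolding of_real_sum[symmetric] of_real_eq_0_iff
        by (rule less_imp_neq[symmetric])
    have "(\<Sum>T\<in>?S. dg_projection T v z * ?m T) = v z * (\<Sum>T\<in>?S. ?m T)"
      unfolding sum_distrib_left by (rule sum.cong[OF refl]) (simp only: dg)
    then show ?thesis using False nz by (simp add: nodal_average_def)
  qed
qed

lemma W_h_subspace: "fun_subspace (W_h P)"
proof -
  have z: "(\<lambda>_. 0) \<in> V_h P" "(\<lambda>_. 0) \<in> V_H P"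
    using fun_subspaceD(1) fe_fine_subspace fe_coarse_subspace by blast+
  have "I_H P (\<lambda>_. 0) = (\<lambda>_. 0)" by (rule I_H_projection[OF z(2)])
  then show ?thesis
    unfolding fun_subspace_def
    using z fun_subspaceD(2,3)[OF fe_fine_subspace] I_H_linear(1,2) by (simp add: W_h_def)
qed

lemma W_h_sub: "W_h P \<subseteq> V_h P" by (auto simp: W_h_def)

lemma W_h_cnj: "w \<in> W_h P \<Longrightarrow> (\<lambda>x. cnj (w x)) \<in> W_h P"
  using fe_cnj(1) I_H_linear(3) by (simp add: W_h_def)

lemma minus_I_H_in_W_h:
  assumes v: "v \<in> V_h P" shows "(\<lambda>x. v x - I_H P v x) \<in> W_h P"
proof -
  have u: "I_H P v \<in> V_H P" by (rule I_H_in_V_H)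
  then have uh: "I_H P v \<in> V_h P" using fe_coarse_fine by blast
  have m: "(\<lambda>x. - 1 * I_H P v x) \<in> V_h P" by (rule fun_subspaceD(3)[OF fe_fine_subspace uh])
  have "I_H P (\<lambda>x. v x + - 1 * I_H P v x) = (\<lambda>x. I_H P v x + - 1 * I_H P (I_H P v) x)"
    using I_H_linear(1)[OF v m] I_H_linear(2)[OF uh, of "- 1"] by simp
  then have "I_H P (\<lambda>x. v x - I_H P v x) = (\<lambda>_. 0)" using I_H_projection[OF u] by simp
  then show ?thesis using fun_subspaceD(4)[OF fe_fine_subspace v uh] by (simp add: W_h_def)
qed

end

section \<open>Continuity and kernel coercivity of the Helmholtz form\<close>

context helmholtz_problem begin

lemma \<Omega>_sets: "\<Omega> \<in> sets lebesgue" "negligible (\<Omega> - \<Omega>)"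
  using domain(1) by auto

lemma Gamma_R: "Gamma_R P \<in> sets borel" "Gamma_R P \<subseteq> frontier \<Omega>"
  using Gamma_sub[of "Gamma_R P"] by auto

lemma Gamma_R_T: 
  assumes "T \<in> TH P" shows "Gamma_R P \<inter> T \<in> sets borel" "Gamma_R P \<inter> T \<subseteq> frontier \<Omega>"
  using Gamma_R H.mesh_sets(2)[OF assms] by auto

lemma b_form_psd: "psd_on (H1 \<Omega>) (b_form P)"
proof -
  have "b_form P = (\<lambda>v w. grad_ip P \<Omega> v w + complex_of_real ((wavenumber P)\<^sup>2) * L2_ip \<Omega> v w)"
    by (intro ext) (simp add: b_form_def)
  then show ?thesis
    using psd_on_add[OF grad_ip_psd[OF \<Omega>_sets] psd_on_scale[OF L2_ip_psd[OF \<Omega>_sets], of "(wavenumber P)\<^sup>2"]] by simp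
qed

lemma b_form_psd_fe: "psd_on (V_h P) (b_form P)"
  by (rule psd_on_subset[OF b_form_psd fe_fine_H1])

lemma a_on_sesq:
  assumes "S \<in> sets lebesgue" "negligible (S - \<Omega>)" "G \<in> sets borel" "G \<subseteq> frontier \<Omega>"
  shows "sesq_on (V_h P) (a_on P S G)"
proof -
  have eq: "a_on P S G = (\<lambda>v w. (grad_ip P S v w + (- complex_of_real ((wavenumber P)\<^sup>2)) * L2_ip S v w)
      + (- (\<i> * complex_of_real (wavenumber P))) * boundary_ip P G v w)"
    by (intro ext) (simp add: a_on_def)
  have 1: "sesq_on (V_h P) (grad_ip P S)" "sesq_on (V_h P) (L2_ip S)" "sesq_on (V_h P) (boundary_ip P G)"
    using psd_onD(1)[OF psd_on_subset[OF grad_ip_psd[OF assms(1,2)] fe_fine_H1]]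
      psd_onD(1)[OF psd_on_subset[OF L2_ip_psd[OF assms(1,2)] fe_fine_H1]]
      psd_onD(1)[OF psd_on_subset[OF boundary_ip_psd[OF assms(3,4)] fe_fine_P1]] by blast+
  show ?thesis unfolding eq by (intro sesq_on_add sesq_on_scale 1)
qed

lemma a_form_sesq: "sesq_on (V_h P) (a_form P)"
  unfolding a_form_def by (rule a_on_sesq[OF \<Omega>_sets Gamma_R])

lemma a_loc_sesq: "T \<in> TH P \<Longrightarrow> sesq_on (V_h P) (a_loc P T)"
  unfolding a_loc_def by (rule a_on_sesq[OF H.mesh_sets(1,3) Gamma_R_T])

lemma a_on_cnj:
  assumes "S \<in> sets lebesgue" "negligible (S - \<Omega>)" "G \<in> sets borel" "G \<subseteq> frontier \<Omega>" and v: "v \<in> V_h P" and w: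
      "w \<in> V_h P"
  shows "a_on P S G (\<lambda>x. cnj (w x)) (\<lambda>x. cnj (v x)) = a_on P S G v w"
  unfolding a_on_def
  using ip_cnj[OF assms(1,2) subsetD[OF fe_fine_H1 v] subsetD[OF fe_fine_H1 w]]
    boundary_ip_cnj[OF assms(3,4) subsetD[OF fe_fine_P1 v] subsetD[OF fe_fine_P1 w]] by simp

lemma a_form_cnj: "v \<in> V_h P \<Longrightarrow> w \<in> V_h P \<Longrightarrow> a_form P (\<lambda>x. cnj (w x)) (\<lambda>x. cnj (v x)) = a_form P v w"
  unfolding a_form_def by (rule a_on_cnj[OF \<Omega>_sets Gamma_R])

lemma a_loc_cnj: "T \<in> TH P \<Longrightarrow> v \<in> V_h P \<Longrightarrow> w \<in> V_h P \<Longrightarrow> a_loc P T (\<lambda>x. cnj (w x)) (\<lambda>x. cnj (v x)) = a_loc P T v w"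
  unfolding a_loc_def by (rule a_on_cnj[OF H.mesh_sets(1,3) Gamma_R_T])

lemma knorm_nonneg: "v \<in> V_h P \<Longrightarrow> 0 \<le> knorm P v"
  unfolding knorm_def using psd_onD(3)[OF b_form_psd_fe] by simp

lemma knorm_square: "v \<in> V_h P \<Longrightarrow> (knorm P v)\<^sup>2 = Re (b_form P v v)"
  unfolding knorm_def using psd_onD(3)[OF b_form_psd_fe] by simp

lemma b_form_Cauchy_Schwarz:
  assumes "v \<in> V_h P" "w \<in> V_h P"
  shows "cmod (b_form P v w) \<le> knorm P v * knorm P w"
  unfolding knorm_def by (rule psd_on_Cauchy_Schwarz[OF fe_fine_subspace b_form_psd_fe assms])

lemma knorm_triangle:
  assumes "v \<in> V_h P" "w \<in> V_h P"
  shows "knorm P (\<lambda>x. v x + w x) \<le> knorm P v + knorm P w"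
  unfolding knorm_def by (rule psd_on_triangle[OF fe_fine_subspace b_form_psd_fe assms])

text \<open>
  The \<open>L\<^sup>2\<close> part vanishes because \<open>k > 0\<close>; continuity upgrades equality almost everywhere on the domain to
  equality on its closure.
\<close>

lemma b_form_definite:
  assumes v: "v \<in> V_h P" and z: "b_form P v v = 0"
  shows "v = (\<lambda>_. 0)"
proof -
  have vH: "v \<in> H1 \<Omega>" and vP: "v \<in> P1 (Th P)" using v fe_fine_H1 fe_fine_P1 by blast+
  have "0 \<le> Re (grad_ip P \<Omega> v v)" "0 \<le> Re (L2_ip \<Omega> v v)"
    using psd_onD(3)[OF grad_ip_psd[OF \<Omega>_sets] vH] psd_onD(3)[OF L2_ip_psd[OF \<Omega>_sets] vH] by blast+
  moreover have "Re (grad_ip P \<Omega> v v) + (wavenumber P)\<^sup>2 * Re (L2_ip \<Omega> v v) = 0"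
    using arg_cong[OF z, of Re] by (simp add: b_form_def)
  ultimately have "Re (L2_ip \<Omega> v v) = 0"
    using wavenumber_pos by (smt (verit) mult_pos_pos zero_less_power)
  then have "L2_ip \<Omega> v v = 0" using psd_on_Re(1)[OF L2_ip_psd[OF \<Omega>_sets] vH] by simp
  then have ae: "AE x in lebesgue. x \<in> \<Omega> \<longrightarrow> v x = 0" by (rule L2_ip_zero_AE[OF H1_sq_int[OF vH]])
  have on: "v x = 0" if "x \<in> \<Omega>" for x
    by (rule continuous_AE_zero_on_open[OF domain(1) continuous_on_subset[OF h.P1_continuous[OF vP]
        closure_subset] ae that])
  have "v x = 0" for x
  proof (cases "x \<in> closure \<Omega>")
    case True
    show ?thesis by (rule continuous_constant_on_closure[OF h.P1_continuous[OF vP] on True])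
  qed (rule h.P1_outside[OF vP])
  then show ?thesis by (intro ext)
qed

lemma knorm_eq_0:
  assumes v: "v \<in> V_h P" and z: "knorm P v = 0" shows "v = (\<lambda>_. 0)"
proof -
  have "Re (b_form P v v) = 0" using knorm_square[OF v] z by simp
  then have "b_form P v v = 0" using psd_on_Re(1)[OF b_form_psd_fe v] by simp
  then show ?thesis by (rule b_form_definite[OF v])
qed

lemma knorm_cnj:
  assumes v: "v \<in> V_h P" shows "knorm P (\<lambda>x. cnj (v x)) = knorm P v"
  using ip_cnj[OF \<Omega>_sets subsetD[OF fe_fine_H1 v] subsetD[OF fe_fine_H1 v]] by (simp add: knorm_def b_form_def)

lemma knorm_zero: "knorm P (\<lambda>_. 0) = 0"
proof -
  have z: "(\<lambda>_. 0) \<in> V_h P" by (rule fun_subspaceD(1)[OF fe_fine_subspace])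
  have "b_form P (\<lambda>x. 0 * 0) (\<lambda>_. 0) = 0 * b_form P (\<lambda>_. 0) (\<lambda>_. 0)"
    by (rule sesq_onD(3)[OF psd_onD(1)[OF b_form_psd_fe] z z])
  then show ?thesis by (simp add: knorm_def)
qed

lemma knorm_sum:
  assumes "finite I" "\<And>i. i \<in> I \<Longrightarrow> f i \<in> V_h P"
  shows "knorm P (\<lambda>x. \<Sum>i\<in>I. f i x) \<le> (\<Sum>i\<in>I. knorm P (f i))"
  using assms
proof (induction I rule: finite_induct)
  case empty then show ?case using knorm_zero by simp
next
  case (insert i I)
  have "(\<lambda>x. \<Sum>i\<in>I. f i x) \<in> V_h P" using insert by (intro fun_subspace_sum[OF fe_fine_subspace]) auto
  then have "knorm P (\<lambda>x. f i x + (\<Sum>i\<in>I. f i x)) \<le> knorm P (f i) + knorm P (\<lambda>x. \<Sum>i\<in>I. f i x)"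
    using insert by (intro knorm_triangle) auto
  then show ?case using insert by simp
qed

lemma knorm_minus:
  assumes v: "v \<in> V_h P" shows "knorm P (\<lambda>x. - v x) = knorm P v"
proof -
  note s = psd_onD(1)[OF b_form_psd_fe]
  have m: "(\<lambda>x. - 1 * v x) \<in> V_h P" by (rule fun_subspaceD(3)[OF fe_fine_subspace v])
  have "b_form P (\<lambda>x. - 1 * v x) (\<lambda>x. - 1 * v x) = b_form P v v"
    using sesq_onD(3)[OF s v m, of "- 1"] sesq_onD(4)[OF s v v, of "- 1"] by simp
  then show ?thesis by (simp add: knorm_def)
qed

lemma knorm_diff:
  assumes v: "v \<in> V_h P" and w: "w \<in> V_h P"
  shows "knorm P (\<lambda>x. v x - w x) \<le> knorm P v + knorm P w"
proof -
  have "(\<lambda>x. - 1 * w x) \<in> V_h P" by (rule fun_subspaceD(3)[OF fe_fine_subspace w])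
  from knorm_triangle[OF v this] show ?thesis using knorm_minus[OF w] by simp
qed

text \<open>
  Elements overlap in null sets, and the boundary of the domain is a null set.
\<close>

lemma mesh_integral:
  fixes f :: "plane \<Rightarrow> complex"
  assumes f: "\<And>S. S \<in> sets lebesgue \<Longrightarrow> negligible (S - \<Omega>) \<Longrightarrow> set_integrable lebesgue S f"
  shows "N \<subseteq> TH P \<Longrightarrow> (LINT x:\<Union>N|lebesgue. f x) = (\<Sum>T\<in>N. LINT x:T|lebesgue. f x)"
    "(LINT x:\<Omega>|lebesgue. f x) = (\<Sum>T\<in>TH P. LINT x:T|lebesgue. f x)"
proof -
  show gen: "(LINT x:\<Union>N|lebesgue. f x) = (\<Sum>T\<in>N. LINT x:T|lebesgue. f x)" if N: "N \<subseteq> TH P" for N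
  proof -
    have "(LINT x:(\<Union>T\<in>N. T)|lebesgue. f x) = (\<Sum>T\<in>N. LINT x:T|lebesgue. f x)"
    proof (rule set_integral_finite_UN_AE)
      show "finite N" using N H.finite_mesh finite_subset by blast
      show "AE x in lebesgue. x \<in> T \<and> x \<in> T' \<longrightarrow> T = T'" if "T \<in> N" "T' \<in> N" for T T'
        using H.AE_overlap N that by blast
      show "T \<in> sets lebesgue" if "T \<in> N" for T using H.mesh_sets(1) N that by blast
      show "set_integrable lebesgue T f" if "T \<in> N" for T
        using f H.mesh_sets(1,3) N that by blast
    qed
    then show ?thesis by simp
  qed
  have cl: "closure \<Omega> \<in> sets lebesgue" "negligible (closure \<Omega> - \<Omega>)"
    using frontier_negligible domain(1) by (auto simp: frontier_def interior_open)
  have ae: "AE x in lebesgue. x \<notin> closure \<Omega> - \<Omega>" using cl(2) AE_not_in negligible_iff_null_sets by blast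
  have "(LINT x:\<Omega>|lebesgue. f x) = (LINT x:closure \<Omega>|lebesgue. f x)"
    unfolding set_lebesgue_integral_def
  proof (rule integral_cong_AE)
    show "(\<lambda>x. indicat_real \<Omega> x *\<^sub>R f x) \<in> borel_measurable lebesgue"
        "(\<lambda>x. indicat_real (closure \<Omega>) x *\<^sub>R f x) \<in> borel_measurable lebesgue"
      using f[OF \<Omega>_sets] f[OF cl] unfolding set_integrable_def by (auto intro: borel_measurable_integrable)
    show "AE x in lebesgue. indicat_real \<Omega> x *\<^sub>R f x = indicat_real (closure \<Omega>) x *\<^sub>R f x"
      using ae by eventually_elim (use closure_subset in \<open>auto simp: indicator_def\<close>)
  qed
  then show "(LINT x:\<Omega>|lebesgue. f x) = (\<Sum>T\<in>TH P. LINT x:T|lebesgue. f x)"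
    using gen[of "TH P"] H.Union_mesh by simp
qed

lemma ip_mesh_sum:
  assumes v: "v \<in> H1 \<Omega>" and w: "w \<in> H1 \<Omega>"
  shows "L2_ip \<Omega> v w = (\<Sum>T\<in>TH P. L2_ip T v w)" "grad_ip P \<Omega> v w = (\<Sum>T\<in>TH P. grad_ip P T v w)"
    "N \<subseteq> TH P \<Longrightarrow> grad_ip P (\<Union>N) v w = (\<Sum>T\<in>N. grad_ip P T v w)"
proof -
  show "L2_ip \<Omega> v w = (\<Sum>T\<in>TH P. L2_ip T v w)"
    unfolding L2_ip_def 
    by (rule mesh_integral(2)) (rule sq_int_mult[OF sq_int_S[OF _ _ H1_sq_int[OF v]] sq_int_S[OF _ _ H1_sq_int[OF w]]])
  have int: "set_integrable lebesgue S (\<lambda>x. \<Sum>i\<in>UNIV. grad \<Omega> v x $ i * cnj (grad \<Omega> w x $ i))"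
    if "S \<in> sets lebesgue" "negligible (S - \<Omega>)" for S
  proof -
    have "set_integrable lebesgue S (\<lambda>x. grad \<Omega> v x $ i * cnj (grad \<Omega> w x $ i))" for i
      by (rule sq_int_mult[OF sq_int_S[OF that grad_sq_int[OF v]] sq_int_S[OF that grad_sq_int[OF w]]])
    then show ?thesis unfolding set_integrable_def scaleR_sum_right by (intro Bochner_Integration.integrable_sum)
  qed
  show "grad_ip P \<Omega> v w = (\<Sum>T\<in>TH P. grad_ip P T v w)"
    unfolding grad_ip_def by (rule mesh_integral(2)[OF int])
  show "grad_ip P (\<Union>N) v w = (\<Sum>T\<in>N. grad_ip P T v w)" if "N \<subseteq> TH P"
    unfolding grad_ip_def by (rule mesh_integral(1)[OF int that])
qed

lemma element_nonneg:
  assumes "T \<in> TH P" "v \<in> H1 \<Omega>"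
  shows "0 \<le> Re (L2_ip T v v)" "0 \<le> Re (grad_ip P T v v)"
  using psd_onD(3)[OF grad_ip_psd[OF H.mesh_sets(1,3)[OF assms(1)]] assms(2)]
    psd_onD(3)[OF L2_ip_psd[OF H.mesh_sets(1,3)[OF assms(1)]] assms(2)] by blast+

lemma element_mono:
  assumes T: "T \<in> TH P" and v: "v \<in> H1 \<Omega>"
  shows "Re (L2_ip T v v) \<le> Re (L2_ip \<Omega> v v)" "Re (grad_ip P T v v) \<le> Re (grad_ip P \<Omega> v v)"
  unfolding ip_mesh_sum(1,2)[OF v v] Re_sum
  using T element_nonneg[OF _ v] H.finite_mesh by (auto intro: member_le_sum)

lemma knorm_square_split:
  assumes v: "v \<in> V_h P"
  shows "(knorm P v)\<^sup>2 = Re (grad_ip P \<Omega> v v) + (wavenumber P)\<^sup>2 * Re (L2_ip \<Omega> v v)"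
  using knorm_square[OF v] by (simp add: b_form_def)

lemma a_form_diagonal:
  assumes v: "v \<in> V_h P"
  shows "Re (a_form P v v) = Re (grad_ip P \<Omega> v v) - (wavenumber P)\<^sup>2 * Re (L2_ip \<Omega> v v)"
    "Im (a_form P v v) = - wavenumber P * Re (boundary_ip P (Gamma_R P) v v)"
proof -
  have vH: "v \<in> H1 \<Omega>" and vP: "v \<in> P1 (Th P)" using v fe_fine_H1 fe_fine_P1 by blast+
  obtain g l b where *: "grad_ip P \<Omega> v v = complex_of_real g" "L2_ip \<Omega> v v
      = complex_of_real l" "boundary_ip P (Gamma_R P) v v = complex_of_real b"
    using psd_on_Re(1)[OF grad_ip_psd[OF \<Omega>_sets] vH] psd_on_Re(1)[OF L2_ip_psd[OF \<Omega>_sets] vH]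
      psd_on_Re(1)[OF boundary_ip_psd[OF Gamma_R] vP] by blast
  have "a_form P v v = complex_of_real (g - (wavenumber P)\<^sup>2 * l) - \<i> * complex_of_real (wavenumber P * b)"
    unfolding a_form_def a_on_def * by simp
  then show "Re (a_form P v v) = Re (grad_ip P \<Omega> v v) - (wavenumber P)\<^sup>2 * Re (L2_ip \<Omega> v v)"
    "Im (a_form P v v) = - wavenumber P * Re (boundary_ip P (Gamma_R P) v v)"
    unfolding * by simp_all
qed

text \<open>
  The gradient and \<open>L\<^sup>2\<close> terms are bounded by the Cauchy-Schwarz inequality. For the Robin term,
  \<open>- Im a(v, v)\<close> is \<open>k\<close> times the squared trace norm of \<open>v\<close>, so the continuity constant of \<open>a\<close> takes the
  place of a trace inequality.
\<close>

lemma a_loc_bound: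
  assumes C: "continuity_constant P C" and T: "T \<in> TH P" and v: "v \<in> V_h P" and w: "w \<in> V_h P"
  shows "cmod (a_loc P T v w) \<le> (2 + C) * knorm P v * knorm P w"
proof -
  note S = H.mesh_sets(1,3)[OF T] and G = Gamma_R_T[OF T]
  let ?k = "wavenumber P"
  have g: "sqrt (Re (grad_ip P T u u)) \<le> knorm P u" and l: "?k * sqrt (Re (L2_ip T u u)) \<le> knorm P u"
    and b: "sqrt ?k * sqrt (Re (boundary_ip P (Gamma_R P \<inter> T) u u)) \<le> sqrt C * knorm P u" if u: "u \<in> V_h P" for u
  proof -
    have uH: "u \<in> H1 \<Omega>" and uP: "u \<in> P1 (Th P)" using u fe_fine_H1 fe_fine_P1 by blast+
    note nn = psd_onD(3)[OF grad_ip_psd[OF \<Omega>_sets] uH] psd_onD(3)[OF L2_ip_psd[OF \<Omega>_sets] uH]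
    have kk: "0 \<le> ?k\<^sup>2 * Re (L2_ip \<Omega> u u)" using nn by simp
    have "Re (grad_ip P T u u) \<le> (knorm P u)\<^sup>2"
      using element_mono(2)[OF T uH] kk unfolding knorm_square_split[OF u] by linarith
    then show "sqrt (Re (grad_ip P T u u)) \<le> knorm P u"
      using knorm_nonneg[OF u] real_le_lsqrt by (simp add: real_sqrt_le_iff real_le_lsqrt)
    have "?k\<^sup>2 * Re (L2_ip T u u) \<le> ?k\<^sup>2 * Re (L2_ip \<Omega> u u)"
      by (intro mult_left_mono element_mono(1)[OF T uH]) simp
    then have "?k\<^sup>2 * Re (L2_ip T u u) \<le> (knorm P u)\<^sup>2" using nn unfolding knorm_square_split[OF u] by linarith
    then have "sqrt (?k\<^sup>2 * Re (L2_ip T u u)) \<le> knorm P u" using knorm_nonneg[OF u] by (intro real_le_lsqrt)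
    then show "?k * sqrt (Re (L2_ip T u u)) \<le> knorm P u" using wavenumber_pos by (simp add: real_sqrt_mult)
    have "?k * Re (boundary_ip P (Gamma_R P \<inter> T) u u) \<le> ?k * Re (boundary_ip P (Gamma_R P) u u)"
      using wavenumber_pos boundary_ip_mono[OF Gamma_R G(1) _ uP] by (intro mult_left_mono) auto
    also have "\<dots> = - Im (a_form P u u)" using a_form_diagonal(2)[OF u] by simp
    also have "\<dots> \<le> cmod (a_form P u u)" using abs_Im_le_cmod[of "a_form P u u"] by linarith
    also have "\<dots> \<le> C * knorm P u * knorm P u"
      using C u fe_fine_sub_V unfolding continuity_constant_def by blast
    finally have "sqrt (?k * Re (boundary_ip P (Gamma_R P \<inter> T) u u)) \<le> sqrt (C * (knorm P u)\<^sup>2)"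
      by (intro real_sqrt_le_mono) (simp add: power2_eq_square mult.assoc)
    then show "sqrt ?k * sqrt (Re (boundary_ip P (Gamma_R P \<inter> T) u u)) \<le> sqrt C * knorm P u"
      using knorm_nonneg[OF u] by (simp add: real_sqrt_mult)
  qed
  have C0: "0 \<le> C" using C by (simp add: continuity_constant_def)
  have vH: "v \<in> H1 \<Omega>" "w \<in> H1 \<Omega>" and vP: "v \<in> P1 (Th P)" "w \<in> P1 (Th P)" using v w fe_fine_H1 fe_fine_P1 by blast+
  have 1: "cmod (grad_ip P T v w) \<le> knorm P v * knorm P w"
    using psd_on_Cauchy_Schwarz[OF H1_subsp grad_ip_psd[OF S] vH] 
      mult_mono[OF g[OF v] g[OF w] knorm_nonneg[OF v]] element_nonneg(2)[OF T vH(2)] by simp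
  have 2: "cmod (complex_of_real (?k\<^sup>2) * L2_ip T v w) \<le> knorm P v * knorm P w"
  proof -
    have "cmod (complex_of_real (?k\<^sup>2) * L2_ip T v w) = ?k\<^sup>2 * cmod (L2_ip T v w)" by (simp add: norm_mult norm_power)
    also have "\<dots> \<le> ?k\<^sup>2 * (sqrt (Re (L2_ip T v v)) * sqrt (Re (L2_ip T w w)))"
      using psd_on_Cauchy_Schwarz[OF H1_subsp L2_ip_psd[OF S] vH] by (intro mult_left_mono) auto
    also have "\<dots> = (?k * sqrt (Re (L2_ip T v v))) * (?k * sqrt (Re (L2_ip T w w)))"
      by (simp add: power2_eq_square)
    also have "\<dots> \<le> knorm P v * knorm P w"
      using wavenumber_pos element_nonneg(1)[OF T vH(2)] by (intro mult_mono l v w knorm_nonneg) auto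
    finally show ?thesis .
  qed
  have 3: "cmod (\<i> * complex_of_real ?k * boundary_ip P (Gamma_R P \<inter> T) v w) \<le> C * knorm P v * knorm P w"
  proof -
    let ?b = "\<lambda>u. sqrt (Re (boundary_ip P (Gamma_R P \<inter> T) u u))"
    have "cmod (\<i> * complex_of_real ?k * boundary_ip P (Gamma_R P \<inter> T) v w)
        = ?k * cmod (boundary_ip P (Gamma_R P \<inter> T) v w)"
      using wavenumber_pos by (simp add: norm_mult)
    also have "\<dots> \<le> ?k * (?b v * ?b w)"
      using psd_on_Cauchy_Schwarz[OF h.P1_subspace boundary_ip_psd[OF G] vP] wavenumber_pos
          by (intro mult_left_mono) auto
    also have "\<dots> = (sqrt ?k * sqrt ?k) * (?b v * ?b w)" using wavenumber_pos by simp
    also have "\<dots> = (sqrt ?k * ?b v) * (sqrt ?k * ?b w)" by (simp only: mult_ac)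
    also have "\<dots> \<le> (sqrt C * knorm P v) * (sqrt C * knorm P w)"
      using wavenumber_pos psd_onD(3)[OF boundary_ip_psd[OF G] vP(2)] C0
      by (intro mult_mono b v w mult_nonneg_nonneg knorm_nonneg) auto
    also have "\<dots> = (sqrt C * sqrt C) * knorm P v * knorm P w" by (simp only: mult_ac)
    also have "\<dots> = C * knorm P v * knorm P w" using C0 by simp
    finally show ?thesis .
  qed
  have "cmod (a_loc P T v w) \<le> cmod (grad_ip P T v w) + cmod (complex_of_real (?k\<^sup>2) * L2_ip T v w)
      + cmod (\<i> * complex_of_real ?k * boundary_ip P (Gamma_R P \<inter> T) v w)"
    unfolding a_loc_def a_on_def by (intro order_trans[OF norm_triangle_ineq4] add_mono norm_triangle_ineq4) simp
  also have "\<dots> \<le> (2 + C) * knorm P v * knorm P w" using 1 2 3 by (simp add: algebra_simps)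
  finally show ?thesis .
qed

text \<open>
  On the kernel the approximation property bounds the \<open>L\<^sup>2\<close> norm on each element by the gradient on its
  patch. In the sum over all elements, each element is counted once for every patch that contains it,
  hence at most \<open>C\<^sub>p\<^sub>a\<^sub>t\<^sub>c\<^sub>h(1)\<close> times.
\<close>

lemma kernel_L2_bound:
  assumes C: "approximation_constant P C" and w: "w \<in> W_h P"
  shows "(wavenumber P)\<^sup>2 * Re (L2_ip \<Omega> w w) \<le> (chi_res P C)\<^sup>2 * Re (grad_ip P \<Omega> w w)"
proof -
  let ?k = "wavenumber P"
  define m where "m = (MAX T\<in>TH P. ?k * diameter T)"
  define N where "N T = {K \<in> TH P. K \<inter> T \<noteq> {}}" for T
  have wh: "w \<in> V_h P" using w W_h_sub by blast
  have wH: "w \<in> H1 \<Omega>" using wh fe_fine_H1 by blast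
  have C0: "0 \<le> C" using C by (simp add: approximation_constant_def)
  have cl: "closure T = T" if "T \<in> TH P" for T using triangle_facts(9)[OF H.triangle[OF that]] by simp
  have nb: "nbhd P T = \<Union>(N T)" if "T \<in> TH P" for T
    unfolding nbhd_def N_def using cl that by (metis (no_types, lifting) Collect_cong)
  have fN: "finite (N T)" "N T \<subseteq> TH P" for T using H.finite_mesh by (auto simp: N_def)
  have elementwise: "?k\<^sup>2 * Re (L2_ip T w w) \<le> (C * m)\<^sup>2 * (\<Sum>K\<in>N T. Re (grad_ip P K w w))" if T: "T \<in> TH P" for T
  proof -
    note t = triangle_facts[OF H.triangle[OF T]]
    let ?g = "Re (grad_ip P (nbhd P T) w w)"
    have g: "?g = (\<Sum>K\<in>N T. Re (grad_ip P K w w))"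
      unfolding nb[OF T] ip_mesh_sum(3)[OF wH wH fN(2)] by simp
    have g0: "0 \<le> ?g" unfolding g using fN(2) element_nonneg(2)[OF _ wH] by (intro sum_nonneg) blast
    have d: "0 < diameter T"
    proof -
      obtain x e where "0 < e" "ball x e \<subseteq> T" using t(6) mem_interior by blast
      then have "diameter (ball x e) \<le> diameter T" using t(10) diameter_subset by blast
      then show ?thesis using \<open>0 < e\<close> by simp
    qed
    have "inverse (diameter T) * L2_norm T (\<lambda>x. w x - I_H P w x) \<le> C * grad_norm P (nbhd P T) w"
      using C T wh fe_fine_sub_V unfolding approximation_constant_def by blast
    then have "L2_norm T w \<le> diameter T * (C * grad_norm P (nbhd P T) w)"
      using w d by (simp add: W_h_def field_simps)
    moreover have "0 \<le> L2_norm T w" unfolding L2_norm_def using element_nonneg(1)[OF T wH] by simp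
    ultimately have "(L2_norm T w)\<^sup>2 \<le> (diameter T * (C * grad_norm P (nbhd P T) w))\<^sup>2" by (intro power_mono)
    then have sq: "Re (L2_ip T w w) \<le> (diameter T * C)\<^sup>2 * ?g"
      using element_nonneg(1)[OF T wH] g0 by (simp add: L2_norm_def grad_norm_def power_mult_distrib)
    have km: "?k * diameter T \<le> m" unfolding m_def using H.finite_mesh T by (intro Max_ge) auto
    have "?k\<^sup>2 * Re (L2_ip T w w) \<le> ?k\<^sup>2 * ((diameter T * C)\<^sup>2 * ?g)"
      using sq by (intro mult_left_mono) auto
    also have "\<dots> = (C * (?k * diameter T))\<^sup>2 * ?g" by (simp add: power_mult_distrib mult_ac)
    also have "\<dots> \<le> (C * m)\<^sup>2 * ?g"
      using km C0 d wavenumber_pos g0 by (intro mult_right_mono power_mono mult_left_mono mult_nonneg_nonneg) auto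
    finally show ?thesis unfolding g .
  qed
  have card: "real (card (N K)) \<le> real (C_patch P 1)" if K: "K \<in> TH P" for K
  proof -
    have p: "patch P (enat 1) K = nbhd P K" by (simp add: patch_def)
    have "N K \<subseteq> {K' \<in> TH P. K' \<subseteq> patch P (enat 1) K}" unfolding p nb[OF K] using fN(2) by blast
    then have "card (N K) \<le> card {K' \<in> TH P. K' \<subseteq> patch P (enat 1) K}" using H.finite_mesh by (intro card_mono) auto
    also have "\<dots> \<le> C_patch P 1" unfolding C_patch_def using H.finite_mesh K by (intro Max_ge) auto
    finally show ?thesis by simp
  qed
  have "?k\<^sup>2 * Re (L2_ip \<Omega> w w) = (\<Sum>T\<in>TH P. ?k\<^sup>2 * Re (L2_ip T w w))"
    unfolding ip_mesh_sum(1)[OF wH wH] by (simp add: sum_distrib_left)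
  also have "\<dots> \<le> (\<Sum>T\<in>TH P. (C * m)\<^sup>2 * (\<Sum>K\<in>N T. Re (grad_ip P K w w)))" by (intro sum_mono elementwise)
  also have "\<dots> = (C * m)\<^sup>2 * (\<Sum>T\<in>TH P. \<Sum>K\<in>N T. Re (grad_ip P K w w))" by (simp add: sum_distrib_left)
  \<comment> \<open>\<open>K\<close> lies in the patch of \<open>T\<close> iff \<open>T\<close> lies in the patch of \<open>K\<close>\<close>
  also have "(\<Sum>T\<in>TH P. \<Sum>K\<in>N T. Re (grad_ip P K w w)) = (\<Sum>K\<in>TH P. \<Sum>T\<in>{T \<in> TH P. K \<inter> T \<noteq> {}}. Re (grad_ip P K w w))"
    unfolding N_def by (rule sum.swap_restrict[OF H.finite_mesh H.finite_mesh])
  also have "\<dots> = (\<Sum>K\<in>TH P. real (card (N K)) * Re (grad_ip P K w w))"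
    by (simp add: N_def Int_commute)
  also have "\<dots> \<le> (\<Sum>K\<in>TH P. real (C_patch P 1) * Re (grad_ip P K w w))"
    using card element_nonneg(2)[OF _ wH] by (intro sum_mono mult_right_mono)
  also have "\<dots> = real (C_patch P 1) * Re (grad_ip P \<Omega> w w)"
    unfolding ip_mesh_sum(2)[OF wH wH] by (simp add: sum_distrib_left)
  finally have "?k\<^sup>2 * Re (L2_ip \<Omega> w w) \<le> (C * m)\<^sup>2 * (real (C_patch P 1) * Re (grad_ip P \<Omega> w w))"
    by (simp add: mult_left_mono)
  moreover have "(chi_res P C)\<^sup>2 = (C * m)\<^sup>2 * real (C_patch P 1)"
    unfolding chi_res_def m_def[symmetric] by (simp add: power_mult_distrib)
  ultimately show ?thesis by (simp add: mult.assoc)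
qed

lemma chi_res_nonneg: 
  assumes "approximation_constant P C" shows "0 \<le> chi_res P C"
proof -
  obtain T where T: "T \<in> TH P" using H.mesh_nonempty by blast
  have "0 \<le> wavenumber P * diameter T" 
    using mult_nonneg_nonneg[OF less_imp_le[OF wavenumber_pos] diameter_ge_0[OF triangle_facts(10)[OF
        H.triangle[OF T]]]] .
  also have "\<dots> \<le> (MAX T\<in>TH P. wavenumber P * diameter T)" using H.finite_mesh T by (intro Max_ge) auto
  finally show ?thesis using assms by (simp add: chi_res_def approximation_constant_def)
qed

text \<open>
  The Robin term does not contribute to the real part, and \<open>c\<^sub>W\<close> is the constant for which \<open>g - l \<ge> c\<^sub>W (g + l)\<close>
  follows from \<open>l \<le> \<chi>\<^sup>2 g\<close>.
\<close>

lemma kernel_coercive: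
  assumes C: "approximation_constant P C" and chi: "chi_res P C < 1" and w: "w \<in> W_h P"
  shows "c_W P C * (knorm P w)\<^sup>2 \<le> Re (a_form P w w)"
proof -
  have wh: "w \<in> V_h P" using w W_h_sub by blast
  let ?x = "(chi_res P C)\<^sup>2" and ?g = "Re (grad_ip P \<Omega> w w)" and ?l = "(wavenumber P)\<^sup>2 * Re (L2_ip \<Omega> w w)"
  have b: "?l \<le> ?x * ?g" by (rule kernel_L2_bound[OF C w])
  have pos: "0 < 1 + ?x" by (simp add: add_pos_nonneg)
  \<comment> \<open>cleared of denominators, the claim is twice the previous bound\<close>
  have "(1 - ?x) * (?g + ?l) \<le> (1 + ?x) * (?g - ?l)" using b by (simp add: algebra_simps)
  then have "(1 - ?x) / (1 + ?x) * (?g + ?l) \<le> ?g - ?l" using pos by (simp add: field_simps)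
  then show ?thesis unfolding c_W_def knorm_square_split[OF wh] a_form_diagonal(1)[OF wh] .
qed

lemma c_W_pos:
  assumes "approximation_constant P C" "chi_res P C < 1" shows "0 < c_W P C"
proof -
  have "(chi_res P C)\<^sup>2 < 1" using chi_res_nonneg[OF assms(1)] assms(2) by (simp add: power_less_one_iff)
  then show ?thesis unfolding c_W_def by (intro divide_pos_pos) (auto simp: add_pos_nonneg)
qed

end

section \<open>Correctors, indicators and the error estimate\<close>

lemma quadratic_bound:
  fixes c x M :: real
  assumes "0 < c" "0 \<le> x" "0 \<le> M" "c * x\<^sup>2 \<le> M * x"
  shows "x \<le> M / c"
proof (cases "x = 0")
  case False
  then have "c * x \<le> M" using assms by (simp add: power2_eq_square)
  then show ?thesis using assms(1) by (simp add: field_simps)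
qed (use assms in simp)

locale helmholtz_constants = helmholtz_problem P for P :: helmholtz +
  fixes C_a C_app C_I C_sd C_syn :: real
  assumes C_a: "continuity_constant P C_a"
    and C_app: "approximation_constant P C_app"
    and C_I: "stability_constant P C_I"
    and C_sd: "stable_decomposition_constant P C_sd"
    and C_syn: "synthesis_constant P C_syn"
    and resolution: "chi_res P C_app < 1"
begin

abbreviation "cW \<equiv> c_W P C_app"

lemma cW_pos: "0 < cW" by (rule c_W_pos[OF C_app resolution])

lemma C_nonneg: "0 \<le> C_a" "0 \<le> C_I" "0 \<le> C_sd" "0 \<le> C_syn"
  using C_a C_I C_sd C_syn
  by (auto simp: continuity_constant_def stability_constant_def stable_decomposition_constant_def
      synthesis_constant_def)

lemma coercive: "w \<in> W_h P \<Longrightarrow> cW * (knorm P w)\<^sup>2 \<le> Re (a_form P w w)"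
  by (rule kernel_coercive[OF C_app resolution])

lemma continuity: "v \<in> V_h P \<Longrightarrow> w \<in> V_h P \<Longrightarrow> cmod (a_form P v w) \<le> C_a * knorm P v * knorm P w"
  using C_a fe_fine_sub_V unfolding continuity_constant_def by blast

lemma W_norm_bound:
  assumes w: "w \<in> W_h P" and M: "0 \<le> M" "cmod (a_form P w w) \<le> M * knorm P w"
  shows "knorm P w \<le> M / cW"
proof (rule quadratic_bound[OF cW_pos _ M(1)])
  show "0 \<le> knorm P w" using knorm_nonneg w W_h_sub by blast
  show "cW * (knorm P w)\<^sup>2 \<le> M * knorm P w"
    using coercive[OF w] M(2) complex_Re_le_cmod[of "a_form P w w"] by linarith
qed

text \<open>
  Coercivity makes \<open>a\<close> definite on the kernel, so that problems on arbitrary subspaces of it, in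
  particular all corrector problems, are uniquely solvable.
\<close>

lemma kernel_solution:
  assumes X: "fun_subspace X" "X \<subseteq> W_h P" and G: "antilinear_on X G"
  shows "\<exists>!q. q \<in> X \<and> (\<forall>w\<in>X. a_form P q w = G w)"
proof (rule form_representation[OF h.finite_vertices X(1) _ _ _ G])
  have XV: "X \<subseteq> V_h P" using X(2) W_h_sub by blast
  show "v = (\<lambda>_. 0)" if "v \<in> X" "\<forall>z\<in>vertices (Th P). v z = 0" for v
    using h.P1_unisolvent[of v] that XV fe_fine_P1 by blast
  show "sesq_on X (a_form P)" by (rule sesq_on_subset[OF a_form_sesq XV])
  show "v = (\<lambda>_. 0)" if v: "v \<in> X" "a_form P v v = 0" for v
  proof (rule knorm_eq_0)
    show vh: "v \<in> V_h P" using v XV by blast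
    have "knorm P v \<le> 0 / cW" by (rule W_norm_bound) (use v X(2) in auto)
    then show "knorm P v = 0" using knorm_nonneg[OF vh] by simp
  qed
qed

lemma W_patch_subspace: "fun_subspace (W_patch P l T)" "W_patch P l T \<subseteq> W_h P"
proof -
  show "W_patch P l T \<subseteq> W_h P" by (auto simp: W_patch_def)
  have "supp P (\<lambda>x. u x + v x) \<subseteq> supp P u \<union> supp P v" for u v
    unfolding supp_def closure_Un[symmetric] by (rule closure_mono) auto
  moreover have "supp P (\<lambda>x. c * u x) \<subseteq> supp P u" for c u
    unfolding supp_def by (rule closure_mono) auto
  moreover have "supp P (\<lambda>_. 0) = {}" by (simp add: supp_def)
  ultimately show "fun_subspace (W_patch P l T)"
    using fun_subspaceD(1-3)[OF W_h_subspace] unfolding fun_subspace_def W_patch_def by blast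
qed

lemma W_node_subspace: "fun_subspace (W_node P z)" "W_node P z \<subseteq> W_h P"
  using W_patch_subspace[of "enat 2" "{z}"] by (simp_all add: W_patch_def W_node_def)

lemma W_patch_cnj: "w \<in> W_patch P l T \<Longrightarrow> (\<lambda>x. cnj (w x)) \<in> W_patch P l T"
  using W_h_cnj by (simp add: W_patch_def supp_def)

lemma Q_inf: 
  assumes v: "v \<in> V_h P"
  shows "Q_inf P v \<in> W_h P" "w \<in> W_h P \<Longrightarrow> a_form P (Q_inf P v) w = a_form P v w"
  using theI'[OF kernel_solution[OF W_h_subspace order_refl antilinear_on_subset[OF sesq_on_antilinear[OF
      a_form_sesq v] W_h_sub]]]
  unfolding Q_inf_def[symmetric] by blast+

lemma q_loc: 
  assumes T: "T \<in> TH P" and v: "v \<in> V_h P"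
  shows "q_loc P l T v \<in> W_patch P l T" "w \<in> W_patch P l T \<Longrightarrow> a_form P (q_loc P l T v) w = a_loc P T v w"
  using theI'[OF kernel_solution[OF W_patch_subspace[of l T] antilinear_on_subset[OF sesq_on_antilinear[OF
      a_loc_sesq[OF T] v] order_trans[OF W_patch_subspace(2)[of l T] W_h_sub]]]]
  unfolding q_loc_def[symmetric] by blast+

text \<open>
  By the symmetry \<open>a_form_cnj\<close>, conjugation maps adjoint solutions to primal solutions for the conjugate
  data.
\<close>

lemma adjoint_solution_iff:
  assumes X: "X \<subseteq> V_h P" "\<And>w. w \<in> X \<Longrightarrow> (\<lambda>x. cnj (w x)) \<in> X"
    and g: "\<And>w. w \<in> X \<Longrightarrow> g (\<lambda>x. cnj (v x)) (\<lambda>x. cnj (w x)) = g w v"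
  shows "(q \<in> X \<and> (\<forall>w\<in>X. a_form P w q = g w v)) \<longleftrightarrow>
    ((\<lambda>x. cnj (q x)) \<in> X \<and> (\<forall>w\<in>X. a_form P (\<lambda>x. cnj (q x)) w = g (\<lambda>x. cnj (v x)) w))"
proof
  assume q: "q \<in> X \<and> (\<forall>w\<in>X. a_form P w q = g w v)"
  have "a_form P (\<lambda>x. cnj (q x)) w = g (\<lambda>x. cnj (v x)) w" if w: "w \<in> X" for w
  proof -
    have w': "(\<lambda>x. cnj (w x)) \<in> X" using X(2) w .
    have "a_form P (\<lambda>x. cnj (q x)) w = a_form P (\<lambda>x. cnj (w x)) q"
      using a_form_cnj[OF subsetD[OF X(1) w'] subsetD[OF X(1) conjunct1[OF q]]] by simp
    also have "\<dots> = g (\<lambda>x. cnj (w x)) v" using q w' by blast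
    also have "\<dots> = g (\<lambda>x. cnj (v x)) w" using g[OF w'] by simp
    finally show ?thesis .
  qed
  then show "(\<lambda>x. cnj (q x)) \<in> X \<and> (\<forall>w\<in>X. a_form P (\<lambda>x. cnj (q x)) w = g (\<lambda>x. cnj (v x)) w)"
    using q X(2) by blast
next
  assume q: "(\<lambda>x. cnj (q x)) \<in> X \<and> (\<forall>w\<in>X. a_form P (\<lambda>x. cnj (q x)) w = g (\<lambda>x. cnj (v x)) w)"
  have qX: "q \<in> X" using X(2)[OF conjunct1[OF q]] by simp
  have "a_form P w q = g w v" if w: "w \<in> X" for w
  proof -
    have w': "(\<lambda>x. cnj (w x)) \<in> X" using X(2) w .
    have "a_form P w q = a_form P (\<lambda>x. cnj (q x)) (\<lambda>x. cnj (w x))"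
      by (rule a_form_cnj[OF subsetD[OF X(1) w] subsetD[OF X(1) qX], symmetric])
    also have "\<dots> = g (\<lambda>x. cnj (v x)) (\<lambda>x. cnj (w x))" using q w' by blast
    also have "\<dots> = g w v" by (rule g[OF w])
    finally show ?thesis .
  qed
  then show "q \<in> X \<and> (\<forall>w\<in>X. a_form P w q = g w v)" using qX by blast
qed

lemma THE_cnj:
  fixes R :: "('a \<Rightarrow> complex) \<Rightarrow> bool"
  assumes "\<exists>!p. R p"
  shows "(THE q. R (\<lambda>x. cnj (q x))) = (\<lambda>x. cnj ((THE p. R p) x))"
proof (rule the_equality)
  show "R (\<lambda>x. cnj (cnj ((THE p. R p) x)))" using theI'[OF assms] by simp
  show "q = (\<lambda>x. cnj ((THE p. R p) x))" if q: "R (\<lambda>x. cnj (q x))" for q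
    using the1_equality[where P=R, OF assms q] by simp
qed

lemma Q_inf_adj_cnj:
  assumes v: "v \<in> V_h P"
  shows "Q_inf_adj P v = (\<lambda>x. cnj (Q_inf P (\<lambda>x. cnj (v x)) x))"
proof -
  have v': "(\<lambda>x. cnj (v x)) \<in> V_h P" by (rule fe_cnj(1)[OF v])
  have "(q \<in> W_h P \<and> (\<forall>w\<in>W_h P. a_form P w q = a_form P w v)) \<longleftrightarrow>
    ((\<lambda>x. cnj (q x)) \<in> W_h P \<and> (\<forall>w\<in>W_h P. a_form P (\<lambda>x. cnj (q x)) w = a_form P (\<lambda>x. cnj (v x)) w))" for q
  proof (rule adjoint_solution_iff[OF W_h_sub W_h_cnj])
    show "a_form P (\<lambda>x. cnj (v x)) (\<lambda>x. cnj (w x)) = a_form P w v" if "w \<in> W_h P" for w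
      by (rule a_form_cnj[OF subsetD[OF W_h_sub that] v])
  qed assumption
  then show ?thesis unfolding Q_inf_adj_def Q_inf_def
    by (simp only:) (rule THE_cnj[OF kernel_solution[OF W_h_subspace order_refl antilinear_on_subset[OF
        sesq_on_antilinear[OF a_form_sesq v'] W_h_sub]]])
qed

lemma q_loc_adj_cnj:
  assumes T: "T \<in> TH P" and v: "v \<in> V_h P"
  shows "q_loc_adj P l T v = (\<lambda>x. cnj (q_loc P l T (\<lambda>x. cnj (v x)) x))"
proof -
  have v': "(\<lambda>x. cnj (v x)) \<in> V_h P" by (rule fe_cnj(1)[OF v])
  have sub: "W_patch P l T \<subseteq> V_h P" using W_patch_subspace(2) W_h_sub by blast
  have "(q \<in> W_patch P l T \<and> (\<forall>w\<in>W_patch P l T. a_form P w q = a_loc P T w v)) \<longleftrightarrow>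
    ((\<lambda>x. cnj (q x)) \<in> W_patch P l T \<and> (\<forall>w\<in>W_patch P l T. a_form P (\<lambda>x. cnj (q x)) w
        = a_loc P T (\<lambda>x. cnj (v x)) w))" for q
  proof (rule adjoint_solution_iff[OF sub W_patch_cnj])
    show "a_loc P T (\<lambda>x. cnj (v x)) (\<lambda>x. cnj (w x)) = a_loc P T w v" if "w \<in> W_patch P l T" for w
      by (rule a_loc_cnj[OF T subsetD[OF sub that] v])
  qed assumption
  then show ?thesis unfolding q_loc_adj_def q_loc_def
    by (simp only:) (rule THE_cnj[OF kernel_solution[OF W_patch_subspace antilinear_on_subset[OF
        sesq_on_antilinear[OF a_loc_sesq[OF T] v'] sub]]])
qed

lemma Q_loc_adj_cnj:
  assumes v: "v \<in> V_h P"
  shows "Q_loc_adj P l v = (\<lambda>x. cnj (Q_loc P l (\<lambda>x. cnj (v x)) x))"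
  unfolding Q_loc_adj_def Q_loc_def using q_loc_adj_cnj[OF _ v] by simp

lemma defect_adj_cnj:
  assumes v: "v \<in> V_h P"
  shows "defect_adj P l v = (\<lambda>x. cnj (defect P l (\<lambda>x. cnj (v x)) x))"
  unfolding defect_adj_def defect_def Q_inf_adj_cnj[OF v] Q_loc_adj_cnj[OF v] by simp

lemma Q_loc_in: "v \<in> V_h P \<Longrightarrow> Q_loc P l v \<in> W_h P"
  unfolding Q_loc_def
  using q_loc(1) W_patch_subspace(2) by (intro fun_subspace_sum[OF W_h_subspace H.finite_mesh]) blast

lemma defect_in: "v \<in> V_h P \<Longrightarrow> defect P l v \<in> W_h P"
  unfolding defect_def by (rule fun_subspaceD(4)[OF W_h_subspace Q_inf(1) Q_loc_in])

lemma adjoint_in: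
  assumes v: "v \<in> V_h P"
  shows "Q_inf_adj P v \<in> W_h P" "Q_loc_adj P l v \<in> W_h P" "defect_adj P l v \<in> W_h P"
  unfolding Q_inf_adj_cnj[OF v] Q_loc_adj_cnj[OF v] defect_adj_cnj[OF v]
  by (intro W_h_cnj Q_inf(1) Q_loc_in defect_in fe_cnj(1) v)+

lemma Q_inf_adj:
  assumes v: "v \<in> V_h P" and w: "w \<in> W_h P"
  shows "a_form P w (Q_inf_adj P v) = a_form P w v"
proof -
  have v': "(\<lambda>x. cnj (v x)) \<in> V_h P" by (rule fe_cnj(1)[OF v])
  have wh: "w \<in> V_h P" using w W_h_sub by blast
  have q: "Q_inf P (\<lambda>x. cnj (v x)) \<in> V_h P" using Q_inf(1)[OF v'] W_h_sub by blast
  have "a_form P w (Q_inf_adj P v) = a_form P (Q_inf P (\<lambda>x. cnj (v x))) (\<lambda>x. cnj (w x))"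
    unfolding Q_inf_adj_cnj[OF v] using a_form_cnj[OF wh fe_cnj(1)[OF q]] by simp
  also have "\<dots> = a_form P (\<lambda>x. cnj (v x)) (\<lambda>x. cnj (w x))" by (rule Q_inf(2)[OF v' W_h_cnj[OF w]])
  also have "\<dots> = a_form P w v" by (rule a_form_cnj[OF wh v])
  finally show ?thesis .
qed

text \<open>
  A bound with a constant independent of the function; it serves to show that the suprema
  defining \<open>\<delta>\<^sub>\<ell>\<close> and \<open>\<Theta>\<^sub>\<ell>\<close> are taken over bounded sets of reals and hence are upper bounds.
\<close>

lemma defect_bound: "\<exists>C\<ge>0. \<forall>v\<in>V_h P. knorm P (Q_loc P l v) \<le> C * knorm P v \<and> knorm P (defect P l v) \<le> C * knorm P v"
proof -
  define n where "n = real (card (TH P))"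
  define C where "C = C_a / cW + n * ((2 + C_a) / cW)"
  have n0: "0 \<le> n * ((2 + C_a) / cW)" "0 \<le> C_a / cW" using cW_pos C_nonneg by (auto simp: n_def)
  have C0: "0 \<le> C" unfolding C_def using n0 by simp
  have "knorm P (Q_loc P l v) \<le> C * knorm P v \<and> knorm P (defect P l v) \<le> C * knorm P v" if v: "v \<in> V_h P" for v
  proof -
    note kv = knorm_nonneg[OF v]
    have qin: "q_loc P l T v \<in> W_h P" if "T \<in> TH P" for T using q_loc(1)[OF that v] W_patch_subspace(2) by blast
    have ql: "knorm P (q_loc P l T v) \<le> (2 + C_a) * knorm P v / cW" if T: "T \<in> TH P" for T
    proof (rule W_norm_bound[OF qin[OF T]])
      show "0 \<le> (2 + C_a) * knorm P v" using kv C_nonneg by simp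
      show "cmod (a_form P (q_loc P l T v) (q_loc P l T v)) \<le> (2 + C_a) * knorm P v * knorm P (q_loc P l T v)"
        unfolding q_loc(2)[OF T v q_loc(1)[OF T v]] using a_loc_bound[OF C_a T v] qin[OF T] W_h_sub by blast
    qed
    have "knorm P (Q_loc P l v) \<le> (\<Sum>T\<in>TH P. knorm P (q_loc P l T v))"
      unfolding Q_loc_def using qin W_h_sub by (intro knorm_sum H.finite_mesh) blast
    also have "\<dots> \<le> (\<Sum>T\<in>TH P. (2 + C_a) * knorm P v / cW)" by (intro sum_mono ql)
    also have "\<dots> = n * ((2 + C_a) / cW) * knorm P v" by (simp add: n_def)
    finally have Q: "knorm P (Q_loc P l v) \<le> n * ((2 + C_a) / cW) * knorm P v" .
    have "knorm P (Q_inf P v) \<le> C_a * knorm P v / cW"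
    proof (rule W_norm_bound[OF Q_inf(1)[OF v]])
      show "0 \<le> C_a * knorm P v" using kv C_nonneg by simp
      show "cmod (a_form P (Q_inf P v) (Q_inf P v)) \<le> C_a * knorm P v * knorm P (Q_inf P v)"
        unfolding Q_inf(2)[OF v Q_inf(1)[OF v]] using continuity[OF v] Q_inf(1)[OF v] W_h_sub by blast
    qed
    moreover have "knorm P (defect P l v) \<le> knorm P (Q_inf P v) + knorm P (Q_loc P l v)"
      unfolding defect_def using Q_inf(1)[OF v] Q_loc_in[OF v] W_h_sub by (intro knorm_diff) blast+
    ultimately have "knorm P (defect P l v) \<le> C * knorm P v" using Q by (simp add: C_def algebra_simps)
    moreover have "n * ((2 + C_a) / cW) * knorm P v \<le> C * knorm P v"
      using n0 kv by (intro mult_right_mono) (auto simp: C_def)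
    ultimately show ?thesis using Q by simp
  qed
  then show ?thesis using C0 by blast
qed

lemma bdd_above_defect: "bdd_above ((\<lambda>v. knorm P (defect P l v) / knorm P v) ` V_H P)"
proof -
  obtain C where C: "0 \<le> C" "\<And>v. v \<in> V_h P \<Longrightarrow> knorm P (defect P l v) \<le> C * knorm P v"
    using defect_bound by blast
  show ?thesis
  proof (rule bdd_aboveI2)
    fix v assume "v \<in> V_H P"
    then have "v \<in> V_h P" using fe_coarse_fine by blast
    then show "knorm P (defect P l v) / knorm P v \<le> C"
      using C knorm_nonneg[of v] by (cases "knorm P v = 0") (auto simp: divide_le_eq)
  qed
qed

lemma zero_in_V_H: "(\<lambda>_. 0) \<in> V_H P"
  by (rule fun_subspaceD(1)[OF fe_coarse_subspace])

lemma delta_nonneg: "0 \<le> delta P l"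
  using cSUP_upper[OF zero_in_V_H bdd_above_defect] by (simp add: delta_def op_norm_VH_def knorm_zero)

text \<open>
  Conjugation carries the adjoint defect of \<open>v\<close> to the primal defect of the conjugate of \<open>v\<close> and
  preserves the norms.
\<close>

lemma defect_adj_le_delta:
  assumes v: "v \<in> V_H P"
  shows "knorm P (defect_adj P l v) \<le> delta P l * knorm P v"
proof -
  have vh: "v \<in> V_h P" using v fe_coarse_fine by blast
  define u where "u = (\<lambda>x. cnj (v x))"
  have u: "u \<in> V_H P" "u \<in> V_h P" using fe_cnj v vh by (auto simp: u_def)
  have ku: "knorm P u = knorm P v" unfolding u_def by (rule knorm_cnj[OF vh])
  have du: "defect P l u \<in> V_h P" using defect_in[OF u(2)] W_h_sub by blast
  have eq: "knorm P (defect_adj P l v) = knorm P (defect P l u)"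
    unfolding defect_adj_cnj[OF vh] u_def[symmetric] by (rule knorm_cnj[OF du])
  obtain C where C: "0 \<le> C" "\<And>v. v \<in> V_h P \<Longrightarrow> knorm P (defect P l v) \<le> C * knorm P v"
    using defect_bound by blast
  have le: "knorm P (defect P l u) / knorm P u \<le> delta P l"
    unfolding delta_def op_norm_VH_def by (rule cSUP_upper[OF u(1) bdd_above_defect])
  show ?thesis
  proof (cases "knorm P u = 0")
    case True
    then show ?thesis using C(2)[OF u(2)] knorm_nonneg[OF du] unfolding eq ku[symmetric] by simp
  next
    case False
    then have "0 < knorm P u" using knorm_nonneg[OF u(2)] by simp
    then show ?thesis using le unfolding eq ku[symmetric] by (simp add: divide_le_eq)
  qed
qed

lemma xi:
  assumes G: "antilinear_on (V_h P) G"
  shows "xi P z G \<in> W_node P z" "w \<in> W_node P z \<Longrightarrow> b_form P (xi P z G) w = G w"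
proof -
  have sub: "W_node P z \<subseteq> V_h P" using W_node_subspace(2) W_h_sub by blast
  have "\<exists>!q. q \<in> W_node P z \<and> (\<forall>w\<in>W_node P z. b_form P q w = G w)"
  proof (rule form_representation[OF h.finite_vertices W_node_subspace(1) _ _ _ antilinear_on_subset[OF G sub]])
    show "v = (\<lambda>_. 0)" if "v \<in> W_node P z" "\<forall>z\<in>vertices (Th P). v z = 0" for v
      using h.P1_unisolvent[of v] that sub fe_fine_P1 by blast
    show "sesq_on (W_node P z) (b_form P)" by (rule sesq_on_subset[OF psd_onD(1)[OF b_form_psd_fe] sub])
    show "v = (\<lambda>_. 0)" if "v \<in> W_node P z" "b_form P v v = 0" for v
      using b_form_definite[of v] that sub by blast
  qed
  from theI'[OF this] show "xi P z G \<in> W_node P z" "w \<in> W_node P z \<Longrightarrow> b_form P (xi P z G) w = G w"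
    unfolding xi_def[symmetric] by blast+
qed

lemma eta_nonneg: "0 \<le> eta P G" by (simp add: eta_def sum_nonneg)

text \<open>
  The functional splits along the stable decomposition, each piece is an inner product with
  the local Riesz representative, and the Cauchy-Schwarz inequality for sums collects the pieces.
\<close>

lemma eta_reliable:
  assumes G: "antilinear_on (V_h P) G" and w: "w \<in> W_h P"
  shows "cmod (G w) \<le> C_sd * eta P G * knorm P w"
proof -
  let ?Z = "vertices (TH P)"
  obtain f where f: "\<And>z. z \<in> ?Z \<Longrightarrow> f z \<in> W_node P z" "w = (\<lambda>x. \<Sum>z\<in>?Z. f z x)"
    "(\<Sum>z\<in>?Z. (knorm P (f z))\<^sup>2) \<le> C_sd\<^sup>2 * (knorm P w)\<^sup>2"
    using C_sd w unfolding stable_decomposition_constant_def by blast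
  have sub: "W_node P z \<subseteq> V_h P" for z using W_node_subspace(2) W_h_sub by blast
  have fz: "f z \<in> V_h P" if "z \<in> ?Z" for z using f(1)[OF that] sub by blast
  have xz: "xi P z G \<in> V_h P" for z using xi(1)[OF G] sub by blast
  have "G w = (\<Sum>z\<in>?Z. G (f z))"
    unfolding f(2) by (rule antilinear_on_sum[OF fe_fine_subspace G H.finite_vertices fz])
  also have "\<dots> = (\<Sum>z\<in>?Z. b_form P (xi P z G) (f z))"
    by (rule sum.cong[OF refl]) (rule xi(2)[OF G f(1), symmetric])
  finally have "cmod (G w) \<le> (\<Sum>z\<in>?Z. cmod (b_form P (xi P z G) (f z)))" by (simp add: norm_sum)
  also have "\<dots> \<le> (\<Sum>z\<in>?Z. \<bar>knorm P (xi P z G)\<bar> * \<bar>knorm P (f z)\<bar>)"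
    using b_form_Cauchy_Schwarz[OF xz fz] knorm_nonneg[OF xz] knorm_nonneg[OF fz] by (intro sum_mono) simp
  also have "\<dots> \<le> L2_set (\<lambda>z. knorm P (xi P z G)) ?Z * L2_set (\<lambda>z. knorm P (f z)) ?Z"
    by (rule L2_set_mult_ineq)
  also have "\<dots> = eta P G * L2_set (\<lambda>z. knorm P (f z)) ?Z" by (simp add: L2_set_def eta_def)
  also have "\<dots> \<le> eta P G * (C_sd * knorm P w)"
  proof (rule mult_left_mono[OF _ eta_nonneg])
    have "L2_set (\<lambda>z. knorm P (f z)) ?Z \<le> sqrt (C_sd\<^sup>2 * (knorm P w)\<^sup>2)"
      unfolding L2_set_def using f(3) by (rule real_sqrt_le_mono)
    also have "\<dots> = C_sd * knorm P w" using C_nonneg(3) knorm_nonneg[OF subsetD[OF W_h_sub w]]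
        by (simp add: real_sqrt_mult)
    finally show "L2_set (\<lambda>z. knorm P (f z)) ?Z \<le> C_sd * knorm P w" .
  qed
  finally show ?thesis by (simp add: mult_ac)
qed

text \<open>
  Testing the functional with the sum of its local Riesz representatives yields \<open>\<eta>\<^sup>2\<close>, and the norm of
  this sum is at most \<open>C\<^sub>s\<^sub>y\<^sub>n \<eta>\<close>.
\<close>

lemma eta_efficient:
  assumes G: "antilinear_on (V_h P) G" and M: "0 \<le> M" "\<And>w. w \<in> V_h P \<Longrightarrow> cmod (G w) \<le> M * knorm P w"
  shows "eta P G \<le> M * C_syn"
proof -
  let ?Z = "vertices (TH P)"
  let ?x = "\<lambda>z. xi P z G"
  have sub: "W_node P z \<subseteq> V_h P" for z using W_node_subspace(2) W_h_sub by blast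
  have xz: "?x z \<in> V_h P" for z using xi(1)[OF G] sub by blast
  let ?s = "\<lambda>x. \<Sum>z\<in>?Z. ?x z x"
  have s: "?s \<in> V_h P" using xz by (intro fun_subspace_sum[OF fe_fine_subspace H.finite_vertices])
  have sq: "(eta P G)\<^sup>2 = (\<Sum>z\<in>?Z. (knorm P (?x z))\<^sup>2)" by (simp add: eta_def sum_nonneg)
  have "complex_of_real ((eta P G)\<^sup>2) = (\<Sum>z\<in>?Z. b_form P (?x z) (?x z))"
    unfolding sq of_real_sum knorm_square[OF xz]
    by (rule sum.cong[OF refl]) (rule psd_on_Re(1)[OF b_form_psd_fe xz, symmetric])
  also have "\<dots> = (\<Sum>z\<in>?Z. G (?x z))" by (rule sum.cong[OF refl]) (rule xi(2)[OF G xi(1)[OF G]])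
  also have "\<dots> = G ?s" by (rule antilinear_on_sum[OF fe_fine_subspace G H.finite_vertices xz, symmetric])
  finally have "(eta P G)\<^sup>2 = cmod (G ?s)" by (metis norm_of_real abs_of_nonneg zero_le_power2)
  also have "\<dots> \<le> M * knorm P ?s" by (rule M(2)[OF s])
  also have "\<dots> \<le> M * (C_syn * eta P G)"
  proof (rule mult_left_mono[OF _ M(1)])
    have "(knorm P ?s)\<^sup>2 \<le> C_syn\<^sup>2 * (\<Sum>z\<in>?Z. (knorm P (?x z))\<^sup>2)"
    proof -
      have "\<forall>z\<in>?Z. ?x z \<in> W_node P z" using xi(1)[OF G] by blast
      then show ?thesis using C_syn unfolding synthesis_constant_def by (elim conjE allE[of _ ?x]) simp
    qed
    then have "(knorm P ?s)\<^sup>2 \<le> (C_syn * eta P G)\<^sup>2" by (simp add: sq power_mult_distrib)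
    then show "knorm P ?s \<le> C_syn * eta P G"
      by (rule power2_le_imp_le[OF _ mult_nonneg_nonneg[OF C_nonneg(4) eta_nonneg]])
  qed
  finally have "1 * (eta P G)\<^sup>2 \<le> M * C_syn * eta P G" by (simp add: mult_ac)
  then show ?thesis using quadratic_bound[of 1 "eta P G" "M * C_syn"] eta_nonneg[of G] M(1) C_nonneg(4) by simp
qed

lemma G_loc_antilinear:
  assumes v: "v \<in> V_h P"
  shows "antilinear_on (V_h P) (G_loc P l v)" "T_adj P l v \<in> V_h P"
proof -
  show t: "T_adj P l v \<in> V_h P"
    unfolding T_adj_def using fun_subspaceD(4)[OF fe_fine_subspace v] adjoint_in(2)[OF v] W_h_sub by blast
  show "antilinear_on (V_h P) (G_loc P l v)"
    unfolding G_loc_def by (rule sesq_on_antilinear_cnj[OF a_form_sesq t])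
qed

lemma eta_G_loc_bound: "\<exists>C\<ge>0. \<forall>v\<in>V_h P. eta P (G_loc P l v) \<le> C * knorm P v"
proof -
  obtain C where C: "0 \<le> C" "\<And>v. v \<in> V_h P \<Longrightarrow> knorm P (Q_loc P l v) \<le> C * knorm P v"
    using defect_bound by blast
  have "eta P (G_loc P l v) \<le> C_a * (1 + C) * C_syn * knorm P v" if v: "v \<in> V_h P" for v
  proof -
    have kQ: "knorm P (Q_loc_adj P l v) \<le> C * knorm P v"
    proof -
      have v': "(\<lambda>x. cnj (v x)) \<in> V_h P" by (rule fe_cnj(1)[OF v])
      have "Q_loc P l (\<lambda>x. cnj (v x)) \<in> V_h P" using Q_loc_in[OF v'] W_h_sub by blast
      then show ?thesis unfolding Q_loc_adj_cnj[OF v]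
        using C(2)[OF v'] knorm_cnj v by simp
    qed
    have "knorm P (T_adj P l v) \<le> knorm P v + knorm P (Q_loc_adj P l v)"
      unfolding T_adj_def using adjoint_in(2)[OF v] W_h_sub by (intro knorm_diff v) blast
    then have T: "knorm P (T_adj P l v) \<le> (1 + C) * knorm P v" using kQ by (simp add: algebra_simps)
    have "eta P (G_loc P l v) \<le> (C_a * ((1 + C) * knorm P v)) * C_syn"
    proof (rule eta_efficient[OF G_loc_antilinear(1)[OF v]])
      show "0 \<le> C_a * ((1 + C) * knorm P v)" using C_nonneg(1) C(1) knorm_nonneg[OF v] by simp
      fix w assume w: "w \<in> V_h P"
      have "cmod (G_loc P l v w) \<le> C_a * knorm P w * knorm P (T_adj P l v)"
        unfolding G_loc_def complex_mod_cnj by (rule continuity[OF w G_loc_antilinear(2)[OF v]])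
      also have "\<dots> \<le> C_a * knorm P w * ((1 + C) * knorm P v)"
        using C_nonneg(1) knorm_nonneg[OF w] T by (intro mult_left_mono) auto
      finally show "cmod (G_loc P l v w) \<le> C_a * ((1 + C) * knorm P v) * knorm P w" by (simp add: mult_ac)
    qed
    then show ?thesis by (simp add: mult_ac)
  qed
  moreover have "0 \<le> C_a * (1 + C) * C_syn" using C_nonneg C(1) by simp
  ultimately show ?thesis by blast
qed

lemma bdd_above_eta: "bdd_above ((\<lambda>v. eta P (G_loc P l v) / knorm P v) ` V_H P)"
proof -
  obtain C where C: "0 \<le> C" "\<And>v. v \<in> V_h P \<Longrightarrow> eta P (G_loc P l v) \<le> C * knorm P v"
    using eta_G_loc_bound by blast
  show ?thesis
  proof (rule bdd_aboveI2)
    fix v assume "v \<in> V_H P"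
    then have "v \<in> V_h P" using fe_coarse_fine by blast
    then show "eta P (G_loc P l v) / knorm P v \<le> C"
      using C knorm_nonneg[of v] by (cases "knorm P v = 0") (auto simp: divide_le_eq)
  qed
qed

lemma Theta_nonneg: "0 \<le> Theta P l"
  using cSUP_upper[OF zero_in_V_H bdd_above_eta] by (simp add: Theta_def knorm_zero)

text \<open>
  The ideal adjoint corrector reproduces \<open>a(w, v)\<close> for kernel functions \<open>w\<close>, so the defect \<open>d\<close> satisfies
  \<open>a(w, d) = a(w, T\<^sub>\<ell>\<^sup>* v)\<close>, which is the conjugate of \<open>G\<^sub>\<ell>(v)(w)\<close>. Take \<open>w = d\<close> and use coercivity.
\<close>

lemma defect_adj_le_Theta:
  assumes v: "v \<in> V_H P"
  shows "knorm P (defect_adj P l v) \<le> C_sd / cW * Theta P l * knorm P v"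
proof -
  have vh: "v \<in> V_h P" using v fe_coarse_fine by blast
  let ?d = "defect_adj P l v"
  have d: "?d \<in> W_h P" by (rule adjoint_in(3)[OF vh])
  note dh = subsetD[OF W_h_sub d]
  have Q: "Q_inf_adj P v \<in> V_h P" "Q_loc_adj P l v \<in> V_h P" using adjoint_in[OF vh] W_h_sub by blast+
  obtain C where eta_le: "eta P (G_loc P l v) \<le> C * knorm P v"
    using eta_G_loc_bound vh by blast
  have "eta P (G_loc P l v) / knorm P v \<le> Theta P l"
    unfolding Theta_def by (rule cSUP_upper[OF v bdd_above_eta])
  then have eta: "eta P (G_loc P l v) \<le> Theta P l * knorm P v"
    using eta_le eta_nonneg[of "G_loc P l v"] knorm_nonneg[OF vh] by (cases "knorm P v = 0") (auto simp: divide_le_eq)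
  have "a_form P ?d ?d = a_form P ?d (Q_inf_adj P v) - a_form P ?d (Q_loc_adj P l v)"
    using sesq_on_diff(2)[OF fe_fine_subspace a_form_sesq Q dh] unfolding defect_adj_def .
  also have "\<dots> = a_form P ?d v - a_form P ?d (Q_loc_adj P l v)" by (simp only: Q_inf_adj[OF vh d])
  also have "\<dots> = a_form P ?d (T_adj P l v)"
    using sesq_on_diff(2)[OF fe_fine_subspace a_form_sesq vh Q(2) dh] unfolding T_adj_def by (rule sym)
  finally have "cmod (a_form P ?d ?d) = cmod (G_loc P l v ?d)" by (simp add: G_loc_def)
  also have "\<dots> \<le> C_sd * eta P (G_loc P l v) * knorm P ?d" by (rule eta_reliable[OF G_loc_antilinear(1)[OF vh] d])
  finally have "knorm P ?d \<le> C_sd * eta P (G_loc P l v) / cW"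
    by (intro W_norm_bound[OF d]) (use C_nonneg(3) eta_nonneg in auto)
  also have "\<dots> \<le> C_sd * (Theta P l * knorm P v) / cW"
    using eta C_nonneg(3) cW_pos by (intro divide_right_mono mult_left_mono) auto
  finally show ?thesis by (simp add: mult_ac)
qed

text \<open>
  The inner suprema are at most \<open>C\<^sub>a\<close> by continuity and nonnegative, which makes the infimum over them a
  genuine lower bound.
\<close>

lemma inf_sup_bound:
  assumes v: "v \<in> V_h P" and M: "0 \<le> M" "\<And>w. w \<in> V_h P \<Longrightarrow> cmod (a_form P v w) \<le> M * knorm P w"
  shows "inf_sup P * knorm P v \<le> M"
proof (cases "v = (\<lambda>_. 0)")
  case True then show ?thesis using M(1) knorm_zero by simp
next
  case False
  let ?X = "V_h P - {\<lambda>_. 0}"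
  let ?q = "\<lambda>v w. cmod (a_form P v w) / (knorm P v * knorm P w)"
  have pos: "0 < knorm P u" if "u \<in> ?X" for u
    using knorm_nonneg[of u] knorm_eq_0[of u] that by fastforce
  have vX: "v \<in> ?X" using v False by blast
  have bdd: "bdd_above (?q u ` ?X)" if u: "u \<in> ?X" for u
  proof (rule bdd_aboveI2)
    fix w assume w: "w \<in> ?X"
    have "cmod (a_form P u w) \<le> C_a * (knorm P u * knorm P w)" using continuity[of u w] u w by (simp add: mult.assoc)
    then show "?q u w \<le> C_a" using pos[OF u] pos[OF w] by (simp add: divide_le_eq)
  qed
  have "bdd_below ((\<lambda>u. SUP w\<in>?X. ?q u w) ` ?X)"
  proof (rule bdd_belowI2)
    fix u assume u: "u \<in> ?X"
    have "0 \<le> ?q u u" using pos[OF u] by simp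
    also have "\<dots> \<le> (SUP w\<in>?X. ?q u w)" by (rule cSUP_upper[OF u bdd[OF u]])
    finally show "0 \<le> (SUP w\<in>?X. ?q u w)" .
  qed
  from cINF_lower[OF this vX] have "inf_sup P \<le> (SUP w\<in>?X. ?q v w)" by (simp add: inf_sup_def)
  also have "\<dots> \<le> M / knorm P v"
  proof (rule cSUP_least)
    show "?X \<noteq> {}" using vX by blast
    fix w assume w: "w \<in> ?X"
    have "?q v w \<le> (M * knorm P w) / (knorm P v * knorm P w)"
      using M(2)[of w] w pos[OF w] pos[OF vX] by (intro divide_right_mono) auto
    also have "\<dots> = M / knorm P v" using pos[OF w] by simp
    finally show "?q v w \<le> M / knorm P v" .
  qed
  finally show ?thesis using pos[OF vX] by (simp add: field_simps)
qed

context
  fixes F u_h U l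
  assumes gamma: "0 < inf_sup P" and F: "F \<in> antidual P (V P)" and u_h: "galerkin_solution P F u_h"
    and U: "U \<in> V_h P" and R0: "\<forall>y\<in>Y_H P l. residual P F U y = 0"
begin

lemma residual_antilinear: "antilinear_on (V_h P) (residual P F U)"
proof -
  have "antilinear_on (V P) F" using F by (auto simp: antidual_def antilinear_on_def)
  then have "antilinear_on (V_h P) F" by (rule antilinear_on_subset[OF _ fe_fine_sub_V])
  moreover have "antilinear_on (V_h P) (a_form P U)" by (rule sesq_on_antilinear[OF a_form_sesq U])
  ultimately show ?thesis unfolding antilinear_on_def residual_def by (simp add: algebra_simps)
qed

lemma error_in: "u_h \<in> V_h P" "(\<lambda>x. u_h x - U x) \<in> V_h P"
  using u_h fun_subspaceD(4)[OF fe_fine_subspace _ U] by (auto simp: galerkin_solution_def)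

lemma error_residual:
  assumes w: "w \<in> V_h P" shows "a_form P (\<lambda>x. u_h x - U x) w = residual P F U w"
  using sesq_on_diff(1)[OF fe_fine_subspace a_form_sesq error_in(1) U w] u_h w
  by (simp add: galerkin_solution_def residual_def)

lemma efficiency: "eta_H P F U \<le> C_a * C_syn * knorm P (\<lambda>x. u_h x - U x)"
proof -
  have "eta P (residual P F U) \<le> C_a * knorm P (\<lambda>x. u_h x - U x) * C_syn"
  proof (rule eta_efficient[OF residual_antilinear])
    show "0 \<le> C_a * knorm P (\<lambda>x. u_h x - U x)" using C_nonneg(1) knorm_nonneg[OF error_in(2)] by simp
    show "cmod (residual P F U w) \<le> C_a * knorm P (\<lambda>x. u_h x - U x) * knorm P w" if "w \<in> V_h P" for w
      unfolding error_residual[OF that, symmetric] by (rule continuity[OF error_in(2) that])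
  qed
  then show ?thesis by (simp add: eta_H_def mult_ac)
qed

text \<open>
  The splitting of the error into a kernel part and an \<open>a\<close>-orthogonal remainder described at the
  beginning, for any bound \<open>D\<close> on the adjoint defect.
\<close>

lemma reliability:
  assumes D: "0 \<le> D" "\<And>v. v \<in> V_H P \<Longrightarrow> knorm P (defect_adj P l v) \<le> D * knorm P v"
  shows "knorm P (\<lambda>x. u_h x - U x) \<le> C_sd * (inverse cW + C_I / inf_sup P * D) * eta_H P F U"
proof -
  let ?R = "residual P F U" and ?eta = "eta_H P F U"
  define e where "e = (\<lambda>x. u_h x - U x)"
  note e = error_in(2)[folded e_def]
  note ae = error_residual[folded e_def]
  \<comment> \<open>the kernel part of the error, with respect to the form \<open>a\<close>\<close>
  define q where "q = Q_inf P e"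
  have q: "q \<in> W_h P" "q \<in> V_h P" using Q_inf(1)[OF e] W_h_sub by (auto simp: q_def)
  have eta0: "0 \<le> ?eta" unfolding eta_H_def by (rule eta_nonneg)
  have rel: "cmod (?R w) \<le> C_sd * ?eta * knorm P w" if "w \<in> W_h P" for w
    unfolding eta_H_def by (rule eta_reliable[OF residual_antilinear that])
  have kq: "knorm P q \<le> C_sd * ?eta / cW"
  proof (rule W_norm_bound[OF q(1)])
    show "0 \<le> C_sd * ?eta" using C_nonneg(3) eta0 by simp
    have "a_form P q q = ?R q" using Q_inf(2)[OF e q(1)] ae[OF q(2)] by (simp add: q_def)
    then show "cmod (a_form P q q) \<le> C_sd * ?eta * knorm P q" using rel[OF q(1)] by simp
  qed
  define r where "r = (\<lambda>x. e x - q x)"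
  have r: "r \<in> V_h P" unfolding r_def by (rule fun_subspaceD(4)[OF fe_fine_subspace e q(2)])
  have r_diff: "a_form P r w = a_form P e w - a_form P q w" if "w \<in> V_h P" for w
    unfolding r_def by (rule sesq_on_diff(1)[OF fe_fine_subspace a_form_sesq e q(2) that])
  have rW: "a_form P r w = 0" if "w \<in> W_h P" for w
    using r_diff[OF subsetD[OF W_h_sub that]] Q_inf(2)[OF e that] by (simp add: q_def)
  have "cmod (a_form P r v) \<le> (C_sd * ?eta * (D * C_I)) * knorm P v" if v: "v \<in> V_h P" for v
  proof -
    define g where "g = I_H P v"
    have g: "g \<in> V_H P" "g \<in> V_h P" using I_H_in_V_H fe_coarse_fine by (auto simp: g_def)
    have Qs: "Q_inf_adj P g \<in> W_h P" "Q_loc_adj P l g \<in> W_h P" "defect_adj P l g \<in> W_h P"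
      using adjoint_in[OF g(2)] by blast+
    note Qh = Qs[THEN subsetD[OF W_h_sub]]
    have "a_form P r (\<lambda>x. v x - g x) = 0" unfolding g_def by (rule rW[OF minus_I_H_in_W_h[OF v]])
    then have 1: "a_form P r v = a_form P r g"
      using sesq_on_diff(2)[OF fe_fine_subspace a_form_sesq v g(2) r] by simp
    \<comment> \<open>\<open>r\<close> does not see the correction of \<open>g\<close>, and \<open>q\<close> does not see the corrected function\<close>
    let ?t = "\<lambda>x. g x - Q_inf_adj P g x"
    have t: "?t \<in> V_h P" by (rule fun_subspaceD(4)[OF fe_fine_subspace g(2) Qh(1)])
    have "a_form P r ?t = a_form P r g"
      using sesq_on_diff(2)[OF fe_fine_subspace a_form_sesq g(2) Qh(1) r] rW[OF Qs(1)] by simp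
    moreover have "a_form P q ?t = 0"
      using sesq_on_diff(2)[OF fe_fine_subspace a_form_sesq g(2) Qh(1) q(2)] Q_inf_adj[OF g(2) q(1)] by simp
    ultimately have 2: "a_form P r g = ?R ?t" using r_diff[OF t] ae[OF t] by simp
    have y: "T_adj P l g \<in> Y_H P l" using g(1) by (auto simp: Y_H_def)
    have yh: "T_adj P l g \<in> V_h P" by (rule G_loc_antilinear(2)[OF g(2)])
    have "?t = (\<lambda>x. T_adj P l g x - defect_adj P l g x)" by (simp add: T_adj_def defect_adj_def)
    then have "?R ?t = ?R (T_adj P l g) - ?R (defect_adj P l g)"
      using antilinear_on_diff[OF fe_fine_subspace residual_antilinear yh Qh(3)] by simp
    then have "cmod (a_form P r v) = cmod (?R (defect_adj P l g))" using R0 y 1 2 by simp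
    also have "\<dots> \<le> C_sd * ?eta * knorm P (defect_adj P l g)" by (rule rel[OF Qs(3)])
    also have "\<dots> \<le> C_sd * ?eta * (D * knorm P g)"
      using C_nonneg(3) eta0 D(2)[OF g(1)] by (intro mult_left_mono) auto
    also have "\<dots> \<le> C_sd * ?eta * (D * (C_I * knorm P v))"
    proof (intro mult_left_mono)
      show "knorm P g \<le> C_I * knorm P v"
        using C_I v fe_fine_sub_V unfolding stability_constant_def g_def by blast
    qed (use C_nonneg(3) eta0 D(1) in auto)
    finally show ?thesis by (simp add: mult_ac)
  qed
  then have "inf_sup P * knorm P r \<le> C_sd * ?eta * (D * C_I)"
    using C_nonneg eta0 D(1) by (intro inf_sup_bound[OF r]) auto
  then have kr: "knorm P r \<le> C_sd * ?eta * (D * C_I) / inf_sup P" using gamma by (simp add: field_simps)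
  have "knorm P e \<le> knorm P q + knorm P r"
  proof -
    have "e = (\<lambda>x. q x + r x)" by (simp add: r_def)
    then show ?thesis using knorm_triangle[OF q(2) r] by simp
  qed
  also have "\<dots> \<le> C_sd * ?eta / cW + C_sd * ?eta * (D * C_I) / inf_sup P" using kq kr by (rule add_mono)
  also have "\<dots> = C_sd * (inverse cW + C_I / inf_sup P * D) * ?eta"
    by (simp add: field_simps)
  finally show ?thesis by (simp add: e_def)
qed

end

end

theorem theorem3p5:
  fixes P :: helmholtz
    and k_min \<sigma> C_a C_app C_I C_sd C_syn \<chi>\<^sub>0 :: real
    and F :: "field \<Rightarrow> complex" and u_h U :: field and l :: enat
  assumes "helmholtz_setting P"
    and "0 < k_min" and "k_min \<le> wavenumber P"
    and "shape_regular \<sigma> (TH P)" and "shape_regular \<sigma> (Th P)"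
    and "continuity_constant P C_a"
    and "approximation_constant P C_app"
    and "stability_constant P C_I"
    and "stable_decomposition_constant P C_sd"
    and "synthesis_constant P C_syn"
    and "chi_res P C_app \<le> \<chi>\<^sub>0" and "\<chi>\<^sub>0 < 1"
    and "0 < inf_sup P"
    and "F \<in> antidual P (V P)"
    and "galerkin_solution P F u_h"
    and "U \<in> V_h P"
    and "\<forall>y\<in>Y_H P l. residual P F U y = 0"
  shows "knorm P (\<lambda>x. u_h x - U x)
           \<le> C_sd * (inverse (c_W P C_app) + C_I * C_F P C_a C_app / inf_sup P * delta P l)
             * eta_H P F U
       \<and> eta_H P F U / (C_a * C_syn) \<le> knorm P (\<lambda>x. u_h x - U x)
       \<and> knorm P (\<lambda>x. u_h x - U x)
           \<le> C_sd * (inverse (c_W P C_app)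
                       + C_I * C_F P C_a C_app * C_sd / (inf_sup P * c_W P C_app) * Theta P l)
             * eta_H P F U"
proof -
  interpret helmholtz_constants P C_a C_app C_I C_sd C_syn
    by unfold_locales (use assms in auto)
  note gal = assms(13-17)
  let ?e = "knorm P (\<lambda>x. u_h x - U x)" and ?eta = "eta_H P F U"
  have eh: "(\<lambda>x. u_h x - U x) \<in> V_h P" by (rule error_in(2)[OF gal])
  have e0: "0 \<le> ?e" by (rule knorm_nonneg[OF eh])
  have eta0: "0 \<le> ?eta" unfolding eta_H_def by (rule eta_nonneg)
  have CF: "1 \<le> C_F P C_a C_app" using C_nonneg(1) cW_pos by (simp add: C_F_def)
  have upper: "?e \<le> C_sd * (inverse cW + C_I * C_F P C_a C_app / inf_sup P * D) * ?eta"
    if D: "0 \<le> D" "\<And>v. v \<in> V_H P \<Longrightarrow> knorm P (defect_adj P l v) \<le> D * knorm P v" for D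
  proof -
    have "?e \<le> C_sd * (inverse cW + C_I / inf_sup P * D) * ?eta" by (rule reliability[OF gal D])
    also have "\<dots> \<le> C_sd * (inverse cW + C_I * C_F P C_a C_app / inf_sup P * D) * ?eta"
    proof -
      have "C_I * 1 \<le> C_I * C_F P C_a C_app" using CF C_nonneg(2) by (intro mult_left_mono) auto
      then have "C_I / inf_sup P * D \<le> C_I * C_F P C_a C_app / inf_sup P * D"
        using assms(13) D(1) by (intro mult_right_mono divide_right_mono) auto
      then show ?thesis using C_nonneg(3) eta0 by (intro mult_right_mono mult_left_mono) auto
    qed
    finally show ?thesis .
  qed
  show ?thesis
  proof (intro conjI)
    show "?e \<le> C_sd * (inverse cW + C_I * C_F P C_a C_app / inf_sup P * delta P l) * ?eta"
      by (rule upper[OF delta_nonneg defect_adj_le_delta])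
    show "?eta / (C_a * C_syn) \<le> ?e"
    proof (cases "C_a * C_syn = 0")
      case False
      then have "0 < C_a * C_syn" using C_nonneg(1,4) by (simp add: less_le)
      then show ?thesis using efficiency[OF gal] by (simp add: divide_le_eq mult.commute)
    qed (use e0 in auto)
    have t0: "0 \<le> C_sd / cW * Theta P l" using C_nonneg(3) cW_pos Theta_nonneg by simp
    have "?e \<le> C_sd * (inverse cW + C_I * C_F P C_a C_app / inf_sup P * (C_sd / cW * Theta P l)) * ?eta"
      by (rule upper[OF t0 defect_adj_le_Theta])
    then show "?e \<le> C_sd * (inverse cW + C_I * C_F P C_a C_app * C_sd / (inf_sup P * cW) * Theta P l) * ?eta"
      by (simp add: mult.assoc)
  qed
qed

end
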